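(* Let $\mathbb{B}$ be a homogeneous, linear differential operator of order $n$ on $\mathbb{R}^n$ from $V$ to $W$ with constant coefficients that is elliptic and canceling. Then $\mathrm{BV}^{\mathbb{B}}(\mathbb{R}^n)\subset \mathrm{C}_0(\mathbb{R}^n,V)$ and this inclusion is $\mathbb{B}$-strictly continuous: if $u_j,u\in\mathrm{BV}^{\mathbb{B}}(\mathbb{R}^n)$ and $u_j\to u$ $\mathbb{B}$-strictly, then $u_j\to u$ uniformly on $\mathbb{R}^n$.
   Context: $V,W$ are finite-dimensional real inner product spaces. A homogeneous constant-coefficient linear operator of order $n$ on $\mathbb{R}^n$ from $V$ to $W$ is $\mathbb{B}u=\sum_{|\beta|=n}B_\beta\,\partial^\beta u$ with $B_\beta\in\mathrm{Lin}(V,W)$; its symbol is $\mathbb{B}(\xi)=\sum_{|\beta|=n}\xi^\beta B_\beta$. $\mathbb{B}$ is elliptic if $\ker\mathbb{B}(\xi)=\{0\}$ for all $0\neq\xi\in\mathbb{R}^n$. $\mathbb{B}$ is canceling if $\bigcap_{\xi\in\mathbb{S}^{n-1}}\mathrm{im}\,\mathbb{B}(\xi)=\{0\}$. $\mathrm{BV}^{\mathbb{B}}(\mathbb{R}^n)=\{u\in \mathrm{W}^{n-1,1}(\mathbb{R}^n,V):\mathbb{B}u\in\mathcal{M}(\mathbb{R}^n,W)\}$, where $\mathcal{M}$ denotes finite vector-valued measures and $|\mu|$ the total variation measure of $\mu$. $u_j\to u$ $\mathbb{B}$-strictly means $u_j\to u$ in $\mathrm{W}^{n-1,1}(\mathbb{R}^n,V)$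 and $|\mathbb{B}u_j|(\mathbb{R}^n)\to|\mathbb{B}u|(\mathbb{R}^n)$. $\mathrm{C}_0(\mathbb{R}^n,V)$ is the Banach space of continuous $V$-valued functions vanishing at infinity, with the supremum norm; elements of $\mathrm{BV}^{\mathbb{B}}(\mathbb{R}^n)$ are identified with their continuous representatives. *)

theory Defs
  imports "HOL-Analysis.Analysis"
begin

definition mi_order :: "('n::finite \<Rightarrow> nat) \<Rightarrow> nat" where
  "mi_order \<beta> = (\<Sum>i\<in>UNIV. \<beta> i)"

definition mi_power :: "real ^ 'n::finite \<Rightarrow> ('n \<Rightarrow> nat) \<Rightarrow> real" where
  "mi_power \<xi> \<beta> = (\<Prod>i\<in>UNIV. (\<xi> $ i) ^ \<beta> i)"

text \<open>The sums over multi-indices below range over finite sets.\<close>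

lemma finite_mi_order_le: "finite {\<beta> :: 'n::finite \<Rightarrow> nat. mi_order \<beta> \<le> k}"
proof (rule finite_subset)
  show "{\<beta> :: 'n \<Rightarrow> nat. mi_order \<beta> \<le> k} \<subseteq> PiE UNIV (\<lambda>_. {..k})"
  proof
    fix \<beta> :: "'n \<Rightarrow> nat"
    assume "\<beta> \<in> {\<beta>. mi_order \<beta> \<le> k}"
    moreover have "\<beta> i \<le> mi_order \<beta>" for i
      unfolding mi_order_def by (rule member_le_sum) auto
    ultimately show "\<beta> \<in> PiE UNIV (\<lambda>_. {..k})"
      by (auto intro: order_trans)
  qed
  show "finite (PiE (UNIV :: 'n set) (\<lambda>_. {..k}))"
    by (rule finite_PiE) auto
qed

lemma finite_mi_order_eq: "finite {\<beta> :: 'n::finite \<Rightarrow> nat. mi_order \<beta> = k}"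
  by (rule finite_subset [OF _ finite_mi_order_le [of k]]) auto

definition pd :: "'n::finite \<Rightarrow> (real ^ 'n \<Rightarrow> real) \<Rightarrow> real ^ 'n \<Rightarrow> real" where
  "pd i f = (\<lambda>x. frechet_derivative f (at x) (axis i 1))"

text \<open>A finite type carries no canonical order, so the coordinates are enumerated
  arbitrarily; \<open>mi_deriv\<close> is only applied to smooth functions, for which the order of
  differentiation is immaterial.\<close>

definition coords :: "'n::finite list" where
  "coords = (SOME is. set is = UNIV \<and> distinct is)"

definition mi_deriv :: "('n::finite \<Rightarrow> nat) \<Rightarrow> (real ^ 'n \<Rightarrow> real) \<Rightarrow> real ^ 'n \<Rightarrow> real" where
  "mi_deriv \<beta> f = foldr (\<lambda>i. pd i ^^ \<beta> i) coords f"

text \<open>All iterated partial derivatives (over all words of directions) are everywhere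
  Frechet differentiable, hence continuous: this is \<open>C\<^sup>\<infinity>\<close>.\<close>

definition smooth :: "(real ^ 'n::finite \<Rightarrow> real) \<Rightarrow> bool" where
  "smooth f \<longleftrightarrow> (\<forall>is. foldr pd is f differentiable_on UNIV)"

definition test_functions :: "(real ^ 'n::finite \<Rightarrow> real) set" where
  "test_functions = {\<phi>. smooth \<phi> \<and> compact (closure {x. \<phi> x \<noteq> 0})}"

text \<open>An operator of order \<open>k\<close> is given by its coefficients \<open>B \<beta> \<in> Lin(V,W)\<close>, where only the
  multi-indices of order \<open>k\<close> are ever used. As \<open>V\<close> is finite-dimensional, \<open>Lin(V,W)\<close> is the
  type of bounded linear maps.\<close>

definition symbol ::
  "nat \<Rightarrow> (('n::finite \<Rightarrow> nat) \<Rightarrow> 'v::euclidean_space \<Rightarrow>\<^sub>L 'w::euclidean_space)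
    \<Rightarrow> real ^ 'n \<Rightarrow> 'v \<Rightarrow>\<^sub>L 'w" where
  "symbol k B \<xi> = (\<Sum>\<beta> | mi_order \<beta> = k. mi_power \<xi> \<beta> *\<^sub>R B \<beta>)"

definition elliptic ::
  "nat \<Rightarrow> (('n::finite \<Rightarrow> nat) \<Rightarrow> 'v::euclidean_space \<Rightarrow>\<^sub>L 'w::euclidean_space) \<Rightarrow> bool" where
  "elliptic k B \<longleftrightarrow> (\<forall>\<xi>. \<xi> \<noteq> 0 \<longrightarrow> {v. blinfun_apply (symbol k B \<xi>) v = 0} = {0})"

definition canceling ::
  "nat \<Rightarrow> (('n::finite \<Rightarrow> nat) \<Rightarrow> 'v::euclidean_space \<Rightarrow>\<^sub>L 'w::euclidean_space) \<Rightarrow> bool" where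
  "canceling k B \<longleftrightarrow> (\<Inter>\<xi>\<in>sphere 0 1. range (blinfun_apply (symbol k B \<xi>))) = {0}"

text \<open>Elements are functions rather than classes; every notion below is invariant under
  modification on a null set.\<close>

definition locally_integrable :: "(real ^ 'n::finite \<Rightarrow> 'v::euclidean_space) \<Rightarrow> bool" where
  "locally_integrable u \<longleftrightarrow> (\<forall>K. compact K \<longrightarrow> set_integrable lebesgue K u)"

definition has_weak_deriv ::
  "('n::finite \<Rightarrow> nat) \<Rightarrow> (real ^ 'n \<Rightarrow> 'v::euclidean_space) \<Rightarrow> (real ^ 'n \<Rightarrow> 'v) \<Rightarrow> bool" where
  "has_weak_deriv \<beta> u g \<longleftrightarrow> locally_integrable u \<and> locally_integrable g \<and>
     (\<forall>\<phi>\<in>test_functions.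
        (LINT x|lebesgue. mi_deriv \<beta> \<phi> x *\<^sub>R u x)
          = (-1) ^ mi_order \<beta> *\<^sub>R (LINT x|lebesgue. \<phi> x *\<^sub>R g x))"

text \<open>Weak derivatives are unique up to null sets, so the choice does not affect integrals.\<close>

definition weak_deriv ::
  "('n::finite \<Rightarrow> nat) \<Rightarrow> (real ^ 'n \<Rightarrow> 'v::euclidean_space) \<Rightarrow> real ^ 'n \<Rightarrow> 'v" where
  "weak_deriv \<beta> u = (SOME g. has_weak_deriv \<beta> u g)"

definition sobolev1 :: "nat \<Rightarrow> (real ^ 'n::finite \<Rightarrow> 'v::euclidean_space) set" where
  "sobolev1 k = {u. \<forall>\<beta>. mi_order \<beta> \<le> k \<longrightarrow>
                     (\<exists>g. has_weak_deriv \<beta> u g \<and> integrable lebesgue g)}"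

definition sobolev1_norm :: "nat \<Rightarrow> (real ^ 'n::finite \<Rightarrow> 'v::euclidean_space) \<Rightarrow> real" where
  "sobolev1_norm k u =
     (\<Sum>\<beta> | mi_order \<beta> \<le> k. LINT x|lebesgue. norm (weak_deriv \<beta> u x))"

text \<open>A vector measure is a set function; its values off the Borel sets are irrelevant.\<close>

definition total_variation ::
  "((real ^ 'n::finite) set \<Rightarrow> 'w::euclidean_space) \<Rightarrow> (real ^ 'n) set \<Rightarrow> ennreal" where
  "total_variation \<mu> A =
     (SUP P \<in> {P. finite P \<and> P \<subseteq> sets borel \<and> partition_on A P}. \<Sum>E\<in>P. ennreal (norm (\<mu> E)))"

definition finite_vector_measure ::
  "((real ^ 'n::finite) set \<Rightarrow> 'w::euclidean_space) \<Rightarrow> bool" where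
  "finite_vector_measure \<mu> \<longleftrightarrow>
     (\<forall>A :: nat \<Rightarrow> (real ^ 'n) set. range A \<subseteq> sets borel \<longrightarrow> disjoint_family A \<longrightarrow>
        (\<lambda>i. \<mu> (A i)) sums \<mu> (\<Union>i. A i)) \<and>
     total_variation \<mu> UNIV < \<infinity>"

text \<open>Positive part of the Jordan decomposition of a real measure \<open>\<nu>\<close>:
  \<open>\<nu>\<^sup>+(A) = sup {\<nu>(E) : E \<subseteq> A Borel}\<close>, and \<open>\<nu>\<^sup>- = (-\<nu>)\<^sup>+\<close>. The supremum includes
  \<open>\<nu>({}) = 0\<close>, so truncation of negative values by \<open>ennreal\<close> is harmless.\<close>

definition positive_variation :: "((real ^ 'n::finite) set \<Rightarrow> real) \<Rightarrow> (real ^ 'n) measure" where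
  "positive_variation \<nu> =
     measure_of UNIV (sets borel) (\<lambda>A. SUP E \<in> {E \<in> sets borel. E \<subseteq> A}. ennreal (\<nu> E))"

definition signed_integral ::
  "((real ^ 'n::finite) set \<Rightarrow> real) \<Rightarrow> (real ^ 'n \<Rightarrow> real) \<Rightarrow> real" where
  "signed_integral \<nu> \<phi> =
     (LINT x|positive_variation \<nu>. \<phi> x) - (LINT x|positive_variation (\<lambda>E. - \<nu> E). \<phi> x)"

definition vector_integral ::
  "((real ^ 'n::finite) set \<Rightarrow> 'w::euclidean_space) \<Rightarrow> (real ^ 'n \<Rightarrow> real) \<Rightarrow> 'w" where
  "vector_integral \<mu> \<phi> = (\<Sum>b\<in>Basis. signed_integral (\<lambda>E. \<mu> E \<bullet> b) \<phi> *\<^sub>R b)"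

text \<open>The distribution \<open>\<Sum>\<^sub>\<beta> B\<^sub>\<beta> \<partial>\<^sup>\<beta> u\<close> tested against \<open>\<phi>\<close>.\<close>

definition op_dist ::
  "nat \<Rightarrow> (('n::finite \<Rightarrow> nat) \<Rightarrow> 'v::euclidean_space \<Rightarrow>\<^sub>L 'w::euclidean_space)
    \<Rightarrow> (real ^ 'n \<Rightarrow> 'v) \<Rightarrow> (real ^ 'n \<Rightarrow> real) \<Rightarrow> 'w" where
  "op_dist k B u \<phi> =
     (\<Sum>\<beta> | mi_order \<beta> = k.
        (-1) ^ k *\<^sub>R blinfun_apply (B \<beta>) (LINT x|lebesgue. mi_deriv \<beta> \<phi> x *\<^sub>R u x))"

definition is_op_measure ::
  "nat \<Rightarrow> (('n::finite \<Rightarrow> nat) \<Rightarrow> 'v::euclidean_space \<Rightarrow>\<^sub>L 'w::euclidean_space)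
    \<Rightarrow> (real ^ 'n \<Rightarrow> 'v) \<Rightarrow> ((real ^ 'n) set \<Rightarrow> 'w) \<Rightarrow> bool" where
  "is_op_measure k B u \<mu> \<longleftrightarrow> finite_vector_measure \<mu> \<and>
     (\<forall>\<phi>\<in>test_functions. op_dist k B u \<phi> = vector_integral \<mu> \<phi>)"

text \<open>\<open>Bu\<close> as a measure; it is unique on the Borel sets, hence so is its total variation.\<close>

definition op_measure ::
  "nat \<Rightarrow> (('n::finite \<Rightarrow> nat) \<Rightarrow> 'v::euclidean_space \<Rightarrow>\<^sub>L 'w::euclidean_space)
    \<Rightarrow> (real ^ 'n \<Rightarrow> 'v) \<Rightarrow> (real ^ 'n) set \<Rightarrow> 'w" where
  "op_measure k B u = (SOME \<mu>. is_op_measure k B u \<mu>)"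

definition BV ::
  "nat \<Rightarrow> (('n::finite \<Rightarrow> nat) \<Rightarrow> 'v::euclidean_space \<Rightarrow>\<^sub>L 'w::euclidean_space)
    \<Rightarrow> (real ^ 'n \<Rightarrow> 'v) set" where
  "BV k B = {u \<in> sobolev1 (k - 1). \<exists>\<mu>. is_op_measure k B u \<mu>}"

definition strictly_converges ::
  "nat \<Rightarrow> (('n::finite \<Rightarrow> nat) \<Rightarrow> 'v::euclidean_space \<Rightarrow>\<^sub>L 'w::euclidean_space)
    \<Rightarrow> (nat \<Rightarrow> real ^ 'n \<Rightarrow> 'v) \<Rightarrow> (real ^ 'n \<Rightarrow> 'v) \<Rightarrow> bool" where
  "strictly_converges k B us u \<longleftrightarrow>
     (\<lambda>j. sobolev1_norm (k - 1) (\<lambda>x. us j x - u x)) \<longlonglongrightarrow> 0 \<and>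
     (\<lambda>j. total_variation (op_measure k B (us j)) UNIV)
        \<longlonglongrightarrow> total_variation (op_measure k B u) UNIV"

definition C0 :: "(real ^ 'n::finite \<Rightarrow> 'v::euclidean_space) set" where
  "C0 = {v. continuous_on UNIV v \<and> (v \<longlongrightarrow> 0) at_infinity}"

definition continuous_representative ::
  "(real ^ 'n::finite \<Rightarrow> 'v::euclidean_space) \<Rightarrow> (real ^ 'n \<Rightarrow> 'v) \<Rightarrow> bool" where
  "continuous_representative u v \<longleftrightarrow> continuous_on UNIV v \<and> (AE x in lebesgue. u x = v x)"

end

theory Submission
  imports Defs "HOL-Probability.Probability"
begin

text \<open>
  Only \<open>L\<^sup>1\<close>-convergence of \<open>u\<^sub>j\<close> and the convergence of the total masses are used. With
  \<open>P\<^sub>j\<close> the Fourier multiplier of a radial cutoff at frequency \<open>2\<^sup>j\<close>, the dyadic piece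
  \<open>v \<bullet> (P\<^sub>j\<^sub>+\<^sub>1 u - P\<^sub>j u)(x)\<close> is \<open>\<integral> \<kappa>(2\<^sup>j\<^sup>+\<^sup>1 (y - x)) \<bullet> d\<bbbB>u(y)\<close>, where \<open>\<kappa>\<close> has no scaling factor in
  front because the order of \<open>\<bbbB>\<close> equals the dimension, and where ellipticity gives
  \<open>\<kappa>(z) = O(1 / \<bar>z\<bar>)\<close>. As \<open>\<bbbB>u\<close> is annihilated by the orthogonal projection \<open>\<Pi>(\<xi>)\<close> onto the
  complement of \<open>im \<bbbB>(\<xi>)\<close>, and as canceling makes the mean of \<open>\<Pi>\<close> invertible, \<open>\<kappa>\<close> may be
  corrected so that also \<open>\<kappa>(z) = O(\<bar>z\<bar>)\<close>. Summing over the scales \<open>j \<ge> b\<close>,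
  the distance of \<open>P\<^sub>b u\<close> to its limit at \<open>x\<close> is at most a constant times
  \<open>\<bar>\<bbbB>u\<bar>(ball x r) + \<bar>\<bbbB>u\<bar>(\<real>\<^sup>n) / (2\<^sup>b r)\<close>. The same projections show that \<open>\<bbbB>u\<close> has no
  atoms, so by lower semicontinuity of the total variation \<open>\<bar>\<bbbB>u\<^sub>j\<bar>(ball x r)\<close> is small for small \<open>r\<close>,
  uniformly in \<open>x\<close> and in large \<open>j\<close>. Everything is written with real cosines
  \<open>cos (\<xi> \<bullet> x + t)\<close>; differentiation shifts the phase \<open>t\<close> by \<open>\<pi>/2\<close>.
\<close>

text \<open>Cutoffs and projections are only Lipschitz here, so kernels are known to decay like
  1/|z| and no faster. This suffices for the dyadic pieces, since min(|z|, 1/|z|) is summable over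
  the scales, but it does not make the kernel of one \<open>lowpass\<close> integrable, so P_j f ->
  f cannot be read off from an approximate identity. Instead the Cauchy estimate provides some
  limit, which is identified with u by moving \<open>lowpass\<close> onto Gaussians, whose
  transforms are explicit. The factor (2 pi)^{-n} is never inserted; limits carry (2 pi)^n, which is
  \<open>gauss_mass\<close> squared.

  Two sizes of a vector measure are kept. \<open>tv\<close> is the exact total variation: lower
  semicontinuity must hold with constant 1 for strict convergence to control closed sets.
  \<open>var\<close> adds up the Jordan parts of the components; it is additive and bounds
  integrals. The two agree up to the factor 2 dim W, harmless since only smallness matters.

  The constant in the scale estimate is independent of u, so one radius and one scale serve a whole
  strictly convergent sequence.\<close>

section \<open>Smooth functions and bumps\<close>

text \<open>Carrying the powers of \<open>inverse t\<close> keeps the family closed under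
  differentiation, so one derivative formula for all \<open>m\<close> yields the smoothness of the
  standard flat function \<open>flat_exp 0\<close>.\<close>

definition flat_exp :: "nat \<Rightarrow> real \<Rightarrow> real" where
  "flat_exp m t = (if t > 0 then exp (- inverse t) * inverse t ^ m else 0)"

text \<open>With s = 1/t the claim is that s^(m+2) / exp s is bounded. A bound by t^2 gives the
  difference quotient at 0 the limit 0, at the one point where the derivative cannot be computed
  from a formula valid nearby.\<close>

lemma flat_exp_small: "\<exists>C. \<forall>t>0. flat_exp m t \<le> C * t\<^sup>2"
proof -
  have "((\<lambda>s::real. s ^ (m + 2) / exp s) \<longlongrightarrow> 0) at_top"
    by (rule tendsto_power_div_exp_0)
  then have "\<forall>\<^sub>F s in at_top. s ^ (m + 2) / exp s < (1::real)"
    by (rule order_tendstoD) simp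
  then obtain N where N: "\<And>s. s \<ge> N \<Longrightarrow> s ^ (m + 2) / exp s < (1::real)"
    unfolding eventually_at_top_linorder by blast
  \<comment> \<open>Beyond \<open>N\<close> the quotient is below 1; up to \<open>N\<close> its
    denominator is at least 1 and its numerator at most \<open>N\<close> to the power m + 2.\<close>
  define C where "C = 1 + (max 0 N) ^ (m + 2)"
  have "s ^ (m + 2) / exp s \<le> C" if "s > 0" for s :: real
  proof (cases "s \<ge> N")
    case True
    then show ?thesis using N[of s] by (simp add: C_def add_increasing2)
  next
    case False
    have "s ^ (m + 2) / exp s \<le> s ^ (m + 2) / 1"
      by (rule divide_left_mono) (use that in auto)
    also have "\<dots> \<le> C" unfolding C_def
      using power_mono[of s "max 0 N" "m + 2"] that False by auto
    finally show ?thesis .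
  qed
  note C = this
  have "flat_exp m t \<le> C * t\<^sup>2" if "t > 0" for t
  proof -
    have "flat_exp m t = (inverse t) ^ (m + 2) / exp (inverse t) * t\<^sup>2"
      using that by (simp add: flat_exp_def exp_minus field_simps power_add power2_eq_square)
    also have "\<dots> \<le> C * t\<^sup>2"
      using C[of "inverse t"] that by (intro mult_right_mono) auto
    finally show ?thesis .
  qed
  then show ?thesis by blast
qed

lemma flat_exp_deriv:
  "(flat_exp m has_real_derivative (flat_exp (m + 2) t - real m * flat_exp (m + 1) t)) (at t)"
proof (cases t "0::real" rule: linorder_cases)
  case less
  have "((\<lambda>_. 0) has_real_derivative 0) (at t)" by simp
  then have "(flat_exp m has_real_derivative 0) (at t)"
    by (rule has_field_derivative_transform_within_open[where S="{..<0}"])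
       (use less in \<open>auto simp: flat_exp_def\<close>)
  then show ?thesis using less by (simp add: flat_exp_def)
next
  case greater
  have "((\<lambda>t. exp (- inverse t) * inverse t ^ m) has_real_derivative
      (flat_exp (m + 2) t - real m * flat_exp (m + 1) t)) (at t)"
  proof -
    have inv: "(inverse has_real_derivative - (inverse t * inverse t)) (at t)"
      using greater by (auto intro!: derivative_eq_intros simp: power2_eq_square)
    have "((\<lambda>t. inverse t ^ m) has_real_derivative - (real m * inverse t ^ (m + 1))) (at t)"
    proof (cases m)
      case (Suc k)
      show ?thesis
        by (rule DERIV_cong[OF DERIV_power[OF inv]]) (simp add: Suc algebra_simps)
    qed simp
    moreover have "((\<lambda>t. exp (- inverse t)) has_real_derivative
        exp (- inverse t) * (inverse t * inverse t)) (at t)"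
      using DERIV_fun_exp[OF DERIV_minus[OF inv]] by simp
    ultimately have "((\<lambda>t. exp (- inverse t) * inverse t ^ m) has_real_derivative
        exp (- inverse t) * (inverse t * inverse t) * inverse t ^ m
         + - (real m * inverse t ^ (m + 1)) * exp (- inverse t)) (at t)"
      by (rule DERIV_mult[rotated])
    then show ?thesis
      by (rule DERIV_cong) (use greater in \<open>simp add: flat_exp_def algebra_simps\<close>)
  qed
  then show ?thesis
    by (rule has_field_derivative_transform_within_open[where S="{0<..}"])
       (use greater in \<open>auto simp: flat_exp_def\<close>)
next
  case equal
  obtain C where C: "\<And>t. t > 0 \<Longrightarrow> flat_exp m t \<le> C * t\<^sup>2" using flat_exp_small[of m] by blast
  have "(flat_exp m has_real_derivative 0) (at 0)"
    unfolding has_field_derivative_iff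
  proof (rule Lim_null_comparison)
    show "\<forall>\<^sub>F h in at 0. norm ((flat_exp m h - flat_exp m 0) / (h - 0)) \<le> \<bar>C\<bar> * \<bar>h\<bar>"
    proof (rule always_eventually, rule allI)
      fix h :: real
      show "norm ((flat_exp m h - flat_exp m 0) / (h - 0)) \<le> \<bar>C\<bar> * \<bar>h\<bar>"
      proof (cases "h > 0")
        case True
        have "flat_exp m h \<le> \<bar>C\<bar> * h\<^sup>2"
          using C[OF True] by (smt (verit) mult_right_mono zero_le_power2)
        moreover have "flat_exp m h \<ge> 0" by (simp add: flat_exp_def)
        ultimately show ?thesis using True
          by (simp add: flat_exp_def power2_eq_square divide_le_eq)
      qed (simp add: flat_exp_def mult_le_0_iff not_less)
    qed
    show "((\<lambda>h. \<bar>C\<bar> * \<bar>h\<bar>) \<longlongrightarrow> 0) (at (0::real))"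
      by (auto intro!: tendsto_eq_intros)
  qed
  then show ?thesis using equal by (simp add: flat_exp_def)
qed

lemma pd_eq:
  assumes "(f has_derivative D) (at x)"
  shows "pd i f x = D (axis i 1)"
  using frechet_derivative_at[OF assms] by (simp add: pd_def)

lemma sin_shift: "cos (x + pi / 2) = - sin x"
  by (simp add: cos_add)

section \<open>A class of smooth functions closed under differentiation\<close>

definition bump :: "nat \<Rightarrow> real \<Rightarrow> real ^ 'n::finite \<Rightarrow> real ^ 'n \<Rightarrow> real" where
  "bump m s c x = flat_exp m (1 - s * ((x - c) \<bullet> (x - c)))"

text \<open>The predicate \<open>smooth\<close> quantifies over all words of derivatives and is not
  visibly stable under products. This syntactic class contains every concrete function needed and is
  closed under \<open>pd\<close>, so smoothness follows by induction on the word.\<close>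

inductive smooth_expr :: "(real ^ 'n::finite \<Rightarrow> real) \<Rightarrow> bool" where
  const: "smooth_expr (\<lambda>_. a)"
| coord: "smooth_expr (\<lambda>x. x $ i)"
| bump: "smooth_expr (bump m s c)"
| cos: "smooth_expr (\<lambda>x. cos (\<xi> \<bullet> x + t))"
| add: "smooth_expr f \<Longrightarrow> smooth_expr g \<Longrightarrow> smooth_expr (\<lambda>x. f x + g x)"
| mult: "smooth_expr f \<Longrightarrow> smooth_expr g \<Longrightarrow> smooth_expr (\<lambda>x. f x * g x)"

lemma bump_has_derivative:
  "(bump m s c has_derivative
     (\<lambda>h. (bump (m + 2) s c x - real m * bump (m + 1) s c x) * (- 2 * s * ((x - c) \<bullet> h)))) (at x)"
proof -
  have "((\<lambda>x. 1 - s * ((x - c) \<bullet> (x - c))) has_derivative (\<lambda>h. - 2 * s * ((x - c) \<bullet> h))) (at x)"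
    by (auto intro!: derivative_eq_intros simp: inner_commute algebra_simps)
  from DERIV_compose_FDERIV[OF flat_exp_deriv this] show ?thesis
    by (simp add: bump_def[abs_def] mult.commute)
qed

lemma smooth_expr_pd:
  assumes "smooth_expr f"
  shows "(\<forall>x. f differentiable (at x)) \<and> (\<forall>i. smooth_expr (pd i f))"
  using assms
proof induction
  case (const a)
  have "pd i (\<lambda>_. a) = (\<lambda>_. 0)" for i :: 'a
    by (rule ext) (simp add: pd_eq[OF has_derivative_const])
  then show ?case by (auto intro: smooth_expr.const)
next
  case (coord j)
  have D: "((\<lambda>x. x $ j) has_derivative (\<lambda>h. h $ j)) (at x)" for x :: "real ^ 'a"
    by (rule bounded_linear_imp_has_derivative) (rule bounded_linear_vec_nth)
  have "pd i (\<lambda>x. x $ j) = (\<lambda>_. (axis i 1 :: real ^ 'a) $ j)" for i :: 'a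
    by (rule ext) (simp add: pd_eq[OF D])
  then show ?case using D by (auto intro: smooth_expr.const simp: differentiable_def)
next
  case (bump m s c)
  have "smooth_expr (pd i (bump m s c))" for i
  proof -
    have eq: "pd i (bump m s c) = (\<lambda>x. (bump (m + 2) s c x + (- real m) * bump (m + 1) s c x)
        * ((- 2 * s) * (x $ i + (- (c $ i)))))"
      by (rule ext) (simp add: pd_eq[OF bump_has_derivative] inner_axis)
    show ?thesis unfolding eq by (intro smooth_expr.intros)
  qed
  then show ?case using bump_has_derivative unfolding differentiable_def by blast
next
  case (cos \<xi> t)
  have D: "((\<lambda>x. cos (\<xi> \<bullet> x + t)) has_derivative (\<lambda>h. - sin (\<xi> \<bullet> x + t) * (\<xi> \<bullet> h))) (at x)" for x
    by (auto intro!: derivative_eq_intros simp: algebra_simps)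
  have "smooth_expr (pd i (\<lambda>x. cos (\<xi> \<bullet> x + t)))" for i
  proof -
    have eq: "pd i (\<lambda>x. cos (\<xi> \<bullet> x + t)) = (\<lambda>x. cos (\<xi> \<bullet> x + (t + pi / 2)) * \<xi> $ i)"
      by (rule ext) (simp add: pd_eq[OF D] inner_axis sin_shift add.assoc[symmetric])
    show ?thesis unfolding eq by (intro smooth_expr.intros)
  qed
  then show ?case using D by (auto simp: differentiable_def)
next
  case (add f g)
  have "(\<lambda>x. f x + g x) differentiable (at x)" for x using add by auto
  moreover have "pd i (\<lambda>x. f x + g x) = (\<lambda>x. pd i f x + pd i g x)" for i
  proof
    fix x
    from add have "(f has_derivative frechet_derivative f (at x)) (at x)"
      "(g has_derivative frechet_derivative g (at x)) (at x)"
      by (auto simp: frechet_derivative_works[symmetric])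
    from pd_eq[OF has_derivative_add[OF this]]
    show "pd i (\<lambda>x. f x + g x) x = pd i f x + pd i g x" by (simp add: pd_def)
  qed
  ultimately show ?case using add by (auto intro: smooth_expr.intros)
next
  case (mult f g)
  have "(\<lambda>x. f x * g x) differentiable (at x)" for x using mult by auto
  moreover have "pd i (\<lambda>x. f x * g x) = (\<lambda>x. f x * pd i g x + pd i f x * g x)" for i
  proof
    fix x
    from mult have "(f has_derivative frechet_derivative f (at x)) (at x)"
      "(g has_derivative frechet_derivative g (at x)) (at x)"
      by (auto simp: frechet_derivative_works[symmetric])
    from pd_eq[OF has_derivative_mult[OF this]]
    show "pd i (\<lambda>x. f x * g x) x = f x * pd i g x + pd i f x * g x" by (simp add: pd_def)
  qed
  ultimately show ?case using mult by (auto intro!: smooth_expr.intros)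
qed

lemma foldr_pd_snoc: "foldr pd (is @ [i]) f = foldr pd is (pd i f)"
  by simp

lemma smooth_expr_foldr: "smooth_expr f \<Longrightarrow> smooth_expr (foldr pd is f)"
  by (induction "is") (use smooth_expr_pd in auto)

lemma smooth_expr_imp_smooth: "smooth_expr f \<Longrightarrow> smooth f"
  unfolding smooth_def differentiable_on_def
  by (meson smooth_expr_foldr smooth_expr_pd differentiable_at_withinI)

lemma smooth_expr_differentiable: "smooth_expr f \<Longrightarrow> f differentiable (at x)"
  using smooth_expr_pd by blast

lemma smooth_expr_continuous: "smooth_expr f \<Longrightarrow> continuous_on UNIV f"
  by (meson smooth_expr_differentiable differentiable_imp_continuous_within
      continuous_at_imp_continuous_on)

section \<open>Iterated derivatives of sums, products, dilations and cosines\<close>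

lemma pd_add:
  assumes "smooth_expr f" "smooth_expr g"
  shows "pd i (\<lambda>x. f x + g x) = (\<lambda>x. pd i f x + pd i g x)"
proof
  fix x
  have "(f has_derivative frechet_derivative f (at x)) (at x)"
    "(g has_derivative frechet_derivative g (at x)) (at x)"
    using assms by (auto simp: frechet_derivative_works[symmetric] smooth_expr_differentiable)
  from pd_eq[OF has_derivative_add[OF this]]
  show "pd i (\<lambda>x. f x + g x) x = pd i f x + pd i g x" by (simp add: pd_def)
qed

lemma pd_mult:
  assumes "smooth_expr f" "smooth_expr g"
  shows "pd i (\<lambda>x. f x * g x) = (\<lambda>x. f x * pd i g x + pd i f x * g x)"
proof
  fix x
  have "(f has_derivative frechet_derivative f (at x)) (at x)"
    "(g has_derivative frechet_derivative g (at x)) (at x)"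
    using assms by (auto simp: frechet_derivative_works[symmetric] smooth_expr_differentiable)
  from pd_eq[OF has_derivative_mult[OF this]]
  show "pd i (\<lambda>x. f x * g x) x = f x * pd i g x + pd i f x * g x" by (simp add: pd_def)
qed

lemma foldr_pd_add:
  assumes "smooth_expr f" "smooth_expr g"
  shows "foldr pd is (\<lambda>x. f x + g x) = (\<lambda>x. foldr pd is f x + foldr pd is g x)"
  by (induction "is") (simp_all add: pd_add smooth_expr_foldr assms)

text \<open>The last letter of a word is the derivative applied first, so induction from the right
  meets products again; the product rule doubles the number of terms with every letter, hence the
  power of 2.\<close>

lemma foldr_pd_mult_bound:
  assumes "smooth_expr f" "smooth_expr g"
    and "\<And>js x. length js \<le> length is \<Longrightarrow> \<bar>foldr pd js f x\<bar> \<le> C"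
    and "\<And>js x. length js \<le> length is \<Longrightarrow> \<bar>foldr pd js g x\<bar> \<le> D"
    and "C \<ge> 0" "D \<ge> 0"
  shows "\<bar>foldr pd is (\<lambda>x. f x * g x) x\<bar> \<le> 2 ^ length is * C * D"
  using assms
proof (induction "is" arbitrary: f g x rule: rev_induct)
  case Nil
  from Nil(3)[of "[]" x] Nil(4)[of "[]" x] Nil(5,6) show ?case
    by (simp add: abs_mult mult_mono)
next
  case (snoc i "is")
  have *: "foldr pd (is @ [i]) (\<lambda>x. f x * g x) =
      (\<lambda>x. foldr pd is (\<lambda>x. f x * pd i g x) x + foldr pd is (\<lambda>x. pd i f x * g x) x)"
    unfolding foldr_pd_snoc pd_mult[OF snoc.prems(1,2)]
    by (rule foldr_pd_add) (use snoc.prems in \<open>auto intro!: smooth_expr.intros simp: smooth_expr_pd\<close>)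
  have "\<bar>foldr pd is (\<lambda>x. f x * pd i g x) x\<bar> \<le> 2 ^ length is * C * D"
  proof (rule snoc.IH)
    fix js :: "'a list" and x assume "length js \<le> length is"
    then show "\<bar>foldr pd js (pd i g) x\<bar> \<le> D"
      using snoc.prems(4)[of "js @ [i]" x] by simp
  qed (use snoc.prems in \<open>auto simp: smooth_expr_pd\<close>)
  moreover have "\<bar>foldr pd is (\<lambda>x. pd i f x * g x) x\<bar> \<le> 2 ^ length is * C * D"
  proof (rule snoc.IH)
    fix js :: "'a list" and x assume "length js \<le> length is"
    then show "\<bar>foldr pd js (pd i f) x\<bar> \<le> C"
      using snoc.prems(3)[of "js @ [i]" x] by simp
  qed (use snoc.prems in \<open>auto simp: smooth_expr_pd\<close>)
  ultimately show ?case unfolding * by simp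
qed

text \<open>If the derivatives of \<open>g\<close> of positive order are small, differentiating \<open>f * g\<close> amounts to
  differentiating \<open>f\<close> only.\<close>

lemma foldr_pd_mult_almost:
  assumes "smooth_expr f" "smooth_expr g"
    and "\<And>js x. length js \<le> length is \<Longrightarrow> \<bar>foldr pd js f x\<bar> \<le> C"
    and "\<And>js x. js \<noteq> [] \<Longrightarrow> length js \<le> length is \<Longrightarrow> \<bar>foldr pd js g x\<bar> \<le> D"
    and "C \<ge> 0" "D \<ge> 0"
  shows "\<bar>foldr pd is (\<lambda>x. f x * g x) x - foldr pd is f x * g x\<bar> \<le> 2 ^ length is * C * D"
  using assms
proof (induction "is" arbitrary: f x rule: rev_induct)
  case Nil
  then show ?case by simp
next
  case (snoc i "is")
  have *: "foldr pd (is @ [i]) (\<lambda>x. f x * g x) =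
      (\<lambda>x. foldr pd is (\<lambda>x. f x * pd i g x) x + foldr pd is (\<lambda>x. pd i f x * g x) x)"
    unfolding foldr_pd_snoc pd_mult[OF snoc.prems(1,2)]
    by (rule foldr_pd_add) (use snoc.prems in \<open>auto intro!: smooth_expr.intros simp: smooth_expr_pd\<close>)
  \<comment> \<open>Once a derivative has fallen on \<open>g\<close> the term is small whatever
    follows; only the other summand needs the induction hypothesis.\<close>
  have "\<bar>foldr pd is (\<lambda>x. f x * pd i g x) x\<bar> \<le> 2 ^ length is * C * D"
  proof (rule foldr_pd_mult_bound)
    fix js :: "'a list" and x assume "length js \<le> length is"
    then show "\<bar>foldr pd js (pd i g) x\<bar> \<le> D"
      using snoc.prems(4)[of "js @ [i]" x] by simp
  qed (use snoc.prems in \<open>auto simp: smooth_expr_pd\<close>)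
  moreover have "\<bar>foldr pd is (\<lambda>x. pd i f x * g x) x - foldr pd is (pd i f) x * g x\<bar>
      \<le> 2 ^ length is * C * D"
  proof (rule snoc.IH)
    fix js :: "'a list" and x assume "length js \<le> length is"
    then show "\<bar>foldr pd js (pd i f) x\<bar> \<le> C"
      using snoc.prems(3)[of "js @ [i]" x] by simp
  qed (use snoc.prems in \<open>auto simp: smooth_expr_pd\<close>)
  ultimately show ?case unfolding * by simp
qed

lemma foldr_pd_scale:
  assumes "smooth_expr f" "\<And>x. smooth_expr (\<lambda>x. f (r *\<^sub>R x))"
  shows "foldr pd is (\<lambda>x. f (r *\<^sub>R x)) = (\<lambda>x. r ^ length is * foldr pd is f (r *\<^sub>R x))"
proof (induction "is")
  case (Cons i "is")
  let ?g = "foldr pd is f"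
  have "pd i (\<lambda>x. r ^ length is * ?g (r *\<^sub>R x)) x = r ^ Suc (length is) * pd i ?g (r *\<^sub>R x)" for x
  proof -
    have "?g differentiable at (r *\<^sub>R x)"
      by (simp add: assms smooth_expr_differentiable smooth_expr_foldr)
    then have 1: "(?g has_derivative frechet_derivative ?g (at (r *\<^sub>R x))) (at (r *\<^sub>R x))"
      by (simp add: frechet_derivative_works[symmetric])
    have 2: "((\<lambda>x. r *\<^sub>R x) has_derivative (\<lambda>h. r *\<^sub>R h)) (at x)"
      by (auto intro!: derivative_eq_intros)
    have lin: "linear (frechet_derivative ?g (at (r *\<^sub>R x)))"
      using 1 has_derivative_linear by blast
    from pd_eq[OF has_derivative_mult_right[OF has_derivative_compose[OF 2 1], of "r ^ length is"]]
    show ?thesis by (simp add: pd_def linear_scale[OF lin])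
  qed
  then show ?case using Cons.IH by auto
qed simp

lemma foldr_pd_cos:
  "foldr pd is (\<lambda>x. cos (\<xi> \<bullet> x + t)) =
     (\<lambda>x. (\<Prod>i\<leftarrow>is. \<xi> $ i) * cos (\<xi> \<bullet> x + (t + real (length is) * pi / 2)))"
proof (induction "is")
  case (Cons i "is")
  have D: "((\<lambda>x. a * cos (\<xi> \<bullet> x + s)) has_derivative (\<lambda>h. a * (- sin (\<xi> \<bullet> x + s) * (\<xi> \<bullet> h)))) (at x)" for x s a
    by (auto intro!: derivative_eq_intros simp: algebra_simps)
  have "pd i (\<lambda>x. a * cos (\<xi> \<bullet> x + s)) = (\<lambda>x. \<xi> $ i * a * cos (\<xi> \<bullet> x + (s + pi / 2)))" for s a
    by (rule ext) (simp add: pd_eq[OF D] inner_axis sin_shift add.assoc[symmetric])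
  from this[of "\<Prod>i\<leftarrow>is. \<xi> $ i" "t + real (length is) * pi / 2"] show ?case
    by (simp add: Cons.IH distrib_right add_divide_distrib mult.assoc add.assoc)
       (simp only: add.commute[of "pi / 2"])
qed simp

section \<open>Multi-indices as words of directions\<close>

lemma coords_props: "set (coords :: 'n::finite list) = UNIV" "distinct (coords :: 'n list)"
proof -
  have "\<exists>is :: 'n list. set is = UNIV \<and> distinct is"
    using finite_distinct_list[of "UNIV :: 'n set"] by auto
  from someI_ex[OF this] show "set (coords :: 'n::finite list) = UNIV" "distinct (coords :: 'n list)"
    unfolding coords_def by auto
qed

text \<open>Spelled as a word, a multi-index derivative becomes an instance of
  \<open>foldr pd\<close>, the form in which the estimates are proved.\<close>

definition mi_word :: "('n::finite \<Rightarrow> nat) \<Rightarrow> 'n list" where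
  "mi_word \<beta> = concat (map (\<lambda>i. replicate (\<beta> i) i) coords)"

lemma foldr_pd_replicate: "foldr pd (replicate k i) f = (pd i ^^ k) f"
  by (induction k) auto

lemma mi_deriv_word: "mi_deriv \<beta> f = foldr pd (mi_word \<beta>) f"
proof -
  have "foldr (\<lambda>i. pd i ^^ \<beta> i) is f = foldr pd (concat (map (\<lambda>i. replicate (\<beta> i) i) is)) f" for "is"
    by (induction "is") (simp_all add: foldr_pd_replicate)
  then show ?thesis by (simp add: mi_deriv_def mi_word_def)
qed

lemma prod_list_mi_word: "(\<Prod>i\<leftarrow>mi_word \<beta>. \<xi> $ i) = mi_power \<xi> \<beta>"
proof -
  have "(\<Prod>i\<leftarrow>concat (map (\<lambda>i. replicate (\<beta> i) i) is). \<xi> $ i) = (\<Prod>i\<leftarrow>is. (\<xi> $ i) ^ \<beta> i)" for "is"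
    by (induction "is") (simp_all add: prod_list_replicate)
  then show ?thesis
    by (simp add: mi_word_def mi_power_def prod.distinct_set_conv_list[OF coords_props(2), symmetric]
        coords_props(1))
qed

lemma length_mi_word: "length (mi_word \<beta>) = mi_order \<beta>"
proof -
  have "length (concat (map (\<lambda>i. replicate (\<beta> i) i) is)) = (\<Sum>i\<leftarrow>is. \<beta> i)" for "is"
    by (induction "is") simp_all
  then show ?thesis
    by (simp add: mi_word_def mi_order_def sum.distinct_set_conv_list[OF coords_props(2), symmetric]
        coords_props(1))
qed

lemma mi_deriv_cos:
  "mi_deriv \<beta> (\<lambda>x. cos (\<xi> \<bullet> x + t)) =
     (\<lambda>x. mi_power \<xi> \<beta> * cos (\<xi> \<bullet> x + (t + real (mi_order \<beta>) * pi / 2)))"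
  by (simp add: mi_deriv_word foldr_pd_cos prod_list_mi_word length_mi_word)

lemma mi_deriv_0 [simp]: "mi_deriv (\<lambda>_. 0) f = f"
proof -
  have "foldr (\<lambda>i. pd i ^^ 0) is f = f" for "is" by (induction "is") auto
  then show ?thesis by (simp add: mi_deriv_def)
qed

section \<open>Test functions and smooth approximation of open sets\<close>

lemma compact_supportI:
  fixes f :: "real ^ 'n::finite \<Rightarrow> real"
  assumes "\<And>x. norm x > R \<Longrightarrow> f x = 0"
  shows "compact (closure {x. f x \<noteq> 0})"
proof -
  have "{x. f x \<noteq> 0} \<subseteq> cball 0 R" using assms by (force simp: not_less[symmetric])
  then have "bounded {x. f x \<noteq> 0}" by (rule bounded_subset[OF bounded_cball])
  then show ?thesis by (simp add: compact_closure)
qed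

lemma test_functionI:
  assumes "smooth_expr f" "\<And>x. norm x > R \<Longrightarrow> f x = 0"
  shows "f \<in> test_functions"
  unfolding test_functions_def using smooth_expr_imp_smooth[OF assms(1)] compact_supportI[of R f] assms(2)
  by blast

lemma smooth_expr_prod:
  "finite A \<Longrightarrow> (\<And>i. i \<in> A \<Longrightarrow> smooth_expr (f i)) \<Longrightarrow> smooth_expr (\<lambda>x. \<Prod>i\<in>A. f i x)"
  by (induction A rule: finite_induct) (auto intro!: smooth_expr.intros)

lemma smooth_expr_power: "smooth_expr f \<Longrightarrow> smooth_expr (\<lambda>x. f x ^ k)"
  by (induction k) (auto intro!: smooth_expr.intros)

lemma smooth_expr_one_minus: "smooth_expr f \<Longrightarrow> smooth_expr (\<lambda>x. 1 - f x)"
  using smooth_expr.add[OF smooth_expr.const[of 1] smooth_expr.mult[OF smooth_expr.const[of "-1"], of f]]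
  by simp

definition ball_bump :: "real ^ 'n::finite \<Rightarrow> real \<Rightarrow> real ^ 'n \<Rightarrow> real" where
  "ball_bump c r = bump 0 (1 / r\<^sup>2) c"

lemma ball_bump_props:
  assumes "r > 0"
  shows "x \<in> ball c r \<Longrightarrow> ball_bump c r x > 0" "x \<notin> ball c r \<Longrightarrow> ball_bump c r x = 0"
    "ball_bump c r x \<ge> 0" "ball_bump c r x < 1"
proof -
  have "x \<in> ball c r \<longleftrightarrow> (dist c x)\<^sup>2 < r\<^sup>2"
    by (metis assms mem_ball less_eq_real_def pos2 power_less_imp_less_base power_strict_mono zero_le_dist)
  then have "1 - (x - c) \<bullet> (x - c) / r\<^sup>2 > 0 \<longleftrightarrow> x \<in> ball c r"
    using assms by (simp add: dist_norm norm_minus_commute[of c] power2_norm_eq_inner)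
  then show "x \<in> ball c r \<Longrightarrow> ball_bump c r x > 0" "x \<notin> ball c r \<Longrightarrow> ball_bump c r x = 0"
    "ball_bump c r x \<ge> 0" "ball_bump c r x < 1"
    by (auto simp: ball_bump_def bump_def flat_exp_def)
qed

lemma smooth_expr_ball_bump: "smooth_expr (ball_bump c r)"
  unfolding ball_bump_def by (rule smooth_expr.bump)

text \<open>\<open>U\<close> is a countable union of balls with centers in a countable dense set and
  rational radii, each carrying a bump \<open>e i\<close>. In 1 - prod (1 - e i)^k the growing
  exponent drives the value to 1 as soon as one bump is positive at the point, while only finitely
  many balls enter at each stage, which gives compact support.\<close>

lemma open_approx_test_functions:
  fixes U :: "(real ^ 'n::finite) set"
  assumes "open U"
  obtains \<phi> where "\<And>k::nat. smooth_expr (\<phi> k)" "\<And>k. \<phi> k \<in> test_functions"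
    "\<And>k x. 0 \<le> \<phi> k x" "\<And>k x. \<phi> k x \<le> 1" "\<And>k x. x \<notin> U \<Longrightarrow> \<phi> k x = 0"
    "\<And>x. (\<lambda>k. \<phi> k x) \<longlonglongrightarrow> indicator U x"
proof -
  obtain D :: "(real ^ 'n) set" where D: "countable D" "\<And>X. open X \<Longrightarrow> X \<noteq> {} \<Longrightarrow> \<exists>d\<in>D. d \<in> X"
    using countable_dense_exists by blast
  define Q where "Q = {(c, r). c \<in> D \<and> r \<in> \<rat> \<and> r > 0 \<and> ball c r \<subseteq> U}"
  have "countable Q"
  proof (rule countable_subset)
    show "Q \<subseteq> D \<times> \<rat>" by (auto simp: Q_def)
    show "countable (D \<times> (\<rat> :: real set))" using D countable_rat by auto
  qed
  have cover: "\<exists>q\<in>Q. x \<in> ball (fst q) (snd q)" if xU: "x \<in> U" for x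
  proof -
    obtain e where e: "e > 0" "ball x e \<subseteq> U" using openE[OF assms xU] by metis
    obtain r where r: "r \<in> \<rat>" "0 < r" "r < e / 2" using Rats_dense_in_real[of 0 "e / 2"] e by auto
    obtain d where d: "d \<in> D" "d \<in> ball x r" using D(2)[of "ball x r"] r by auto
    have "ball d r \<subseteq> ball x e"
    proof
      fix y assume "y \<in> ball d r"
      then show "y \<in> ball x e" using d r dist_triangle[of x y d] by auto
    qed
    then have "(d, r) \<in> Q" using e d r by (auto simp: Q_def)
    then show ?thesis using d by (intro bexI[of _ "(d, r)"]) (auto simp: dist_commute)
  qed
  show ?thesis
  proof (cases "Q = {}")
    case True
    then have "U = {}" using cover by auto
    then show ?thesis
      by (intro that[of "\<lambda>_ _. 0"]) (auto intro!: smooth_expr.const test_functionI[of _ 0])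
  next
    case False
    define q where "q = from_nat_into Q"
    have q: "range q = Q" using range_from_nat_into[OF False \<open>countable Q\<close>] by (simp add: q_def)
    define e where "e i = ball_bump (fst (q i)) (snd (q i))" for i :: nat
    have qi: "snd (q i) > 0" "ball (fst (q i)) (snd (q i)) \<subseteq> U" for i
    proof -
      have "q i \<in> Q" using q by auto
      then show "snd (q i) > 0" "ball (fst (q i)) (snd (q i)) \<subseteq> U" by (auto simp: Q_def)
    qed
    note ep = ball_bump_props[OF qi(1)]
    define \<phi> where "\<phi> k x = 1 - (\<Prod>i<k. (1 - e i x) ^ k)" for k x
    have e01: "0 \<le> e i x" "e i x < 1" for i x using ep by (auto simp: e_def)
    have P01: "0 \<le> (\<Prod>i<k. (1 - e i x) ^ k)" "(\<Prod>i<k. (1 - e i x) ^ k) \<le> 1" for k x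
      using e01 by (auto intro!: prod_nonneg prod_le_1 power_le_one simp: less_imp_le)
    have sm: "smooth_expr (\<phi> k)" for k
      unfolding \<phi>_def e_def
      by (intro smooth_expr_one_minus smooth_expr_prod smooth_expr_power smooth_expr_ball_bump) auto
    have z: "\<phi> k x = 0" if "\<And>i. i < k \<Longrightarrow> x \<notin> ball (fst (q i)) (snd (q i))" for k x
    proof -
      have "e i x = 0" if "i < k" for i
        unfolding e_def by (rule ep(2)) (use \<open>\<And>i. i < k \<Longrightarrow> _\<close> that in blast)
      then show ?thesis by (simp add: \<phi>_def)
    qed
    have "bounded (\<Union>i<k. ball (fst (q i)) (snd (q i)))" for k by auto
    then have "\<exists>R. \<forall>x\<in>(\<Union>i<k. ball (fst (q i)) (snd (q i))). norm x \<le> R" for k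
      unfolding bounded_iff by blast
    then have "\<exists>R. \<forall>x. norm x > R \<longrightarrow> \<phi> k x = 0" for k using z
      by (metis UN_I lessThan_iff linorder_not_less)
    then have "\<phi> k \<in> test_functions" for k using sm test_functionI by metis
    moreover have "\<phi> k x = 0" if "x \<notin> U" for k x
      by (rule z) (use qi(2) that in blast)
    moreover have "(\<lambda>k. \<phi> k x) \<longlonglongrightarrow> indicator U x" for x
    proof (cases "x \<in> U")
      case False
      then show ?thesis using \<open>\<And>k x. x \<notin> U \<Longrightarrow> \<phi> k x = 0\<close> by simp
    next
      case True
      obtain i where i: "x \<in> ball (fst (q i)) (snd (q i))" using cover[OF True] q by auto
      have pos: "e i x > 0" using ep(1) i by (auto simp: e_def)
      have le: "(\<Prod>j<k. (1 - e j x) ^ k) \<le> (1 - e i x) ^ k" if "k > i" for k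
      proof -
        have "(\<Prod>j<k. (1 - e j x) ^ k) = (1 - e i x) ^ k * (\<Prod>j\<in>{..<k} - {i}. (1 - e j x) ^ k)"
          using that by (subst prod.remove[of _ i]) auto
        also have "\<dots> \<le> (1 - e i x) ^ k * 1"
          using e01 by (intro mult_left_mono prod_le_1)
            (auto intro!: power_le_one simp: less_imp_le)
        finally show ?thesis by simp
      qed
      have "(\<lambda>k. (\<Prod>j<k. (1 - e j x) ^ k)) \<longlonglongrightarrow> 0"
      proof (rule tendsto_sandwich[of "\<lambda>_. 0" _ _ "\<lambda>k. (1 - e i x) ^ k"])
        show "\<forall>\<^sub>F k in sequentially. (\<Prod>j<k. (1 - e j x) ^ k) \<le> (1 - e i x) ^ k"
          using eventually_gt_at_top[of i] by eventually_elim (rule le)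
        show "(\<lambda>k. (1 - e i x) ^ k) \<longlonglongrightarrow> 0"
          using pos e01[of i x] by (intro LIMSEQ_realpow_zero) auto
      qed (use P01 in auto)
      from tendsto_diff[OF tendsto_const[of 1] this] show ?thesis
        using True by (simp add: \<phi>_def)
    qed
    moreover have "0 \<le> \<phi> k x" "\<phi> k x \<le> 1" for k x using P01 by (auto simp: \<phi>_def)
    ultimately show ?thesis using sm by (intro that[of \<phi>]) auto
  qed
qed

lemma foldr_pd_support:
  assumes "\<And>x. norm x > R \<Longrightarrow> f x = 0" "norm x > R"
  shows "foldr pd is f x = 0"
  using assms(2)
proof (induction "is" arbitrary: x)
  case (Cons i "is")
  have "((\<lambda>_. 0) has_derivative (\<lambda>_. 0)) (at x)" by simp
  then have "(foldr pd is f has_derivative (\<lambda>_. 0)) (at x)"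
  proof (rule has_derivative_transform_within_open)
    show "open {x. norm x > R}" by (intro open_Collect_less continuous_intros)
  qed (use Cons in auto)
  from pd_eq[OF this] show ?case by simp
qed (use assms in auto)

lemma foldr_pd_bounded:
  fixes f :: "real ^ 'n::finite \<Rightarrow> real"
  assumes "smooth_expr f" "\<And>x. norm x > R \<Longrightarrow> f x = 0"
  shows "\<exists>C\<ge>0. \<forall>js x. length js \<le> m \<longrightarrow> \<bar>foldr pd js f x\<bar> \<le> C"
proof -
  have "\<exists>C. \<forall>x. \<bar>foldr pd js f x\<bar> \<le> C" for js
  proof -
    have "compact (foldr pd js f ` cball 0 R)"
      by (intro compact_continuous_image continuous_on_subset[OF smooth_expr_continuous])
         (use assms smooth_expr_foldr in auto)
    then obtain C where C: "\<forall>x\<in>cball 0 R. \<bar>foldr pd js f x\<bar> \<le> C"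
      by (auto simp: bounded_iff dest!: compact_imp_bounded)
    have "\<bar>foldr pd js f x\<bar> \<le> max C 0" for x
    proof (cases "norm x \<le> R")
      case False
      then show ?thesis using foldr_pd_support[of R f x js] assms(2) by auto
    qed (use C in \<open>auto simp: le_max_iff_disj\<close>)
    then show ?thesis by blast
  qed
  then obtain C where C: "\<And>js x. \<bar>foldr pd js f x\<bar> \<le> C js" by metis
  have fin: "finite {js :: 'n list. length js \<le> m}"
    using finite_lists_length_le[of "UNIV :: 'n set" m] by simp
  have C0: "C js \<ge> 0" for js using C[of js 0] by linarith
  have "C js \<le> sum C {js. length js \<le> m}" if "length js \<le> m" for js
    by (rule member_le_sum) (use that fin C0 in auto)
  then have "\<forall>js x. length js \<le> m \<longrightarrow> \<bar>foldr pd js f x\<bar> \<le> sum C {js. length js \<le> m}"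
    using C order_trans by blast
  moreover have "sum C {js. length js \<le> m} \<ge> 0" using C0 by (intro sum_nonneg) auto
  ultimately show ?thesis by blast
qed

section \<open>Finite signed and vector measures\<close>

locale signed_measure =
  fixes \<nu> :: "(real ^ 'n::finite) set \<Rightarrow> real"
  assumes sums: "range A \<subseteq> sets borel \<Longrightarrow> disjoint_family A \<Longrightarrow> (\<lambda>i. \<nu> (A i)) sums \<nu> (\<Union>i::nat. A i)"
    and bdd: "\<exists>C. \<forall>E\<in>sets borel. \<bar>\<nu> E\<bar> \<le> C"
begin

lemma empty: "\<nu> {} = 0"
proof -
  have "(\<lambda>i::nat. \<nu> {}) sums \<nu> (\<Union>i::nat. {})"
    by (rule sums) (auto simp: disjoint_family_on_def)
  then have "(\<lambda>i::nat. \<nu> {}) \<longlonglongrightarrow> 0" by (rule summable_LIMSEQ_zero[OF sums_summable])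
  then show ?thesis by (simp add: LIMSEQ_const_iff)
qed

lemma add:
  assumes "A \<in> sets borel" "B \<in> sets borel" "A \<inter> B = {}"
  shows "\<nu> (A \<union> B) = \<nu> A + \<nu> B"
proof -
  have "(\<lambda>i. \<nu> (binaryset A B i)) sums \<nu> (\<Union>i. binaryset A B i)"
    by (rule sums) (use assms in \<open>auto simp: binaryset_def disjoint_family_on_def\<close>)
  moreover have "(\<lambda>i. \<nu> (binaryset A B i)) sums (\<nu> A + \<nu> B)"
    by (rule binaryset_sums) (rule empty)
  ultimately show ?thesis by (simp add: UN_binaryset_eq sums_unique2)
qed

lemma diff:
  assumes "A \<in> sets borel" "B \<in> sets borel" "B \<subseteq> A"
  shows "\<nu> (A - B) = \<nu> A - \<nu> B"
proof -
  have "B \<union> (A - B) = A" using assms(3) by blast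
  then show ?thesis using add[of B "A - B"] assms by auto
qed

definition pv :: "(real ^ 'n) set \<Rightarrow> ennreal" where
  "pv A = (SUP E \<in> {E \<in> sets borel. E \<subseteq> A}. ennreal (\<nu> E))"

lemma pv_upper: "E \<in> sets borel \<Longrightarrow> E \<subseteq> A \<Longrightarrow> ennreal (\<nu> E) \<le> pv A"
  unfolding pv_def by (rule SUP_upper) auto

lemma pv_least: "(\<And>E. E \<in> sets borel \<Longrightarrow> E \<subseteq> A \<Longrightarrow> ennreal (\<nu> E) \<le> c) \<Longrightarrow> pv A \<le> c"
  unfolding pv_def by (rule SUP_least) auto

lemma pv_superadd:
  assumes "A \<inter> B = {}"
  shows "pv A + pv B \<le> pv (A \<union> B)"
proof -
  have ne: "{E \<in> sets borel. E \<subseteq> X} \<noteq> {}" for X :: "(real ^ 'n) set" by (auto intro: exI[of _ "{}"])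
  have "ennreal (\<nu> E) + ennreal (\<nu> F) \<le> pv (A \<union> B)"
    if "E \<in> sets borel" "E \<subseteq> A" "F \<in> sets borel" "F \<subseteq> B" for E F
  proof (cases "\<nu> E \<ge> 0 \<and> \<nu> F \<ge> 0")
    case True
    then have "ennreal (\<nu> E) + ennreal (\<nu> F) = ennreal (\<nu> (E \<union> F))"
      using add[of E F] that assms by (subst add) (auto simp: ennreal_plus)
    also have "\<dots> \<le> pv (A \<union> B)" by (rule pv_upper) (use that in auto)
    finally show ?thesis .
  next
    \<comment> \<open>A negative value is truncated to 0, and then the other set alone is a
      competitor in the supremum.\<close>
    case False
    then consider "\<nu> E < 0" | "\<nu> F < 0" by linarith
    then show ?thesis
    proof cases
      case 1
      then show ?thesis using pv_upper[of F "A \<union> B"] that by (auto simp: ennreal_neg)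
    next
      case 2
      then show ?thesis using pv_upper[of E "A \<union> B"] that by (auto simp: ennreal_neg)
    qed
  qed
  note * = this
  have "pv A + ennreal (\<nu> F) \<le> pv (A \<union> B)" if "F \<in> sets borel" "F \<subseteq> B" for F
    unfolding pv_def[of A]
    by (subst ennreal_SUP_add_left[OF ne, symmetric]) (rule SUP_least, use *[OF _ _ that] in blast)
  then show ?thesis
    unfolding pv_def[of B]
    by (subst add.commute, subst ennreal_SUP_add_left[OF ne, symmetric])
       (rule SUP_least, auto simp: add.commute)
qed

lemma pv_superadd_sum:
  assumes "disjoint_family A"
  shows "(\<Sum>i<n. pv (A i)) \<le> pv (\<Union>i<(n::nat). A i)"
proof (induction n)
  case (Suc n)
  have "(\<Sum>i<Suc n. pv (A i)) \<le> pv (\<Union>i<n. A i) + pv (A n)"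
    using Suc by (simp add: add_right_mono)
  also have "A i \<inter> A n = {}" if "i < n" for i
    using assms that by (auto simp: disjoint_family_on_def)
  then have "pv (\<Union>i<n. A i) + pv (A n) \<le> pv ((\<Union>i<n. A i) \<union> A n)"
    by (intro pv_superadd) blast
  also have "(\<Union>i<n. A i) \<union> A n = (\<Union>i<Suc n. A i)" by (auto simp: lessThan_Suc)
  finally show ?case .
qed simp

lemma pv_mono: "A \<subseteq> B \<Longrightarrow> pv A \<le> pv B"
  by (rule pv_least) (auto intro: pv_upper)

text \<open>One inequality is the superadditivity of a supremum over subsets. For the other, a
  competitor \<open>E\<close> is cut into the pieces E \<inter> A i; countable additivity recovers
  \<open>\<nu> E\<close> from them, and replacing negative pieces by 0 only increases the
  sum.\<close>

lemma pv_countably_additive: "countably_additive (sets borel) pv"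
  unfolding countably_additive_def
proof (intro allI impI)
  fix A :: "nat \<Rightarrow> (real ^ 'n) set"
  assume A: "range A \<subseteq> sets borel" "disjoint_family A" "\<Union> (range A) \<in> sets borel"
  show "(\<Sum>i. pv (A i)) = pv (\<Union> (range A))"
  proof (rule antisym)
    show "(\<Sum>i. pv (A i)) \<le> pv (\<Union> (range A))"
    proof (rule suminf_le_const)
      show "(\<Sum>i<n. pv (A i)) \<le> pv (\<Union> (range A))" for n
        by (rule order_trans[OF pv_superadd_sum[OF A(2)] pv_mono]) auto
    qed simp
    show "pv (\<Union> (range A)) \<le> (\<Sum>i. pv (A i))"
    proof (rule pv_least)
      fix E assume E: "E \<in> sets borel" "E \<subseteq> \<Union> (range A)"
      have "(\<lambda>i. \<nu> (E \<inter> A i)) sums \<nu> (\<Union>i. E \<inter> A i)"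
        by (rule sums) (use A E in \<open>auto simp: disjoint_family_on_def\<close>)
      moreover have "(\<Union>i. E \<inter> A i) = E" using E by auto
      ultimately have "(\<lambda>n. \<Sum>i<n. \<nu> (E \<inter> A i)) \<longlonglongrightarrow> \<nu> E" by (simp add: sums_def)
      then have lim: "(\<lambda>n. ennreal (\<Sum>i<n. \<nu> (E \<inter> A i))) \<longlonglongrightarrow> ennreal (\<nu> E)"
        by (rule tendsto_ennrealI)
      have "ennreal (\<Sum>i<n. \<nu> (E \<inter> A i)) \<le> (\<Sum>i. pv (A i))" for n
      proof -
        have "ennreal (\<Sum>i<n. \<nu> (E \<inter> A i)) \<le> ennreal (\<Sum>i<n. max 0 (\<nu> (E \<inter> A i)))"
          by (intro ennreal_leI sum_mono) simp
        also have "\<dots> = (\<Sum>i<n. ennreal (\<nu> (E \<inter> A i)))"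
          by (subst sum_ennreal[symmetric]) (auto simp: ennreal_max_0)
        also have "\<dots> \<le> (\<Sum>i<n. pv (A i))"
          by (intro sum_mono pv_upper) (use E A in auto)
        also have "\<dots> \<le> (\<Sum>i. pv (A i))" by (rule sum_le_suminf) auto
        finally show ?thesis .
      qed
      then show "ennreal (\<nu> E) \<le> (\<Sum>i. pv (A i))"
        by (intro LIMSEQ_le_const2[OF lim]) auto
    qed
  qed
qed

lemma sets_pv [simp]: "sets (positive_variation \<nu>) = sets borel"
  and space_pv [simp]: "space (positive_variation \<nu>) = UNIV"
  using sets.sigma_sets_eq[of borel] unfolding positive_variation_def
  by (auto simp: sets_measure_of_conv space_measure_of_conv)

lemma emeasure_pv: "A \<in> sets borel \<Longrightarrow> emeasure (positive_variation \<nu>) A = pv A"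
proof -
  assume A: "A \<in> sets borel"
  have eq: "positive_variation \<nu> = measure_of UNIV (sets borel) pv"
    unfolding positive_variation_def pv_def[abs_def] ..
  show "emeasure (positive_variation \<nu>) A = pv A"
    unfolding eq
  proof (rule emeasure_measure_of_sigma[OF _ _ pv_countably_additive A])
  show "sigma_algebra UNIV (sets (borel :: (real ^ 'n) measure))"
    using sets.sigma_algebra_axioms[of borel] by simp
  show "positive (sets borel) pv"
    by (auto simp: positive_def pv_def empty)
  qed
qed

lemma finite_pv: "finite_measure (positive_variation \<nu>)"
proof
  obtain C where C: "\<And>E. E \<in> sets borel \<Longrightarrow> \<bar>\<nu> E\<bar> \<le> C" using bdd by auto
  have "pv UNIV \<le> ennreal C"
    by (rule pv_least) (use C in \<open>force intro: ennreal_leI\<close>)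
  then show "emeasure (positive_variation \<nu>) (space (positive_variation \<nu>)) \<noteq> \<infinity>"
    using emeasure_pv[of UNIV] by (auto simp: top_unique)
qed

lemma ennreal_measure_pv: "A \<in> sets borel \<Longrightarrow> ennreal (measure (positive_variation \<nu>) A) = pv A"
  using finite_measure.emeasure_eq_measure[OF finite_pv] emeasure_pv by simp

lemma measure_pv_ge: "A \<in> sets borel \<Longrightarrow> E \<in> sets borel \<Longrightarrow> E \<subseteq> A \<Longrightarrow> \<nu> E \<le> measure (positive_variation \<nu>) A"
  using pv_upper[of E A] ennreal_measure_pv[of A] by (metis ennreal_le_iff measure_nonneg)

lemma measure_pv_le:
  "A \<in> sets borel \<Longrightarrow> 0 \<le> c \<Longrightarrow> (\<And>E. E \<in> sets borel \<Longrightarrow> E \<subseteq> A \<Longrightarrow> \<nu> E \<le> c) \<Longrightarrow>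
    measure (positive_variation \<nu>) A \<le> c"
  using pv_least[of A "ennreal c"] ennreal_measure_pv[of A] by (metis ennreal_le_iff ennreal_leI)

lemma uminus: "signed_measure (\<lambda>E. - \<nu> E)"
proof
  show "range A \<subseteq> sets borel \<Longrightarrow> disjoint_family A \<Longrightarrow> (\<lambda>i. - \<nu> (A i)) sums - \<nu> (\<Union>i::nat. A i)" for A
    using sums by (intro sums_minus)
qed (use bdd in auto)

text \<open>Complementation inside \<open>A\<close> exchanges the two parts: \<nu> E = \<nu> A -
  \<nu> (A - E). Taking suprema over E in both directions gives the identity without a Hahn
  set.\<close>

lemma jordan:
  assumes A: "A \<in> sets borel"
  shows "\<nu> A = measure (positive_variation \<nu>) A - measure (positive_variation (\<lambda>E. - \<nu> E)) A"
proof -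
  interpret N: signed_measure "\<lambda>E. - \<nu> E" by (rule uminus)
  let ?p = "measure (positive_variation \<nu>) A" and ?n = "measure (positive_variation (\<lambda>E. - \<nu> E)) A"
  have "?p \<le> \<nu> A + ?n"
  proof (rule measure_pv_le[OF A])
    show "0 \<le> \<nu> A + ?n" using N.measure_pv_ge[OF A A] by simp
    fix E assume E: "E \<in> sets borel" "E \<subseteq> A"
    then show "\<nu> E \<le> \<nu> A + ?n" using diff[OF A] N.measure_pv_ge[OF A, of "A - E"] A by simp
  qed
  moreover have "?n \<le> ?p - \<nu> A"
  proof (rule N.measure_pv_le[OF A])
    show "0 \<le> ?p - \<nu> A" using measure_pv_ge[OF A A] by simp
    fix E assume E: "E \<in> sets borel" "E \<subseteq> A"
    then show "- \<nu> E \<le> ?p - \<nu> A" using diff[OF A] measure_pv_ge[OF A, of "A - E"] A by simp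
  qed
  ultimately show ?thesis by simp
qed

end

section \<open>Total variation and componentwise variation\<close>

definition posv :: "((real ^ 'n::finite) set \<Rightarrow> 'w::euclidean_space) \<Rightarrow> 'w \<Rightarrow> (real ^ 'n) measure" where
  "posv \<mu> b = positive_variation (\<lambda>E. \<mu> E \<bullet> b)"

definition negv :: "((real ^ 'n::finite) set \<Rightarrow> 'w::euclidean_space) \<Rightarrow> 'w \<Rightarrow> (real ^ 'n) measure" where
  "negv \<mu> b = positive_variation (\<lambda>E. - (\<mu> E \<bullet> b))"

text \<open>An additive companion of the total variation: the masses of all Jordan parts of the
  components. It dominates integrals directly and is comparable with \<open>tv\<close> up to
  dimensional factors.\<close>

definition var :: "((real ^ 'n::finite) set \<Rightarrow> 'w::euclidean_space) \<Rightarrow> (real ^ 'n) set \<Rightarrow> real" where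
  "var \<mu> A = (\<Sum>b\<in>Basis. measure (posv \<mu> b) A + measure (negv \<mu> b) A)"

definition tv :: "((real ^ 'n::finite) set \<Rightarrow> 'w::euclidean_space) \<Rightarrow> (real ^ 'n) set \<Rightarrow> real" where
  "tv \<mu> A = enn2real (total_variation \<mu> A)"

text \<open>This is the scalar integral of F \<bullet> d\<mu>, where F takes values in the same
  space as \<mu>.\<close>

definition pairing :: "((real ^ 'n::finite) set \<Rightarrow> 'w::euclidean_space) \<Rightarrow> (real ^ 'n \<Rightarrow> 'w) \<Rightarrow> real" where
  "pairing \<mu> F = (\<Sum>b\<in>Basis. (LINT y|posv \<mu> b. F y \<bullet> b) - (LINT y|negv \<mu> b. F y \<bullet> b))"

locale vector_measure =
  fixes \<mu> :: "(real ^ 'n::finite) set \<Rightarrow> 'w::euclidean_space"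
  assumes fvm: "finite_vector_measure \<mu>"
begin

lemma sums: "range A \<subseteq> sets borel \<Longrightarrow> disjoint_family A \<Longrightarrow> (\<lambda>i. \<mu> (A i)) sums \<mu> (\<Union>i::nat. A i)"
  using fvm unfolding finite_vector_measure_def by blast

lemma tv_UNIV_fin: "total_variation \<mu> UNIV < \<infinity>"
  using fvm unfolding finite_vector_measure_def by blast

lemma empty: "\<mu> {} = 0"
proof -
  have "(\<lambda>i::nat. \<mu> {}) sums \<mu> (\<Union>i::nat. {})"
    by (rule sums) (auto simp: disjoint_family_on_def)
  then have "(\<lambda>i::nat. \<mu> {}) \<longlonglongrightarrow> 0" by (rule summable_LIMSEQ_zero[OF sums_summable])
  then show ?thesis by (simp add: LIMSEQ_const_iff)
qed

text \<open>\<open>partition_on\<close> forbids empty blocks and demands a full cover, so a disjoint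
  family is stripped of empty sets and completed by the remainder of \<open>A\<close>; neither
  change lowers the sum.\<close>

lemma sum_le_total_variation:
  assumes "finite P" "P \<subseteq> sets borel" "disjoint P" "\<Union>P \<subseteq> A" "A \<in> sets borel"
  shows "(\<Sum>E\<in>P. ennreal (norm (\<mu> E))) \<le> total_variation \<mu> A"
proof -
  define Q where "Q = (P - {{}}) \<union> ({A - \<Union>P} - {{}})"
  have fin: "finite Q" using assms(1) by (auto simp: Q_def)
  have "\<Union>P \<in> sets borel" using assms(1,2) by (metis sets.finite_Union)
  then have bor: "Q \<subseteq> sets borel" using assms by (auto simp: Q_def)
  have part: "partition_on A Q"
    unfolding partition_on_def
  proof (intro conjI)
    show "\<Union>Q = A" using assms(4) by (auto simp: Q_def)
    show "disjoint Q" using assms(3) by (auto simp: Q_def disjoint_def)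
    show "{} \<notin> Q" by (auto simp: Q_def)
  qed
  have "(\<Sum>E\<in>P. ennreal (norm (\<mu> E))) = (\<Sum>E\<in>P - {{}}. ennreal (norm (\<mu> E)))"
    by (rule sum.mono_neutral_right) (use assms(1) empty in auto)
  also have "\<dots> \<le> (\<Sum>E\<in>Q. ennreal (norm (\<mu> E)))"
    by (rule sum_mono2[OF fin]) (auto simp: Q_def)
  also have "\<dots> \<le> total_variation \<mu> A"
    unfolding total_variation_def by (rule SUP_upper) (use fin bor part in auto)
  finally show ?thesis .
qed

lemma total_variation_mono:
  assumes "A \<subseteq> B" "B \<in> sets borel"
  shows "total_variation \<mu> A \<le> total_variation \<mu> B"
  unfolding total_variation_def[of \<mu> A]
  by (rule SUP_least, rule sum_le_total_variation) (use assms in \<open>auto simp: partition_on_def\<close>)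

lemma total_variation_fin: "total_variation \<mu> A < \<infinity>"
  using le_less_trans[OF total_variation_mono[of A UNIV] tv_UNIV_fin] by simp

lemma ennreal_tv: "ennreal (tv \<mu> A) = total_variation \<mu> A"
  using total_variation_fin[of A] by (simp add: tv_def)

lemma tv_nonneg: "tv \<mu> A \<ge> 0" by (simp add: tv_def)

lemma sum_le_tv:
  assumes "finite P" "P \<subseteq> sets borel" "disjoint P" "\<Union>P \<subseteq> A" "A \<in> sets borel"
  shows "(\<Sum>E\<in>P. norm (\<mu> E)) \<le> tv \<mu> A"
proof -
  have "ennreal (\<Sum>E\<in>P. norm (\<mu> E)) \<le> ennreal (tv \<mu> A)"
    using sum_le_total_variation[OF assms] by (simp add: ennreal_tv sum_ennreal)
  then show ?thesis by (simp add: tv_nonneg)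
qed

lemma norm_le_tv: "E \<in> sets borel \<Longrightarrow> E \<subseteq> A \<Longrightarrow> A \<in> sets borel \<Longrightarrow> norm (\<mu> E) \<le> tv \<mu> A"
  using sum_le_tv[of "{E}" A] by auto

lemma tv_le:
  assumes "\<And>P. finite P \<Longrightarrow> P \<subseteq> sets borel \<Longrightarrow> partition_on A P \<Longrightarrow> (\<Sum>E\<in>P. norm (\<mu> E)) \<le> c" "0 \<le> c"
  shows "tv \<mu> A \<le> c"
proof -
  have "total_variation \<mu> A \<le> ennreal c"
    unfolding total_variation_def
    by (rule SUP_least) (use assms in \<open>auto simp: sum_ennreal intro!: ennreal_leI\<close>)
  then show ?thesis using assms(2) by (simp add: ennreal_tv[symmetric])
qed

lemma tv_approx:
  assumes "e > 0" "A \<in> sets borel"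
  obtains P where "finite P" "P \<subseteq> sets borel" "partition_on A P" "tv \<mu> A < (\<Sum>E\<in>P. norm (\<mu> E)) + e"
proof (rule ccontr)
  note rule = that
  assume neg: "\<not> thesis"
  have *: "(\<Sum>E\<in>P. norm (\<mu> E)) \<le> tv \<mu> A - e" if "finite P" "P \<subseteq> sets borel" "partition_on A P" for P
  proof (rule ccontr)
    assume "\<not> (\<Sum>E\<in>P. norm (\<mu> E)) \<le> tv \<mu> A - e"
    then have "tv \<mu> A < (\<Sum>E\<in>P. norm (\<mu> E)) + e" by linarith
    from neg rule[OF that this] show False by contradiction
  qed
  \<comment> \<open>The difference drops the block when \<open>A\<close> is empty, where the only
    partition is the empty one.\<close>
  have "partition_on A ({A} - {{}})" by (auto simp: partition_on_def disjoint_def)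
  then have "0 \<le> tv \<mu> A - e"
    using *[of "{A} - {{}}"] assms sum_nonneg[of "{A} - {{}}" "\<lambda>E. norm (\<mu> E)"] by fastforce
  then have "tv \<mu> A \<le> tv \<mu> A - e" by (intro tv_le *)
  then show False using assms by simp
qed

text \<open>Near-optimal partitions of disjoint sets merge into one disjoint family inside
  \<open>U\<close>. The error is \<open>d\<close> for each set; the 1 added in the denominator of
  \<open>d\<close> covers an empty index set.\<close>

lemma sum_tv_le:
  assumes "finite I" "\<And>i. i \<in> I \<Longrightarrow> A i \<in> sets borel" "disjoint_family_on A I" "\<And>i. i \<in> I \<Longrightarrow> A i \<subseteq> U"
    "U \<in> sets borel"
  shows "(\<Sum>i\<in>I. tv \<mu> (A i)) \<le> tv \<mu> U"
proof (rule field_le_epsilon)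
  fix e :: real assume e: "e > 0"
  define d where "d = e / (real (card I) + 1)"
  have d: "d > 0" using e by (simp add: d_def)
  have "\<exists>P. finite P \<and> P \<subseteq> sets borel \<and> partition_on (A i) P \<and> tv \<mu> (A i) < (\<Sum>E\<in>P. norm (\<mu> E)) + d"
    if "i \<in> I" for i
    using tv_approx[OF d assms(2)[OF that]] by metis
  then obtain P where P: "\<And>i. i \<in> I \<Longrightarrow> finite (P i)" "\<And>i. i \<in> I \<Longrightarrow> P i \<subseteq> sets borel"
    "\<And>i. i \<in> I \<Longrightarrow> partition_on (A i) (P i)"
    "\<And>i. i \<in> I \<Longrightarrow> tv \<mu> (A i) < (\<Sum>E\<in>P i. norm (\<mu> E)) + d"
    by metis
  have sub: "E \<subseteq> A i" "E \<noteq> {}" if "i \<in> I" "E \<in> P i" for i E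
    using P(3)[OF that(1)] that(2) by (auto simp: partition_on_def)
  have dis: "P i \<inter> P j = {}" if "i \<in> I" "j \<in> I" "i \<noteq> j" for i j
  proof -
    have "A i \<inter> A j = {}" using assms(3) that by (auto simp: disjoint_family_on_def)
    then show ?thesis using sub that by blast
  qed
  have "(\<Sum>i\<in>I. tv \<mu> (A i)) \<le> (\<Sum>i\<in>I. (\<Sum>E\<in>P i. norm (\<mu> E)) + d)"
    by (intro sum_mono less_imp_le P(4))
  also have "\<dots> = (\<Sum>i\<in>I. \<Sum>E\<in>P i. norm (\<mu> E)) + real (card I) * d"
    by (simp add: sum.distrib)
  also have "(\<Sum>i\<in>I. \<Sum>E\<in>P i. norm (\<mu> E)) = (\<Sum>E\<in>(\<Union>i\<in>I. P i). norm (\<mu> E))"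
    by (rule sum.UNION_disjoint[symmetric]) (use assms(1) P(1) dis in auto)
  also have "\<dots> \<le> tv \<mu> U"
  proof (rule sum_le_tv)
    show "disjoint (\<Union>i\<in>I. P i)"
      unfolding disjoint_def
    proof (intro ballI impI)
      fix E F assume EF: "E \<in> (\<Union>i\<in>I. P i)" "F \<in> (\<Union>i\<in>I. P i)" "E \<noteq> F"
      then obtain i j where ij: "i \<in> I" "j \<in> I" "E \<in> P i" "F \<in> P j" by auto
      show "E \<inter> F = {}"
      proof (cases "i = j")
        case True
        then show ?thesis using P(3)[of i] ij EF(3) by (auto simp: partition_on_def disjoint_def)
      next
        case False
        then have "A i \<inter> A j = {}" using assms(3) ij by (auto simp: disjoint_family_on_def)
        then show ?thesis using sub ij by blast
      qed
    qed
    show "\<Union> (\<Union>i\<in>I. P i) \<subseteq> U" using sub assms(4) by blast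
    show "(\<Union>i\<in>I. P i) \<subseteq> sets borel" using P(2) by blast
  qed (use assms P(1) in auto)
  also have "real (card I) * d \<le> e" using e by (simp add: d_def field_simps)
  finally show "(\<Sum>i\<in>I. tv \<mu> (A i)) \<le> tv \<mu> U + e" by simp
qed

lemma component: "signed_measure (\<lambda>E. \<mu> E \<bullet> b)"
proof
  show "(\<lambda>i. \<mu> (A i) \<bullet> b) sums (\<mu> (\<Union>i. A i) \<bullet> b)"
    if "range A \<subseteq> sets borel" "disjoint_family A" for A :: "nat \<Rightarrow> _"
    using sums[OF that] by (rule bounded_linear.sums[OF bounded_linear_inner_left])
  have "\<bar>\<mu> E \<bullet> b\<bar> \<le> tv \<mu> UNIV * norm b" if "E \<in> sets borel" for E
    using norm_le_tv[OF that, of UNIV] Cauchy_Schwarz_ineq2[of "\<mu> E" b]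
    by (meson mult_right_mono norm_ge_zero order_trans sets.top space_borel subset_UNIV borel_open open_UNIV)
  then show "\<exists>C. \<forall>E\<in>sets borel. \<bar>\<mu> E \<bullet> b\<bar> \<le> C" by blast
qed

lemma sets_posv [simp, measurable_cong]: "sets (posv \<mu> b) = sets borel"
  and sets_negv [simp, measurable_cong]: "sets (negv \<mu> b) = sets borel"
  and space_posv [simp]: "space (posv \<mu> b) = UNIV"
  and space_negv [simp]: "space (negv \<mu> b) = UNIV"
  using signed_measure.sets_pv[OF component] signed_measure.space_pv[OF component]
    signed_measure.sets_pv[OF signed_measure.uminus[OF component]]
    signed_measure.space_pv[OF signed_measure.uminus[OF component]]
  by (auto simp: posv_def negv_def)

lemma finite_posv: "finite_measure (posv \<mu> b)" and finite_negv: "finite_measure (negv \<mu> b)"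
  using signed_measure.finite_pv[OF component] signed_measure.finite_pv[OF signed_measure.uminus[OF component]]
  by (auto simp: posv_def negv_def)

lemma jordan: "A \<in> sets borel \<Longrightarrow> \<mu> A \<bullet> b = measure (posv \<mu> b) A - measure (negv \<mu> b) A"
  using signed_measure.jordan[OF component] by (simp add: posv_def negv_def)

lemma var_nonneg: "var \<mu> A \<ge> 0"
  unfolding var_def by (intro sum_nonneg add_nonneg_nonneg) auto

lemma var_mono: "A \<subseteq> B \<Longrightarrow> B \<in> sets borel \<Longrightarrow> var \<mu> A \<le> var \<mu> B"
  unfolding var_def
  by (intro sum_mono add_mono finite_measure.finite_measure_mono finite_posv finite_negv) auto

lemma norm_le_var: "A \<in> sets borel \<Longrightarrow> norm (\<mu> A) \<le> var \<mu> A"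
proof -
  assume A: "A \<in> sets borel"
  have "norm (\<mu> A) \<le> (\<Sum>b\<in>Basis. \<bar>\<mu> A \<bullet> b\<bar>)" by (rule norm_le_l1)
  also have "\<dots> \<le> var \<mu> A"
    unfolding var_def using jordan[OF A]
    by (intro sum_mono) (smt (verit) measure_nonneg)
  finally show ?thesis .
qed

lemma var_additive:
  assumes "finite P" "P \<subseteq> sets borel" "disjoint P"
  shows "(\<Sum>E\<in>P. var \<mu> E) = var \<mu> (\<Union>P)"
proof -
  have d: "disjoint_family_on (\<lambda>E. E) P" using assms(3) by (auto simp: disjoint_family_on_def disjoint_def)
  have "measure M (\<Union>P) = (\<Sum>E\<in>P. measure M E)" if "finite_measure M" "sets M = sets borel" for M :: "(real ^ 'n) measure"
    using finite_measure.finite_measure_finite_Union[OF that(1) assms(1) _ d] that(2) assms(2) by auto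
  then show ?thesis
    unfolding var_def using finite_posv finite_negv
    by (subst sum.swap) (simp add: sum.distrib)
qed

lemma tv_le_var: "A \<in> sets borel \<Longrightarrow> tv \<mu> A \<le> var \<mu> A"
proof (rule tv_le)
  fix P assume P: "finite P" "P \<subseteq> sets borel" "partition_on A P"
  have "(\<Sum>E\<in>P. norm (\<mu> E)) \<le> (\<Sum>E\<in>P. var \<mu> E)"
    by (intro sum_mono norm_le_var) (use P in auto)
  also have "\<dots> = var \<mu> A"
    using var_additive[OF P(1,2)] P(3) by (auto simp: partition_on_def)
  finally show "(\<Sum>E\<in>P. norm (\<mu> E)) \<le> var \<mu> A" .
qed (rule var_nonneg)

text \<open>Each Jordan part is a supremum of plus or minus one component of \<mu> over subsets of
  \<open>A\<close>, hence at most \<open>tv \<mu> A\<close>; there are two parts for each basis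
  vector.\<close>

lemma var_le_tv:
  assumes A: "A \<in> sets borel"
  shows "var \<mu> A \<le> 2 * DIM('w) * tv \<mu> A"
proof -
  have *: "\<mu> E \<bullet> b \<le> tv \<mu> A" "- (\<mu> E \<bullet> b) \<le> tv \<mu> A" if "b \<in> Basis" "E \<in> sets borel" "E \<subseteq> A" for E b
    using norm_le_tv[OF that(2,3) A] Basis_le_norm[OF that(1), of "\<mu> E"] by auto
  have "measure (posv \<mu> b) A + measure (negv \<mu> b) A \<le> 2 * tv \<mu> A" if b: "b \<in> Basis" for b
    using signed_measure.measure_pv_le[OF component A tv_nonneg *(1)[OF b]]
      signed_measure.measure_pv_le[OF signed_measure.uminus[OF component] A tv_nonneg *(2)[OF b]]
    by (simp add: posv_def negv_def)
  then have "var \<mu> A \<le> (\<Sum>b\<in>(Basis::'w set). 2 * tv \<mu> A)"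
    unfolding var_def by (rule sum_mono)
  then show ?thesis by simp
qed

text \<open>Every block of a partition is cut along \<open>A\<close>. The inequality lets a bound on
  the total mass and a lower bound on the complement be combined into an upper bound on
  \<open>A\<close>.\<close>

lemma tv_UNIV_le:
  assumes A: "A \<in> sets borel"
  shows "tv \<mu> UNIV \<le> tv \<mu> A + tv \<mu> (- A)"
proof (rule tv_le)
  fix P :: "(real ^ 'n) set set"
  assume P: "finite P" "P \<subseteq> sets borel" "partition_on UNIV P"
  have dis: "disjoint P" using P(3) by (auto simp: partition_on_def)
  have cA: "- A \<in> sets borel" using A by (simp add: borel_comp)
  have *: "(\<Sum>E\<in>P. norm (\<mu> (E \<inter> X))) \<le> tv \<mu> X" if X: "X \<in> sets borel" for X
  proof -
    have "(\<Sum>E\<in>P. norm (\<mu> (E \<inter> X))) \<le> (\<Sum>E\<in>P. tv \<mu> (E \<inter> X))"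
      by (intro sum_mono norm_le_tv) (use P X in auto)
    also have "\<dots> \<le> tv \<mu> X"
      by (rule sum_tv_le) (use P X dis in \<open>auto simp: disjoint_family_on_def disjoint_def\<close>)
    finally show ?thesis .
  qed
  have "norm (\<mu> E) \<le> norm (\<mu> (E \<inter> A)) + norm (\<mu> (E \<inter> - A))" if "E \<in> P" for E
  proof -
    have E: "E \<in> sets borel" using that P by auto
    have "\<mu> E \<bullet> b = (\<mu> (E \<inter> A) + \<mu> (E \<inter> - A)) \<bullet> b" for b
      using signed_measure.add[OF component, of "E \<inter> A" "E \<inter> - A" b] E A cA
        Int_Un_distrib[of E A "- A"]
      by (simp add: inner_add_left Int_assoc Int_left_commute)
    then have "\<mu> E = \<mu> (E \<inter> A) + \<mu> (E \<inter> - A)" by (metis euclidean_eqI)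
    then show ?thesis by (metis norm_triangle_ineq)
  qed
  then have "(\<Sum>E\<in>P. norm (\<mu> E)) \<le> (\<Sum>E\<in>P. norm (\<mu> (E \<inter> A)) + norm (\<mu> (E \<inter> - A)))"
    by (rule sum_mono)
  also have "\<dots> \<le> tv \<mu> A + tv \<mu> (- A)"
    using *[OF A] *[OF cA] by (simp add: sum.distrib)
  finally show "(\<Sum>E\<in>P. norm (\<mu> E)) \<le> tv \<mu> A + tv \<mu> (- A)" .
qed (use tv_nonneg in auto)

end

section \<open>Integration against a vector measure\<close>

context vector_measure
begin

lemma integrable_bounded:
  fixes \<phi> :: "real ^ 'n \<Rightarrow> 'x::euclidean_space"
  assumes "\<phi> \<in> borel_measurable borel" "\<And>x. norm (\<phi> x) \<le> C"
  shows "integrable (posv \<mu> b) \<phi>" "integrable (negv \<mu> b) \<phi>"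
proof -
  have "\<phi> \<in> borel_measurable (posv \<mu> b)" "\<phi> \<in> borel_measurable (negv \<mu> b)"
    using assms(1)
    by (simp_all add: measurable_cong_sets[OF sets_posv refl] measurable_cong_sets[OF sets_negv refl])
  then show "integrable (posv \<mu> b) \<phi>" "integrable (negv \<mu> b) \<phi>"
    using finite_measure.integrable_const_bound[OF finite_posv, of \<phi> C b]
      finite_measure.integrable_const_bound[OF finite_negv, of \<phi> C b] assms(2) by blast+
qed

lemma vector_integral_inner:
  "b \<in> Basis \<Longrightarrow> vector_integral \<mu> \<phi> \<bullet> b = (LINT x|posv \<mu> b. \<phi> x) - (LINT x|negv \<mu> b. \<phi> x)"
  unfolding vector_integral_def signed_integral_def posv_def negv_def
  by (simp add: inner_sum_left_Basis)

lemma integral_dct: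
  fixes \<phi> :: "nat \<Rightarrow> real ^ 'n \<Rightarrow> real"
  assumes "\<And>k. \<phi> k \<in> borel_measurable borel" "\<And>k x. \<bar>\<phi> k x\<bar> \<le> C" "\<And>x. (\<lambda>k. \<phi> k x) \<longlonglongrightarrow> \<psi> x"
  shows "(\<lambda>k. LINT x|posv \<mu> b. \<phi> k x) \<longlonglongrightarrow> (LINT x|posv \<mu> b. \<psi> x)"
    "(\<lambda>k. LINT x|negv \<mu> b. \<phi> k x) \<longlonglongrightarrow> (LINT x|negv \<mu> b. \<psi> x)"
proof -
  have m: "\<psi> \<in> borel_measurable borel"
    by (rule borel_measurable_LIMSEQ_real[OF assms(3,1)])
  have *: "(\<lambda>k. LINT x|M. \<phi> k x) \<longlonglongrightarrow> (LINT x|M. \<psi> x)" if M: "finite_measure M" "sets M = sets borel"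
    for M :: "(real ^ 'n) measure"
  proof (rule integral_dominated_convergence[where w="\<lambda>_. C"])
    show "integrable M (\<lambda>_. C)"
      by (rule finite_measure.integrable_const[OF M(1)])
  qed (use assms m in \<open>auto simp: measurable_cong_sets[OF M(2) refl]\<close>)
  show "(\<lambda>k. LINT x|posv \<mu> b. \<phi> k x) \<longlonglongrightarrow> (LINT x|posv \<mu> b. \<psi> x)"
    "(\<lambda>k. LINT x|negv \<mu> b. \<phi> k x) \<longlonglongrightarrow> (LINT x|negv \<mu> b. \<psi> x)"
    by (auto intro!: * finite_posv finite_negv)
qed

lemma vector_integral_dct:
  fixes \<phi> :: "nat \<Rightarrow> real ^ 'n \<Rightarrow> real"
  assumes "\<And>k. \<phi> k \<in> borel_measurable borel" "\<And>k x. \<bar>\<phi> k x\<bar> \<le> C" "\<And>x. (\<lambda>k. \<phi> k x) \<longlonglongrightarrow> \<psi> x"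
  shows "(\<lambda>k. vector_integral \<mu> (\<phi> k)) \<longlonglongrightarrow> vector_integral \<mu> \<psi>"
  unfolding vector_integral_def signed_integral_def posv_def[symmetric] negv_def[symmetric]
  by (intro tendsto_sum tendsto_scaleR tendsto_diff integral_dct[OF assms] tendsto_const)

lemma vector_integral_indicator:
  assumes A: "A \<in> sets borel"
  shows "vector_integral \<mu> (indicator A) = \<mu> A"
proof (rule euclidean_eqI)
  fix b :: 'w assume "b \<in> Basis"
  then show "vector_integral \<mu> (indicator A) \<bullet> b = \<mu> A \<bullet> b"
    by (simp add: vector_integral_inner jordan[OF A] A)
qed

lemma vector_integral_sum:
  fixes \<phi> :: "'i \<Rightarrow> real ^ 'n \<Rightarrow> real"
  assumes "\<And>i. i \<in> I \<Longrightarrow> \<phi> i \<in> borel_measurable borel" "\<And>i x. i \<in> I \<Longrightarrow> \<bar>\<phi> i x\<bar> \<le> C"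
  shows "vector_integral \<mu> (\<lambda>x. \<Sum>i\<in>I. c i * \<phi> i x) = (\<Sum>i\<in>I. c i *\<^sub>R vector_integral \<mu> (\<phi> i))"
proof (rule euclidean_eqI)
  fix b :: 'w assume b: "b \<in> Basis"
  have "integrable (posv \<mu> b) (\<phi> i)" "integrable (negv \<mu> b) (\<phi> i)" if "i \<in> I" for i
    using integrable_bounded[of "\<phi> i" C b] assms that by auto
  then show "vector_integral \<mu> (\<lambda>x. \<Sum>i\<in>I. c i * \<phi> i x) \<bullet> b = (\<Sum>i\<in>I. c i *\<^sub>R vector_integral \<mu> (\<phi> i)) \<bullet> b"
    by (simp add: vector_integral_inner[OF b] inner_sum_left Bochner_Integration.integral_sum
        sum_subtractf right_diff_distrib)
qed

text \<open>The constant 1 matters here: it is what makes the total variation lower semicontinuous.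
  The integral is an average of the \<open>\<mu> {\<phi> \<ge> i/m}\<close>, up to \<open>1/m\<close>.\<close>

lemma norm_vector_integral_le_tv:
  assumes [measurable]: "\<phi> \<in> borel_measurable borel" and U: "U \<in> sets borel"
    and "\<And>x. 0 \<le> \<phi> x" "\<And>x. \<phi> x \<le> 1" "\<And>x. x \<notin> U \<Longrightarrow> \<phi> x = 0"
  shows "norm (vector_integral \<mu> \<phi>) \<le> tv \<mu> U"
proof -
  \<comment> \<open>Levels start at Suc i, a positive multiple of 1 / (m + 1), so every level set
    lies in \<open>U\<close>, off which \<phi> vanishes.\<close>
  define L where "L m i = {x. real (Suc i) \<le> real (Suc m) * \<phi> x}" for m i :: nat
  define \<psi> where "\<psi> m x = (\<Sum>i\<in>{..<Suc m}. 1 / real (Suc m) * indicator (L m i) x)" for m and x :: "real ^ 'n"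
  have L: "L m i \<in> sets borel" for m i unfolding L_def by measurable
  \<comment> \<open>Counting the levels that are reached rounds (m + 1) \<phi> down to an integer,
    so \<open>\<psi> m\<close> is within 1 / (m + 1) of \<phi>.\<close>
  have count: "(\<Sum>i\<in>{..<Suc m}. indicator (L m i) x) = real_of_int \<lfloor>real (Suc m) * \<phi> x\<rfloor>" for m x
  proof -
    let ?t = "real (Suc m) * \<phi> x"
    have t: "0 \<le> ?t" "?t \<le> real (Suc m)" using assms(3,4)[of x] by (auto intro: mult_left_le)
    have "(\<Sum>i\<in>{..<Suc m}. indicator (L m i) x) = real (card {i \<in> {..<Suc m}. real (Suc i) \<le> ?t})"
    proof -
      have "(\<Sum>i\<in>{..<Suc m}. indicator (L m i) x) = (\<Sum>i\<in>{..<Suc m}. if real (Suc i) \<le> ?t then 1 else (0::real))"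
        by (intro sum.cong) (auto simp: indicator_def L_def)
      also have "\<dots> = real (card {i \<in> {..<Suc m}. real (Suc i) \<le> ?t})"
        by (subst sum.inter_filter[symmetric]) simp_all
      finally show ?thesis .
    qed
    also have "{i \<in> {..<Suc m}. real (Suc i) \<le> ?t} = {..<nat \<lfloor>?t\<rfloor>}"
    proof (rule set_eqI)
      fix i
      have "real (Suc i) \<le> ?t \<longleftrightarrow> int (Suc i) \<le> \<lfloor>?t\<rfloor>"
        by (metis le_floor_iff of_int_of_nat_eq)
      moreover have "\<lfloor>?t\<rfloor> \<le> int (Suc m)" using t(2) by (metis floor_mono floor_of_nat)
      ultimately show "i \<in> {i \<in> {..<Suc m}. real (Suc i) \<le> ?t} \<longleftrightarrow> i \<in> {..<nat \<lfloor>?t\<rfloor>}"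
        unfolding mem_Collect_eq lessThan_iff by linarith
    qed
    finally show ?thesis using t by simp
  qed
  have eq: "\<psi> m x = real_of_int \<lfloor>real (Suc m) * \<phi> x\<rfloor> / real (Suc m)" for m x
    unfolding \<psi>_def sum_distrib_left[symmetric] count by simp
  have close: "\<bar>\<psi> m x - \<phi> x\<bar> \<le> 1 / real (Suc m)" for m x
  proof -
    have "\<bar>real_of_int \<lfloor>real (Suc m) * \<phi> x\<rfloor> - real (Suc m) * \<phi> x\<bar> \<le> 1" by linarith
    then have "\<bar>real_of_int \<lfloor>real (Suc m) * \<phi> x\<rfloor> - real (Suc m) * \<phi> x\<bar> / real (Suc m) \<le> 1 / real (Suc m)"
      by (intro divide_right_mono) auto
    moreover have "\<psi> m x - \<phi> x = (real_of_int \<lfloor>real (Suc m) * \<phi> x\<rfloor> - real (Suc m) * \<phi> x) / real (Suc m)"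
      by (simp add: eq diff_divide_distrib)
    ultimately show ?thesis by (simp add: abs_divide)
  qed
  have lim: "(\<lambda>m. vector_integral \<mu> (\<psi> m)) \<longlonglongrightarrow> vector_integral \<mu> \<phi>"
  proof (rule vector_integral_dct[where C=2])
    show "\<psi> k \<in> borel_measurable borel" for k unfolding \<psi>_def using L by measurable
    show "\<bar>\<psi> k x\<bar> \<le> 2" for k x
    proof -
      have "1 / real (Suc k) \<le> 1" by simp
      then show ?thesis using close[of k x] assms(3,4)[of x] by linarith
    qed
    show "(\<lambda>k. \<psi> k x) \<longlonglongrightarrow> \<phi> x" for x
      by (rule LIM_zero_cancel, rule Lim_null_comparison[OF _ lim_1_over_n[THEN LIMSEQ_Suc]])
         (use close in auto)
  qed
  have "norm (vector_integral \<mu> (\<psi> m)) \<le> tv \<mu> U" for m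
  proof -
    have "vector_integral \<mu> (\<psi> m) = (\<Sum>i\<in>{..<Suc m}. (1 / real (Suc m)) *\<^sub>R \<mu> (L m i))"
      unfolding \<psi>_def using L
      by (subst vector_integral_sum[where C=1]) (auto simp: vector_integral_indicator simp del: lessThan_Suc)
    also have "norm \<dots> \<le> (\<Sum>i\<in>{..<Suc m}. 1 / real (Suc m) * tv \<mu> U)"
    proof (rule sum_norm_le)
      fix i
      have "L m i \<subseteq> U" using assms(5) by (fastforce simp: L_def)
      then show "norm ((1 / real (Suc m)) *\<^sub>R \<mu> (L m i)) \<le> 1 / real (Suc m) * tv \<mu> U"
        using norm_le_tv[OF L _ U] by (simp add: divide_right_mono)
    qed
    also have "\<dots> = tv \<mu> U" by (simp del: lessThan_Suc)
    finally show ?thesis .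
  qed
  then show ?thesis by (intro LIMSEQ_le_const2[OF tendsto_norm[OF lim]]) auto
qed

text \<open>The bound on \<open>F\<close> is split into a part on one set and a constant. With
  \<open>S\<close> a ball around the point of evaluation, the large constant meets only the
  variation of that ball, and the whole mass meets only the small one.\<close>

lemma pairing_bound:
  assumes [measurable]: "F \<in> borel_measurable borel" and S[measurable]: "S \<in> sets borel"
    and F: "\<And>y. norm (F y) \<le> a * indicator S y + c" and "a \<ge> 0" "c \<ge> 0"
  shows "\<bar>pairing \<mu> F\<bar> \<le> a * var \<mu> S + c * var \<mu> UNIV"
proof -
  have one: "\<bar>LINT y|M. F y \<bullet> b\<bar> \<le> a * measure M S + c * measure M UNIV"
    if M: "finite_measure M" "sets M = sets borel" and b: "b \<in> Basis" for M :: "(real ^ 'n) measure" and b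
  proof -
    interpret finite_measure M by (rule M)
    have [measurable_cong]: "sets M = sets borel" by (rule M)
    have sp: "space M = UNIV" using sets_eq_imp_space_eq[OF M(2)] by simp
    have Fb: "\<bar>F y \<bullet> b\<bar> \<le> a * indicator S y + c" for y
      using F[of y] Basis_le_norm[OF b, of "F y"] by linarith
    have ind: "integrable M (indicator S :: _ \<Rightarrow> real)"
      by (rule integrable_real_indicator) (use S M(2) in \<open>auto simp: less_top[symmetric]\<close>)
    then have int: "integrable M (\<lambda>y. a * indicator S y + c)"
      by simp
    have "\<bar>LINT y|M. F y \<bullet> b\<bar> \<le> (LINT y|M. \<bar>F y \<bullet> b\<bar>)"
      by (rule integral_abs_bound)
    also have "\<dots> \<le> (LINT y|M. a * indicator S y + c)"
      by (rule integral_mono'[OF int]) (use Fb assms(4,5) in \<open>auto intro!: add_nonneg_nonneg mult_nonneg_nonneg\<close>)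
    also have "\<dots> = a * measure M S + c * measure M UNIV"
      using ind S M(2) by (simp add: sp)
    finally show ?thesis .
  qed
  have "\<bar>pairing \<mu> F\<bar> \<le> (\<Sum>b\<in>Basis. \<bar>(LINT y|posv \<mu> b. F y \<bullet> b) - (LINT y|negv \<mu> b. F y \<bullet> b)\<bar>)"
    unfolding pairing_def by (rule sum_abs)
  also have "\<dots> \<le> (\<Sum>b\<in>Basis. a * (measure (posv \<mu> b) S + measure (negv \<mu> b) S)
      + c * (measure (posv \<mu> b) UNIV + measure (negv \<mu> b) UNIV))"
  proof (rule sum_mono)
    fix b :: 'w assume b: "b \<in> Basis"
    show "\<bar>(LINT y|posv \<mu> b. F y \<bullet> b) - (LINT y|negv \<mu> b. F y \<bullet> b)\<bar>
      \<le> a * (measure (posv \<mu> b) S + measure (negv \<mu> b) S)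
      + c * (measure (posv \<mu> b) UNIV + measure (negv \<mu> b) UNIV)"
      using one[OF finite_posv sets_posv b, of b] one[OF finite_negv sets_negv b, of b]
      by (simp add: distrib_left)
  qed
  also have "\<dots> = a * var \<mu> S + c * var \<mu> UNIV"
    unfolding var_def sum_distrib_left by (rule sum.distrib)
  finally show ?thesis .
qed

lemma pairing_dct:
  fixes F :: "nat \<Rightarrow> real ^ 'n \<Rightarrow> 'w"
  assumes "\<And>k. F k \<in> borel_measurable borel" "\<And>k x. norm (F k x) \<le> C" "\<And>x. (\<lambda>k. F k x) \<longlonglongrightarrow> G x"
  shows "(\<lambda>k. pairing \<mu> (F k)) \<longlonglongrightarrow> pairing \<mu> G"
  unfolding pairing_def
proof (intro tendsto_sum tendsto_diff)
  fix b :: 'w assume b: "b \<in> Basis"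
  have *: "(\<lambda>y. F k y \<bullet> b) \<in> borel_measurable borel" "\<bar>F k x \<bullet> b\<bar> \<le> C" "(\<lambda>k. F k x \<bullet> b) \<longlonglongrightarrow> G x \<bullet> b" for k x
    using assms(1)[of k] assms(2)[of k x] Basis_le_norm[OF b, of "F k x"] tendsto_inner[OF assms(3) tendsto_const]
    by auto
  show "(\<lambda>k. LINT y|posv \<mu> b. F k y \<bullet> b) \<longlonglongrightarrow> (LINT y|posv \<mu> b. G y \<bullet> b)"
    "(\<lambda>k. LINT y|negv \<mu> b. F k y \<bullet> b) \<longlonglongrightarrow> (LINT y|negv \<mu> b. G y \<bullet> b)"
    using integral_dct[OF *] by auto
qed

lemma pairing_add:
  assumes "F \<in> borel_measurable borel" "\<And>x. norm (F x) \<le> C" "G \<in> borel_measurable borel" "\<And>x. norm (G x) \<le> D"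
  shows "pairing \<mu> (\<lambda>x. F x + G x) = pairing \<mu> F + pairing \<mu> G"
  unfolding pairing_def sum.distrib[symmetric]
  using integrable_bounded[OF assms(1,2)] integrable_bounded[OF assms(3,4)]
  by (intro sum.cong refl) (simp add: inner_add_left)

lemma pairing_uminus: "pairing \<mu> (\<lambda>x. - F x) = - pairing \<mu> F"
  unfolding pairing_def sum_negf[symmetric] by (intro sum.cong) simp_all

lemma pairing_sum:
  assumes "\<And>k. k \<in> I \<Longrightarrow> F k \<in> borel_measurable borel" "\<And>k x. k \<in> I \<Longrightarrow> norm (F k x) \<le> C"
  shows "pairing \<mu> (\<lambda>x. \<Sum>k\<in>I. F k x) = (\<Sum>k\<in>I. pairing \<mu> (F k))"
proof -
  have "integrable (posv \<mu> b) (F k)" "integrable (negv \<mu> b) (F k)" if "k \<in> I" for k b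
    using integrable_bounded[of "F k" C b] assms that by auto
  then have "pairing \<mu> (\<lambda>x. \<Sum>k\<in>I. F k x) = (\<Sum>b\<in>Basis. \<Sum>k\<in>I. (LINT y|posv \<mu> b. F k y \<bullet> b) - (LINT y|negv \<mu> b. F k y \<bullet> b))"
    unfolding pairing_def
    by (simp add: inner_sum_left Bochner_Integration.integral_sum sum_subtractf)
  then show ?thesis unfolding pairing_def by (subst (asm) sum.swap)
qed

lemma pairing_scaleR:
  "pairing \<mu> (\<lambda>y. \<phi> y *\<^sub>R w) = vector_integral \<mu> \<phi> \<bullet> w"
proof -
  have "pairing \<mu> (\<lambda>y. \<phi> y *\<^sub>R w) = (\<Sum>b\<in>Basis. (vector_integral \<mu> \<phi> \<bullet> b) * (w \<bullet> b))"
    unfolding pairing_def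
    by (intro sum.cong) (simp_all add: vector_integral_inner left_diff_distrib)
  then show ?thesis by (simp add: euclidean_inner[of _ w])
qed

text \<open>Domination by an integrable function of \<xi> alone suffices: the Jordan parts are
  finite measures, so \<open>g\<close> stays integrable on the product.\<close>

lemma pairing_fubini:
  fixes f :: "real ^ 'm::finite \<Rightarrow> real ^ 'n \<Rightarrow> 'w"
  assumes m: "(\<lambda>(\<xi>, y). f \<xi> y) \<in> borel_measurable (borel \<Otimes>\<^sub>M borel)"
    and g: "integrable lborel g" and le: "\<And>\<xi> y. norm (f \<xi> y) \<le> g \<xi>"
  shows "pairing \<mu> (\<lambda>y. LINT \<xi>|lborel. f \<xi> y) = (LINT \<xi>|lborel. pairing \<mu> (f \<xi>))"
    and "integrable lborel (\<lambda>\<xi>. pairing \<mu> (f \<xi>))"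
proof -
  have *: "(LINT y|M. (LINT \<xi>|lborel. f \<xi> y) \<bullet> b) = (LINT \<xi>|lborel. (LINT y|M. f \<xi> y \<bullet> b))"
    "integrable lborel (\<lambda>\<xi>. LINT y|M. f \<xi> y \<bullet> b)"
    if M: "finite_measure M" "sets M = sets borel" and b: "b \<in> Basis" for M :: "(real ^ 'n) measure" and b
  proof -
    interpret finite_measure M by (rule M)
    interpret P: pair_sigma_finite lborel M by standard
    have sp: "space M = UNIV" using sets_eq_imp_space_eq[OF M(2)] by simp
    have mm: "(\<lambda>(\<xi>, y). f \<xi> y) \<in> borel_measurable (lborel \<Otimes>\<^sub>M M)"
      using m by (subst measurable_cong_sets[OF sets_pair_measure_cong[OF sets_lborel M(2)] refl])
    then have mb: "(\<lambda>(\<xi>, y). f \<xi> y \<bullet> b) \<in> borel_measurable (lborel \<Otimes>\<^sub>M M)"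
      by (auto simp: case_prod_beta')
    have gm: "g \<in> borel_measurable lborel" using g by auto
    have "integrable (lborel \<Otimes>\<^sub>M M) (\<lambda>z. g (fst z))"
    proof (rule P.Fubini_integrable)
      show "integrable lborel (\<lambda>x. LINT y|M. norm (g (fst (x, y))))"
        using integrable_norm[OF g] by simp
    qed (use gm in auto)
    then have gi: "integrable (lborel \<Otimes>\<^sub>M M) (\<lambda>(\<xi>, y). g \<xi>)" by (simp add: case_prod_beta')
    have I: "integrable (lborel \<Otimes>\<^sub>M M) (\<lambda>(\<xi>, y). f \<xi> y \<bullet> b)"
    proof (rule Bochner_Integration.integrable_bound[OF gi mb])
      show "AE z in lborel \<Otimes>\<^sub>M M. norm (case z of (\<xi>, y) \<Rightarrow> f \<xi> y \<bullet> b) \<le> norm (case z of (\<xi>, y) \<Rightarrow> g \<xi>)"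
        using le Basis_le_norm[OF b] by (auto intro!: AE_I2) (meson abs_ge_self order_trans)
    qed
    have int\<xi>: "integrable lborel (\<lambda>\<xi>. f \<xi> y)" for y
    proof (rule Bochner_Integration.integrable_bound[OF g])
      show "(\<lambda>\<xi>. f \<xi> y) \<in> borel_measurable lborel"
        using measurable_compose[OF measurable_Pair[OF measurable_ident measurable_const, of y borel borel] m]
        by simp
    qed (use le in \<open>auto intro: order_trans[OF _ abs_ge_self]\<close>)
    have "(LINT y|M. (LINT \<xi>|lborel. f \<xi> y) \<bullet> b) = (LINT y|M. (LINT \<xi>|lborel. f \<xi> y \<bullet> b))"
      using int\<xi> by simp
    also have "\<dots> = (LINT \<xi>|lborel. (LINT y|M. f \<xi> y \<bullet> b))"
      by (rule P.Fubini_integral[OF I])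
    finally show "(LINT y|M. (LINT \<xi>|lborel. f \<xi> y) \<bullet> b) = (LINT \<xi>|lborel. (LINT y|M. f \<xi> y \<bullet> b))" .
    show "integrable lborel (\<lambda>\<xi>. LINT y|M. f \<xi> y \<bullet> b)"
      using P.integrable_fst'[OF I] by simp
  qed
  have i: "integrable lborel (\<lambda>\<xi>. (LINT y|posv \<mu> b. f \<xi> y \<bullet> b) - (LINT y|negv \<mu> b. f \<xi> y \<bullet> b))" if "b \<in> Basis" for b
    using *(2)[OF finite_posv sets_posv that, of b] *(2)[OF finite_negv sets_negv that, of b] by auto
  show "integrable lborel (\<lambda>\<xi>. pairing \<mu> (f \<xi>))"
    unfolding pairing_def using i by auto
  show "pairing \<mu> (\<lambda>y. LINT \<xi>|lborel. f \<xi> y) = (LINT \<xi>|lborel. pairing \<mu> (f \<xi>))"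
    unfolding pairing_def
    using *[OF finite_posv sets_posv] *[OF finite_negv sets_negv] i
    by (subst Bochner_Integration.integral_sum) (auto simp: Bochner_Integration.integral_diff)
qed

end

section \<open>Weak derivatives and locally integrable functions\<close>

text \<open>Product measures and changes of variables are handled for Borel functions, while the
  definitions speak of Lebesgue measurable ones; a Borel representative is chosen component by
  component.\<close>

lemma integrable_lebesgue_obtain_lborel:
  fixes u :: "'a::euclidean_space \<Rightarrow> 'b::euclidean_space"
  assumes "integrable lebesgue u"
  obtains u' where "integrable lborel u'" "AE x in lebesgue. u x = u' x"
proof -
  have "\<exists>f. f \<in> borel_measurable lborel \<and> (AE x in lborel. u x \<bullet> b = f x)" for b
    using completion_ex_borel_measurable_real[of "\<lambda>x. u x \<bullet> b" lborel] assms by auto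
  then obtain f where f: "\<And>b. f b \<in> borel_measurable lborel" "\<And>b. AE x in lborel. u x \<bullet> b = f b x"
    by metis
  define u' where "u' x = (\<Sum>b\<in>Basis. f b x *\<^sub>R b)" for x
  have "AE x in lborel. \<forall>b\<in>Basis. u x \<bullet> b = f b x"
    using f(2) by (intro AE_finite_allI) auto
  then have "AE x in lborel. u x = u' x"
    by eventually_elim (simp add: u'_def euclidean_eq_iff[where 'a='b] inner_sum_left_Basis)
  moreover have "u' \<in> borel_measurable lborel"
    unfolding u'_def using f(1) by measurable
  ultimately have u': "u' \<in> borel_measurable lborel" "AE x in lborel. u x = u' x" by auto
  have ae: "AE x in lebesgue. u x = u' x" using u'(2) by (rule AE_completion)
  have "integrable lebesgue u'"
    using assms by (rule integrable_cong_AE_imp) (use ae u'(1) in \<open>auto simp: measurable_completion\<close>)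
  then have "integrable lborel u'" using integrable_completion[OF u'(1)] by simp
  then show ?thesis using ae that by blast
qed

text \<open>The Borel sets over which \<open>g\<close> integrates to 0 form a Dynkin system, and
  open sets are stable under intersection, so all Borel sets qualify; that forces \<open>g\<close>
  to vanish almost everywhere.\<close>

lemma open_integral_zero_imp_AE_zero:
  fixes g :: "'a::euclidean_space \<Rightarrow> 'b::euclidean_space"
  assumes g: "integrable lborel g"
    and zero: "\<And>U. open U \<Longrightarrow> set_lebesgue_integral lborel U g = 0"
  shows "AE x in lborel. g x = 0"
proof (rule sigma_finite_measure.density_zero[OF lborel.sigma_finite_measure_axioms g])
  have sm: "set_integrable lborel A g" if "A \<in> sets borel" for A
    using g that by (simp add: set_integrable_def integrable_mult_indicator)
  fix A assume "A \<in> sets (lborel :: 'a measure)"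
  then have A: "A \<in> sigma_sets UNIV {S :: 'a set. open S}" by (simp add: borel_def sets_measure_of)
  have "Int_stable {S :: 'a set. open S}" "{S :: 'a set. open S} \<subseteq> Pow UNIV"
    by (auto simp: Int_stable_def)
  from this A show "set_lebesgue_integral lborel A g = 0"
  proof (induct rule: sigma_sets_induct_disjoint)
    case (basic A)
    then show ?case using zero by auto
  next
    case empty
    show ?case by (simp add: set_lebesgue_integral_def)
  next
    case (compl A)
    then have A: "A \<in> sets borel" by (simp add: borel_def sets_measure_of)
    have "set_lebesgue_integral lborel (A \<union> (UNIV - A)) g
        = set_lebesgue_integral lborel A g + set_lebesgue_integral lborel (UNIV - A) g"
      by (rule set_integral_Un) (use A sm in \<open>auto intro!: sets.Diff\<close>)
    moreover have "set_lebesgue_integral lborel UNIV g = 0" by (rule zero) simp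
    ultimately show ?case using compl by simp
  next
    case (union A)
    then have A: "A i \<in> sets borel" for i by (auto simp: borel_def sets_measure_of)
    have "set_lebesgue_integral lborel (\<Union> (range A)) g = (\<Sum>i. set_lebesgue_integral lborel (A i) g)"
    proof (rule lebesgue_integral_countable_add)
      show "set_integrable lborel (\<Union> (range A)) g" by (rule sm) (use A in auto)
      show "A i \<inter> A j = {}" if "i \<noteq> j" for i j using union(1) that by (auto simp: disjoint_family_on_def)
    qed (use A in auto)
    then show ?case using union by simp
  qed
qed

lemma test_function_continuous:
  assumes "\<phi> \<in> test_functions"
  shows "continuous_on UNIV \<phi>"
proof -
  have "foldr pd [] \<phi> differentiable_on UNIV"
    using assms unfolding test_functions_def smooth_def by blast
  then show ?thesis using differentiable_imp_continuous_on by fastforce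
qed

lemma test_function_bounded:
  assumes "\<phi> \<in> test_functions"
  obtains C R where "\<And>x. \<bar>\<phi> x\<bar> \<le> C" "\<And>x. norm x > R \<Longrightarrow> \<phi> x = 0" "C \<ge> 0"
proof -
  let ?K = "closure {x. \<phi> x \<noteq> 0}"
  have K: "compact ?K" using assms by (simp add: test_functions_def)
  then obtain R where R: "\<And>x. x \<in> ?K \<Longrightarrow> norm x \<le> R"
    using compact_imp_bounded[OF K] unfolding bounded_iff by blast
  have "compact (\<phi> ` ?K)"
    by (rule compact_continuous_image[OF continuous_on_subset[OF test_function_continuous[OF assms]] K]) simp
  then have "\<exists>C. \<forall>x\<in>?K. \<bar>\<phi> x\<bar> \<le> C"
    by (auto simp: bounded_iff dest!: compact_imp_bounded)
  then obtain C where C: "\<And>x. x \<in> ?K \<Longrightarrow> \<bar>\<phi> x\<bar> \<le> C" by blast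
  have nz: "\<phi> x = 0" if "x \<notin> ?K" for x using that closure_subset[of "{x. \<phi> x \<noteq> 0}"] by auto
  show ?thesis
  proof (rule that)
    show "\<bar>\<phi> x\<bar> \<le> max C 0" for x using C[of x] nz[of x] by (cases "x \<in> ?K") auto
    show "\<phi> x = 0" if "norm x > R" for x using R[of x] nz[of x] that by fastforce
  qed simp
qed

lemma integrable_test_function_mult:
  assumes "locally_integrable w" "\<phi> \<in> test_functions"
  shows "integrable lebesgue (\<lambda>x. \<phi> x *\<^sub>R w x)"
proof -
  obtain C R where CR: "\<And>x. \<bar>\<phi> x\<bar> \<le> C" "\<And>x. norm x > R \<Longrightarrow> \<phi> x = 0" "C \<ge> 0"
    using test_function_bounded[OF assms(2)] by metis
  have i: "integrable lebesgue (\<lambda>x. indicator (cball 0 R) x *\<^sub>R w x)"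
    using assms(1) compact_cball unfolding locally_integrable_def set_integrable_def by blast
  have eq: "(\<lambda>x. \<phi> x *\<^sub>R w x) = (\<lambda>x. \<phi> x *\<^sub>R (indicator (cball 0 R) x *\<^sub>R w x))"
  proof
    fix x
    show "\<phi> x *\<^sub>R w x = \<phi> x *\<^sub>R (indicator (cball 0 R) x *\<^sub>R w x)"
      by (cases "norm x \<le> R") (use CR(2)[of x] in \<open>auto simp: indicator_def\<close>)
  qed
  have "\<phi> \<in> borel_measurable lebesgue"
    using borel_measurable_continuous_onI[OF test_function_continuous[OF assms(2)]]
    by (intro measurable_completion) simp
  then have "(\<lambda>x. \<phi> x *\<^sub>R (indicator (cball 0 R) x *\<^sub>R w x)) \<in> borel_measurable lebesgue"
    by (rule borel_measurable_scaleR[OF _ borel_measurable_integrable[OF i]])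
  then show ?thesis unfolding eq
    by (rule Bochner_Integration.integrable_bound[OF integrable_scaleR_right[OF i, of C]])
       (use CR in \<open>auto intro!: mult_right_mono simp del: scaleR_scaleR\<close>)
qed

text \<open>On a ball \<open>w\<close> is integrable. Test functions with values in [0, 1] that
  converge to the indicator of an open subset of the ball carry the hypothesis over to integrals
  over open sets, and countably many balls exhaust the space.\<close>

lemma du_bois_reymond:
  fixes w :: "real ^ 'n::finite \<Rightarrow> 'v::euclidean_space"
  assumes w: "locally_integrable w"
    and zero: "\<And>\<phi>. \<phi> \<in> test_functions \<Longrightarrow> (LINT x|lebesgue. \<phi> x *\<^sub>R w x) = 0"
  shows "AE x in lebesgue. w x = 0"
proof -
  have "AE x in lebesgue. indicator (ball 0 R) x *\<^sub>R w x = 0" for R :: real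
  proof -
    have "integrable lebesgue (\<lambda>x. indicator (cball 0 R) x *\<^sub>R w x)"
      using w compact_cball unfolding locally_integrable_def set_integrable_def by blast
    then have i: "integrable lebesgue (\<lambda>x. indicator (ball 0 R) x *\<^sub>R w x)"
      using set_integrable_subset[of lebesgue "cball 0 R" w "ball 0 R"]
      by (auto simp: set_integrable_def)
    obtain g where g: "integrable lborel g" "AE x in lebesgue. indicator (ball 0 R) x *\<^sub>R w x = g x"
      using integrable_lebesgue_obtain_lborel[OF i] by metis
    have "AE x in lborel. g x = 0"
    proof (rule open_integral_zero_imp_AE_zero[OF g(1)])
      fix U :: "(real ^ 'n) set" assume U: "open U"
      have "open (U \<inter> ball 0 R)" using U by auto
      then obtain \<phi> where \<phi>: "\<And>k::nat. smooth_expr (\<phi> k)" "\<And>k. \<phi> k \<in> test_functions"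
        "\<And>k x. 0 \<le> \<phi> k x" "\<And>k x. \<phi> k x \<le> 1" "\<And>k x. x \<notin> U \<inter> ball 0 R \<Longrightarrow> \<phi> k x = 0"
        "\<And>x. (\<lambda>k. \<phi> k x) \<longlonglongrightarrow> indicator (U \<inter> ball 0 R) x"
        by (rule open_approx_test_functions) blast
      have "(\<lambda>k. LINT x|lebesgue. \<phi> k x *\<^sub>R w x) \<longlonglongrightarrow> (LINT x|lebesgue. indicator (U \<inter> ball 0 R) x *\<^sub>R w x)"
      proof (rule integral_dominated_convergence[where w="\<lambda>x. norm (indicator (ball 0 R) x *\<^sub>R w x)"])
        show "integrable lebesgue (\<lambda>x. norm (indicator (ball 0 R) x *\<^sub>R w x))" using i by (rule integrable_norm)
        have "(\<lambda>x. indicator U x *\<^sub>R (indicator (ball 0 R) x *\<^sub>R w x)) \<in> borel_measurable lebesgue"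
          by (rule borel_measurable_scaleR[OF borel_measurable_indicator borel_measurable_integrable[OF i]])
             (use U in auto)
        then show "(\<lambda>x. indicator (U \<inter> ball 0 R) x *\<^sub>R w x) \<in> borel_measurable lebesgue"
          by (simp add: indicator_inter_arith)
        show "(\<lambda>x. \<phi> k x *\<^sub>R w x) \<in> borel_measurable lebesgue" for k
          using integrable_test_function_mult[OF w \<phi>(2)] by auto
        show "AE x in lebesgue. (\<lambda>k. \<phi> k x *\<^sub>R w x) \<longlonglongrightarrow> indicator (U \<inter> ball 0 R) x *\<^sub>R w x"
          by (intro AE_I2 tendsto_scaleR \<phi>(6) tendsto_const)
        show "AE x in lebesgue. norm (\<phi> k x *\<^sub>R w x) \<le> norm (indicator (ball 0 R) x *\<^sub>R w x)" for k
        proof (rule AE_I2)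
          fix x
          show "norm (\<phi> k x *\<^sub>R w x) \<le> norm (indicator (ball 0 R) x *\<^sub>R w x)"
            using \<phi>(3,4,5)[where k=k and x=x] by (cases "x \<in> ball 0 R") (auto intro!: mult_left_le_one_le)
        qed
      qed
      then have "(LINT x|lebesgue. indicator (U \<inter> ball 0 R) x *\<^sub>R w x) = 0"
        using zero[OF \<phi>(2)] by (simp add: LIMSEQ_const_iff)
      also have "(LINT x|lebesgue. indicator (U \<inter> ball 0 R) x *\<^sub>R w x) = (LINT x|lebesgue. indicator U x *\<^sub>R g x)"
      proof (rule integral_cong_AE)
        have "(\<lambda>x. indicator U x *\<^sub>R (indicator (ball 0 R) x *\<^sub>R w x)) \<in> borel_measurable lebesgue"
          by (rule borel_measurable_scaleR[OF borel_measurable_indicator borel_measurable_integrable[OF i]])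
             (use U in auto)
        then show "(\<lambda>x. indicator (U \<inter> ball 0 R) x *\<^sub>R w x) \<in> borel_measurable lebesgue"
          by (simp add: indicator_inter_arith)
        show "(\<lambda>x. indicator U x *\<^sub>R g x) \<in> borel_measurable lebesgue"
          using g(1) U by (intro measurable_completion borel_measurable_scaleR borel_measurable_indicator) auto
        show "AE x in lebesgue. indicator (U \<inter> ball 0 R) x *\<^sub>R w x = indicator U x *\<^sub>R g x"
          using g(2) by eventually_elim (simp add: indicator_inter_arith flip: scaleR_scaleR)
      qed
      also have "\<dots> = set_lebesgue_integral lborel U g"
        unfolding set_lebesgue_integral_def
        by (rule integral_completion) (use g(1) U in \<open>auto intro!: borel_measurable_scaleR borel_measurable_indicator\<close>)
      finally show "set_lebesgue_integral lborel U g = 0" .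
    qed
    then have "AE x in lebesgue. g x = 0" by (rule AE_completion)
    with g(2) show ?thesis by eventually_elim simp
  qed
  then have "AE x in lebesgue. \<forall>R::nat. indicator (ball 0 (real R)) x *\<^sub>R w x = 0"
    by (intro AE_all_countable[THEN iffD2] allI)
  then show ?thesis
  proof eventually_elim
    case (elim x)
    obtain R :: nat where "norm x < real R" using reals_Archimedean2 by blast
    with elim[rule_format, of R] show ?case by simp
  qed
qed

section \<open>From Sobolev functions to integrable functions\<close>

lemma locally_integrable_diff:
  "locally_integrable u \<Longrightarrow> locally_integrable v \<Longrightarrow> locally_integrable (\<lambda>x. u x - v x)"
  unfolding locally_integrable_def by (auto intro: set_integral_diff)

lemma integrable_imp_locally_integrable:
  assumes "integrable lebesgue u"
  shows "locally_integrable u"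
  unfolding locally_integrable_def set_integrable_def
  using assms by (auto intro!: integrable_mult_indicator simp: lmeasurable_compact fmeasurableD)

lemma test_integrals_eq_imp_AE_eq:
  fixes u g :: "real ^ 'n::finite \<Rightarrow> 'v::euclidean_space"
  assumes "locally_integrable u" "locally_integrable g"
    and "\<And>\<phi>. \<phi> \<in> test_functions \<Longrightarrow> (LINT x|lebesgue. \<phi> x *\<^sub>R u x) = (LINT x|lebesgue. \<phi> x *\<^sub>R g x)"
  shows "AE x in lebesgue. u x = g x"
proof -
  have "AE x in lebesgue. u x - g x = 0"
  proof (rule du_bois_reymond[OF locally_integrable_diff[OF assms(1,2)]])
    fix \<phi> :: "real ^ 'n \<Rightarrow> real" assume \<phi>: "\<phi> \<in> test_functions"
    show "(LINT x|lebesgue. \<phi> x *\<^sub>R (u x - g x)) = 0"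
      using integrable_test_function_mult[OF assms(1) \<phi>] integrable_test_function_mult[OF assms(2) \<phi>]
        assms(3)[OF \<phi>] by (simp add: scaleR_diff_right)
  qed
  then show ?thesis by simp
qed

lemma has_weak_deriv_0_AE:
  fixes u g :: "real ^ 'n::finite \<Rightarrow> 'v::euclidean_space"
  assumes "has_weak_deriv (\<lambda>_. 0) u g"
  shows "AE x in lebesgue. u x = g x"
  by (rule test_integrals_eq_imp_AE_eq) (use assms in \<open>auto simp: has_weak_deriv_def mi_order_def\<close>)

lemma sobolev1_integrable:
  assumes "u \<in> sobolev1 m"
  shows "integrable lebesgue u"
proof -
  have "mi_order (\<lambda>_::'a. 0) \<le> m" by (simp add: mi_order_def)
  then obtain g where g: "has_weak_deriv (\<lambda>_. 0) u g" "integrable lebesgue g"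
    using assms unfolding sobolev1_def by blast
  have ae: "AE x in lebesgue. g x = u x" using has_weak_deriv_0_AE[OF g(1)] by eventually_elim simp
  show ?thesis
    using g(2) by (rule integrable_cong_AE_imp)
      (use ae borel_measurable_AE[OF borel_measurable_integrable[OF g(2)] ae] in auto)
qed

text \<open>The summand of the zero multi-index is the L^1 norm of a version of \<open>u\<close>:
  \<open>weak_deriv\<close> is an arbitrary choice, but every choice of order 0 agrees with
  \<open>u\<close> almost everywhere. Applied to differences, this turns Sobolev convergence into
  L^1 convergence.\<close>

lemma sobolev1_norm_ge:
  fixes u :: "real ^ 'n::finite \<Rightarrow> 'v::euclidean_space"
  assumes "integrable lebesgue u"
  shows "(LINT x|lebesgue. norm (u x)) \<le> sobolev1_norm m u"
proof -
  let ?z = "\<lambda>_::'n. 0::nat"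
  have "has_weak_deriv ?z u u"
    using integrable_imp_locally_integrable[OF assms] by (simp add: has_weak_deriv_def mi_order_def)
  then have wd: "has_weak_deriv ?z u (weak_deriv ?z u)" 
    unfolding weak_deriv_def by (rule someI[where P="has_weak_deriv ?z u"])
  have ae: "AE x in lebesgue. u x = weak_deriv ?z u x" by (rule has_weak_deriv_0_AE[OF wd])
  have m: "weak_deriv ?z u \<in> borel_measurable lebesgue"
    using borel_measurable_AE[OF _ ae] assms by auto
  have "(LINT x|lebesgue. norm (u x)) = (LINT x|lebesgue. norm (weak_deriv ?z u x))"
    by (rule integral_cong_AE) (use ae m assms in auto)
  also have "\<dots> \<le> sobolev1_norm m u"
    unfolding sobolev1_norm_def
    by (rule member_le_sum[of ?z _ "\<lambda>\<beta>. LINT x|lebesgue. norm (weak_deriv \<beta> u x)"])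
       (auto simp: mi_order_def finite_mi_order_le[unfolded mi_order_def])
  finally show ?thesis .
qed

section \<open>Strict convergence of measures\<close>

context vector_measure
begin

lemma var_inner_regular:
  assumes A: "A \<in> sets borel" and e: "e > 0"
  obtains K where "compact K" "K \<subseteq> A" "var \<mu> (A - K) < e"
proof -
  \<comment> \<open>There are 2 dim W Jordan parts, each approximated up to \<open>d\<close>; the
    extra 1 makes the total strictly smaller than \<open>e\<close>.\<close>
  define d where "d = e / (2 * real DIM('w) + 1)"
  have d: "d > 0" using e by (simp add: d_def)
  have ex: "\<exists>K. compact K \<and> K \<subseteq> A \<and> measure M (A - K) < d"
    if M: "finite_measure M" "sets M = sets borel" for M :: "(real ^ 'n) measure"
  proof -
    interpret finite_measure M by (rule M)
    have "emeasure M A = (SUP K\<in>{K. K \<subseteq> A \<and> compact K}. emeasure M K)"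
      by (rule inner_regular) (use M A in auto)
    moreover have "emeasure M A < emeasure M A + ennreal d"
      using d by (simp add: emeasure_eq_measure ennreal_plus[symmetric] ennreal_less_iff del: ennreal_plus)
    ultimately obtain K where K: "K \<subseteq> A" "compact K" "emeasure M A < emeasure M K + ennreal d"
    proof (cases "measure M A < d")
      \<comment> \<open>The empty set already works here. Below, measure M A - d has to be
        nonnegative, since \<open>ennreal\<close> would truncate it to 0.\<close>
      case True
      then show ?thesis using that[of "{}"] by (simp add: emeasure_eq_measure ennreal_less_iff)
    next
      case False
      assume sup: "emeasure M A = (SUP K\<in>{K. K \<subseteq> A \<and> compact K}. emeasure M K)"
      have "ennreal (measure M A - d) < emeasure M A"
        using d False by (simp add: emeasure_eq_measure ennreal_less_iff)
      then obtain K where K: "K \<subseteq> A" "compact K" "ennreal (measure M A - d) < emeasure M K"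
        unfolding sup by (auto simp: less_SUP_iff)
      then have "measure M A < measure M K + d"
        using False by (simp add: emeasure_eq_measure ennreal_less_iff)
      then have "emeasure M A < emeasure M K + ennreal d"
        using d by (simp add: emeasure_eq_measure ennreal_plus[symmetric] ennreal_less_iff del: ennreal_plus)
      then show ?thesis using that[of K] K by blast
    qed
    have Kb: "K \<in> sets borel" using K by (simp add: borel_compact)
    have "measure M A < measure M K + d"
      using K(3) d by (simp add: emeasure_eq_measure ennreal_plus[symmetric] ennreal_less_iff del: ennreal_plus)
    then have "measure M (A - K) < d"
      using finite_measure_Diff[of A K] A Kb K(1) M(2) by simp
    then show ?thesis using K by blast
  qed
  have "\<exists>K. compact K \<and> K \<subseteq> A \<and> measure (posv \<mu> b) (A - K) < d"
    "\<exists>K. compact K \<and> K \<subseteq> A \<and> measure (negv \<mu> b) (A - K) < d" for b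
    using ex[OF finite_posv sets_posv] ex[OF finite_negv sets_negv] by auto
  then obtain K L where K: "\<And>b. compact (K b)" "\<And>b. K b \<subseteq> A" "\<And>b. measure (posv \<mu> b) (A - K b) < d"
    and L: "\<And>b. compact (L b)" "\<And>b. L b \<subseteq> A" "\<And>b. measure (negv \<mu> b) (A - L b) < d"
    by metis
  define X where "X = (\<Union>b\<in>Basis. K b \<union> L b)"
  have "compact X" unfolding X_def using K(1) L(1) by (intro compact_UN compact_Un) auto
  have le: "measure M (A - X) \<le> measure M (A - Y)"
    if "finite_measure M" "sets M = sets borel" "Y \<subseteq> X" "compact Y" for M :: "(real ^ 'n) measure" and Y
    by (rule finite_measure.finite_measure_mono[OF that(1)])
       (use A that borel_compact in auto)
  have "var \<mu> (A - X) \<le> (\<Sum>b\<in>(Basis :: 'w set). d + d)"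
    unfolding var_def
  proof (intro sum_mono add_mono)
    fix b :: 'w assume b: "b \<in> Basis"
    have "measure (posv \<mu> b) (A - X) \<le> measure (posv \<mu> b) (A - K b)"
      by (rule le[OF finite_posv sets_posv]) (use b K(1) in \<open>auto simp: X_def\<close>)
    then show "measure (posv \<mu> b) (A - X) \<le> d" using K(3)[of b] by linarith
    have "measure (negv \<mu> b) (A - X) \<le> measure (negv \<mu> b) (A - L b)"
      by (rule le[OF finite_negv sets_negv]) (use b L(1) in \<open>auto simp: X_def\<close>)
    then show "measure (negv \<mu> b) (A - X) \<le> d" using L(3)[of b] by linarith
  qed
  also have "\<dots> < e"
  proof -
    have "(2 * real DIM('w) + 1) * d = e" by (simp add: d_def)
    then show ?thesis using d by (simp add: distrib_right)
  qed
  finally have "var \<mu> (A - X) < e" .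
  moreover have "X \<subseteq> A" unfolding X_def using K(2) L(2) by blast
  ultimately show ?thesis using that \<open>compact X\<close> by blast
qed

lemma var_outer_regular:
  assumes A: "A \<in> sets borel" and e: "e > 0"
  obtains V where "open V" "A \<subseteq> V" "var \<mu> (V - A) < e"
proof -
  obtain K where K: "compact K" "K \<subseteq> - A" "var \<mu> (- A - K) < e"
    using var_inner_regular[of "- A" e] A e by (metis borel_comp)
  have "- K - A = - A - K" by auto
  then show ?thesis using K that[of "- K"] by (auto simp: compact_imp_closed open_Compl)
qed

lemma norm_diff_le_var:
  assumes "A \<in> sets borel" "B \<in> sets borel" "A \<subseteq> B"
  shows "norm (\<mu> B - \<mu> A) \<le> var \<mu> (B - A)"
proof -
  have "\<mu> (B - A) \<bullet> b = (\<mu> B - \<mu> A) \<bullet> b" for b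
    using signed_measure.diff[OF component, of B A b] assms by (simp add: inner_diff_left)
  then have "\<mu> (B - A) = \<mu> B - \<mu> A" by (metis euclidean_eqI)
  then show ?thesis using norm_le_var[of "B - A"] assms by (metis sets.Diff)
qed

lemma var_subadd:
  assumes "A \<in> sets borel" "B \<in> sets borel"
  shows "var \<mu> (A \<union> B) \<le> var \<mu> A + var \<mu> B"
proof -
  have "measure M (A \<union> B) \<le> measure M A + measure M B"
    if "finite_measure M" "sets M = sets borel" for M :: "(real ^ 'n) measure"
    using that assms by (intro measure_Un_le) auto
  from this[OF finite_posv sets_posv] this[OF finite_negv sets_negv]
  have "var \<mu> (A \<union> B) \<le> (\<Sum>b\<in>Basis. (measure (posv \<mu> b) A + measure (posv \<mu> b) B)
      + (measure (negv \<mu> b) A + measure (negv \<mu> b) B))"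
    unfolding var_def by (intro sum_mono add_mono) auto
  then show ?thesis by (simp add: var_def sum.distrib)
qed

lemma tv_Compl_le:
  assumes A: "A \<in> sets borel"
  shows "tv \<mu> A + tv \<mu> (- A) \<le> tv \<mu> UNIV"
proof -
  have "(if b then A else - A) \<in> sets borel" for b using A by (auto simp: borel_comp)
  then show ?thesis
    using sum_tv_le[of "UNIV :: bool set" "\<lambda>b. if b then A else - A" UNIV]
    by (auto simp: UNIV_bool disjoint_family_on_def add.commute)
qed

end

section \<open>Semicontinuity of the total variation and strict convergence\<close>

lemma compact_family_separation:
  fixes K :: "'i \<Rightarrow> 'a::metric_space set"
  assumes "finite I" "\<And>i. i \<in> I \<Longrightarrow> compact (K i)" "disjoint_family_on K I"
  obtains W where "\<And>i. i \<in> I \<Longrightarrow> open (W i)" "\<And>i. i \<in> I \<Longrightarrow> K i \<subseteq> W i" "disjoint_family_on W I"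
proof
  \<comment> \<open>The points closer to \<open>K i\<close> than to every other nonempty set of the
    family. An empty set has \<open>infdist\<close> 0 by convention and is therefore treated
    apart.\<close>
  define W where "W i = (if K i = {} then {} else
    (\<Inter>j\<in>{j \<in> I. j \<noteq> i \<and> K j \<noteq> {}}. {x. infdist x (K i) < infdist x (K j)}))" for i
  show "open (W i)" if "i \<in> I" for i
    unfolding W_def using assms(1)
    by (auto intro!: open_INT open_Collect_less continuous_intros)
  show "K i \<subseteq> W i" if i: "i \<in> I" for i
  proof
    fix x assume x: "x \<in> K i"
    have "infdist x (K i) < infdist x (K j)" if j: "j \<in> I" "j \<noteq> i" "K j \<noteq> {}" for j
    proof -
      have "K i \<inter> K j = {}" using assms(3) i j by (auto simp: disjoint_family_on_def)
      then have "x \<notin> K j" using x by auto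
      moreover have "closed (K j)" using assms(2) j compact_imp_closed by auto
      ultimately have "infdist x (K j) \<noteq> 0" using in_closed_iff_infdist_zero j(3) by metis
      then show ?thesis using x infdist_nonneg[of x "K j"] by simp
    qed
    then show "x \<in> W i" using x by (auto simp: W_def)
  qed
  show "disjoint_family_on W I"
    unfolding disjoint_family_on_def
  proof (intro ballI impI)
    fix i j assume ij: "i \<in> I" "j \<in> I" "i \<noteq> j"
    show "W i \<inter> W j = {}"
    proof (rule ccontr)
      assume "W i \<inter> W j \<noteq> {}"
      then obtain x where x: "x \<in> W i" "x \<in> W j" by auto
      then have "K i \<noteq> {}" "K j \<noteq> {}" by (auto simp: W_def split: if_splits)
      then have "infdist x (K i) < infdist x (K j)" "infdist x (K j) < infdist x (K i)"
        using x ij by (auto simp: W_def)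
      then show False by simp
    qed
  qed
qed

text \<open>The blocks of a near-optimal partition of \<open>U\<close> are replaced by disjoint open
  sets carrying test functions whose integrals nearly reproduce \<open>\<mu> E\<close>. Finitely
  many test integrals converge, and for \<open>\<mu>s j\<close> their sum is at most
  \<open>tv (\<mu>s j) U\<close> because \<open>norm_vector_integral_le_tv\<close> has constant
  1.\<close>

lemma tv_lower_semicontinuous:
  fixes \<mu> :: "(real ^ 'n::finite) set \<Rightarrow> 'w::euclidean_space"
  assumes ms: "\<And>j. vector_measure (\<mu>s j)" and m: "vector_measure \<mu>"
    and conv: "\<And>\<phi>. \<phi> \<in> test_functions \<Longrightarrow> (\<lambda>j. vector_integral (\<mu>s j) \<phi>) \<longlonglongrightarrow> vector_integral \<mu> \<phi>"
    and U: "open U" and e: "e > 0"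
  shows "\<forall>\<^sub>F j in sequentially. tv \<mu> U < tv (\<mu>s j) U + e"
proof -
  interpret vector_measure \<mu> by (rule m)
  have Ub: "U \<in> sets borel" using U by auto
  obtain P where P: "finite P" "P \<subseteq> sets borel" "partition_on U P" "tv \<mu> U < (\<Sum>E\<in>P. norm (\<mu> E)) + e / 5"
    using tv_approx[of "e / 5" U] e Ub by auto
  \<comment> \<open>Each block suffers three errors of size \<open>d\<close>: from the block to a
    compact core, from the core to an open set, from the open set to a test function. Together they
    cost at most 3e/5; the choice of the partition and the convergence cost e/5 each.\<close>
  define d where "d = e / (5 * (real (card P) + 1))"
  have d: "d > 0" using e by (simp add: d_def)
  have cd: "real (card P) * d \<le> e / 5" using e by (simp add: d_def field_simps)
  have "\<exists>K. compact K \<and> K \<subseteq> E \<and> var \<mu> (E - K) < d" if "E \<in> P" for E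
    using var_inner_regular[of E d] d P(2) that by (metis subsetD)
  then obtain K where K: "\<And>E. E \<in> P \<Longrightarrow> compact (K E)" "\<And>E. E \<in> P \<Longrightarrow> K E \<subseteq> E"
    "\<And>E. E \<in> P \<Longrightarrow> var \<mu> (E - K E) < d" by metis
  have sub: "E \<subseteq> U" if "E \<in> P" for E using P(3) that by (auto simp: partition_on_def)
  have "disjoint_family_on K P"
    unfolding disjoint_family_on_def
  proof (intro ballI impI)
    fix E F assume EF: "E \<in> P" "F \<in> P" "E \<noteq> F"
    then have "E \<inter> F = {}" using P(3) by (auto simp: partition_on_def disjoint_def)
    then show "K E \<inter> K F = {}" using K(2) EF by blast
  qed
  then obtain W where W: "\<And>E. E \<in> P \<Longrightarrow> open (W E)" "\<And>E. E \<in> P \<Longrightarrow> K E \<subseteq> W E" "disjoint_family_on W P"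
    using compact_family_separation[OF P(1), of K] K(1) by metis
  have "\<exists>V. open V \<and> K E \<subseteq> V \<and> var \<mu> (V - K E) < d" if "E \<in> P" for E
    using var_outer_regular[of "K E" d] d K(1)[OF that] by (metis borel_compact)
  then obtain V where V: "\<And>E. E \<in> P \<Longrightarrow> open (V E)" "\<And>E. E \<in> P \<Longrightarrow> K E \<subseteq> V E"
    "\<And>E. E \<in> P \<Longrightarrow> var \<mu> (V E - K E) < d" by metis
  \<comment> \<open>\<open>W\<close> keeps the sets disjoint, \<open>V\<close> keeps the variation
    outside the compact core small.\<close>
  define O' where "O' E = U \<inter> W E \<inter> V E" for E
  have O_open: "open (O' E)" if "E \<in> P" for E using U W(1)[OF that] V(1)[OF that] by (auto simp: O'_def)
  have "\<exists>\<phi>. \<phi> \<in> test_functions \<and> (\<forall>x. 0 \<le> \<phi> x \<and> \<phi> x \<le> 1 \<and> (x \<notin> O' E \<longrightarrow> \<phi> x = 0)) \<and>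
      norm (\<mu> E) \<le> norm (vector_integral \<mu> \<phi>) + 3 * d" if E: "E \<in> P" for E
  proof -
    have Kb: "K E \<in> sets borel" using K(1)[OF E] by (rule borel_compact)
    have Eb: "E \<in> sets borel" using P(2) E by auto
    have Ob: "O' E \<in> sets borel" using O_open[OF E] by auto
    have 1: "norm (\<mu> E - \<mu> (K E)) < d"
      using norm_diff_le_var[OF Kb Eb K(2)[OF E]] K(3)[OF E] by simp
    have "K E \<subseteq> O' E" using K(2)[OF E] W(2)[OF E] V(2)[OF E] sub[OF E] by (auto simp: O'_def)
    moreover have "var \<mu> (O' E - K E) \<le> var \<mu> (V E - K E)"
      by (rule var_mono) (use Kb V(1)[OF E] in \<open>auto simp: O'_def\<close>)
    ultimately have 2: "norm (\<mu> (O' E) - \<mu> (K E)) < d"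
      using norm_diff_le_var[OF Kb Ob] V(3)[OF E] by linarith
    obtain \<phi> where \<phi>: "\<And>k::nat. smooth_expr (\<phi> k)" "\<And>k. \<phi> k \<in> test_functions"
      "\<And>k x. 0 \<le> \<phi> k x" "\<And>k x. \<phi> k x \<le> 1" "\<And>k x. x \<notin> O' E \<Longrightarrow> \<phi> k x = 0"
      "\<And>x. (\<lambda>k. \<phi> k x) \<longlonglongrightarrow> indicator (O' E) x"
      by (rule open_approx_test_functions[OF O_open[OF E]]) blast
    have "(\<lambda>k. vector_integral \<mu> (\<phi> k)) \<longlonglongrightarrow> vector_integral \<mu> (indicator (O' E))"
      by (rule vector_integral_dct[where C=1])
         (use \<phi> borel_measurable_continuous_onI[OF smooth_expr_continuous[OF \<phi>(1)]] in \<open>auto simp: abs_le_iff intro: order_trans[of _ 0]\<close>)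
    then have "(\<lambda>k. vector_integral \<mu> (\<phi> k)) \<longlonglongrightarrow> \<mu> (O' E)" by (simp add: vector_integral_indicator Ob)
    then obtain k where k: "norm (vector_integral \<mu> (\<phi> k) - \<mu> (O' E)) < d"
      using d by (metis LIMSEQ_D order_refl)
    have "norm (\<mu> E) \<le> norm (vector_integral \<mu> (\<phi> k)) + norm (vector_integral \<mu> (\<phi> k) - \<mu> (O' E))
        + norm (\<mu> (O' E) - \<mu> (K E)) + norm (\<mu> E - \<mu> (K E))"
      by norm
    then have "norm (\<mu> E) \<le> norm (vector_integral \<mu> (\<phi> k)) + 3 * d" using 1 2 k by linarith
    then show ?thesis using \<phi> by blast
  qed
  then obtain \<phi> where \<phi>: "\<And>E. E \<in> P \<Longrightarrow> \<phi> E \<in> test_functions"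
    "\<And>E x. E \<in> P \<Longrightarrow> 0 \<le> \<phi> E x" "\<And>E x. E \<in> P \<Longrightarrow> \<phi> E x \<le> 1"
    "\<And>E x. E \<in> P \<Longrightarrow> x \<notin> O' E \<Longrightarrow> \<phi> E x = 0"
    "\<And>E. E \<in> P \<Longrightarrow> norm (\<mu> E) \<le> norm (vector_integral \<mu> (\<phi> E)) + 3 * d" by metis
  have "(\<lambda>j. \<Sum>E\<in>P. norm (vector_integral (\<mu>s j) (\<phi> E))) \<longlonglongrightarrow> (\<Sum>E\<in>P. norm (vector_integral \<mu> (\<phi> E)))"
    by (intro tendsto_sum tendsto_norm conv \<phi>(1))
  then have "\<forall>\<^sub>F j in sequentially. (\<Sum>E\<in>P. norm (vector_integral (\<mu>s j) (\<phi> E))) > (\<Sum>E\<in>P. norm (vector_integral \<mu> (\<phi> E))) - e / 5"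
    by (rule order_tendstoD) (use e in simp)
  then show ?thesis
  proof eventually_elim
    case (elim j)
    interpret J: vector_measure "\<mu>s j" by (rule ms)
    have "(\<Sum>E\<in>P. norm (vector_integral (\<mu>s j) (\<phi> E))) \<le> (\<Sum>E\<in>P. tv (\<mu>s j) (O' E))"
      by (intro sum_mono J.norm_vector_integral_le_tv)
         (use \<phi> O_open borel_measurable_continuous_onI[OF test_function_continuous[OF \<phi>(1)]] in auto)
    also have "\<dots> \<le> tv (\<mu>s j) U"
    proof (rule J.sum_tv_le[OF P(1)])
      show "disjoint_family_on O' P"
        using W(3) by (fastforce simp: disjoint_family_on_def O'_def)
    qed (use O_open Ub in \<open>auto simp: O'_def\<close>)
    finally have 1: "(\<Sum>E\<in>P. norm (vector_integral (\<mu>s j) (\<phi> E))) \<le> tv (\<mu>s j) U" .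
    have "(\<Sum>E\<in>P. norm (\<mu> E)) \<le> (\<Sum>E\<in>P. norm (vector_integral \<mu> (\<phi> E)) + 3 * d)"
      by (intro sum_mono \<phi>(5))
    also have "\<dots> = (\<Sum>E\<in>P. norm (vector_integral \<mu> (\<phi> E))) + 3 * (real (card P) * d)"
      by (simp add: sum.distrib)
    finally show ?case using 1 elim P(4) cd by linarith
  qed
qed

text \<open>Mass that converges in total and cannot drop below its limit on the open complement
  cannot exceed its limit on the closed set. The factor 2 dim W is the price of returning from
  \<open>tv\<close> to \<open>var\<close>.\<close>

lemma strict_convergence_closed:
  fixes \<mu> :: "(real ^ 'n::finite) set \<Rightarrow> 'w::euclidean_space"
  assumes ms: "\<And>j. vector_measure (\<mu>s j)" and m: "vector_measure \<mu>"
    and conv: "\<And>\<phi>. \<phi> \<in> test_functions \<Longrightarrow> (\<lambda>j. vector_integral (\<mu>s j) \<phi>) \<longlonglongrightarrow> vector_integral \<mu> \<phi>"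
    and strict: "(\<lambda>j. tv (\<mu>s j) UNIV) \<longlonglongrightarrow> tv \<mu> UNIV"
    and F: "closed F" and e: "e > 0"
  shows "\<forall>\<^sub>F j in sequentially. var (\<mu>s j) F \<le> 2 * DIM('w) * (var \<mu> F + e)"
proof -
  interpret vector_measure \<mu> by (rule m)
  have Fb: "F \<in> sets borel" using F by auto
  have "\<forall>\<^sub>F j in sequentially. tv (\<mu>s j) UNIV < tv \<mu> UNIV + e / 2"
    using strict by (rule order_tendstoD) (use e in simp)
  moreover have "\<forall>\<^sub>F j in sequentially. tv \<mu> (- F) < tv (\<mu>s j) (- F) + e / 2"
    by (rule tv_lower_semicontinuous[OF ms m conv]) (use F e in auto)
  ultimately show ?thesis
  proof eventually_elim
    case (elim j)
    interpret J: vector_measure "\<mu>s j" by (rule ms)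
    have "tv (\<mu>s j) F \<le> var \<mu> F + e"
      using J.tv_Compl_le[OF Fb] elim tv_UNIV_le[OF Fb] tv_le_var[OF Fb] by linarith
    then have "2 * DIM('w) * tv (\<mu>s j) F \<le> 2 * DIM('w) * (var \<mu> F + e)"
      by (intro mult_left_mono) auto
    then show ?case using J.var_le_tv[OF Fb] by linarith
  qed
qed

text \<open>Without atoms, small closed balls around every point are light for the limit measure.
  Finitely many of them cover a large ball, and the exterior of a slightly smaller one is light as
  well. These finitely many closed sets stay light along the sequence, and every ball of radius
  \<open>r\<close> lies in one of them.\<close>

lemma strict_convergence_uniformly_small:
  fixes \<mu> :: "(real ^ 'n::finite) set \<Rightarrow> 'w::euclidean_space"
  assumes ms: "\<And>j. vector_measure (\<mu>s j)" and m: "vector_measure \<mu>"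
    and conv: "\<And>\<phi>. \<phi> \<in> test_functions \<Longrightarrow> (\<lambda>j. vector_integral (\<mu>s j) \<phi>) \<longlonglongrightarrow> vector_integral \<mu> \<phi>"
    and strict: "(\<lambda>j. tv (\<mu>s j) UNIV) \<longlonglongrightarrow> tv \<mu> UNIV"
    and atoms: "\<And>x. var \<mu> {x} = 0" and e: "e > 0"
  obtains r where "r > 0" "\<forall>\<^sub>F j in sequentially. \<forall>x. var (\<mu>s j) (ball x r) \<le> e"
proof -
  interpret vector_measure \<mu> by (rule m)
  \<comment> \<open>Chosen so that 2 * dim W * (d + d) = e when
    \<open>strict_convergence_closed\<close> is applied with error \<open>d\<close>.\<close>
  define d where "d = e / (4 * DIM('w))"
  have d: "d > 0" using e by (simp add: d_def)
  have small: "\<forall>\<^sub>F j in sequentially. var (\<mu>s j) F \<le> e" if F: "closed F" "var \<mu> F < d" for F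
  proof -
    have "2 * DIM('w) * (var \<mu> F + d) \<le> 2 * DIM('w) * (d + d)"
      using F by (intro mult_left_mono) auto
    also have "\<dots> = e" by (simp add: d_def)
    finally show ?thesis
      using strict_convergence_closed[OF ms m conv strict F(1) d] by (auto elim!: eventually_mono)
  qed
  obtain K where K: "compact K" "var \<mu> (UNIV - K) < d"
    using var_inner_regular[of UNIV d] d by auto
  obtain R where R: "\<And>x. x \<in> K \<Longrightarrow> norm x < R"
    using compact_imp_bounded[OF K(1)] unfolding bounded_pos_less by auto
  have "var \<mu> (- ball 0 R) \<le> var \<mu> (UNIV - K)"
    by (rule var_mono) (use R borel_compact[OF K(1)] in auto)
  then have out: "\<forall>\<^sub>F j in sequentially. var (\<mu>s j) (- ball 0 R) \<le> e"
    using K by (intro small) auto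
  have "\<exists>r>0. var \<mu> (cball x (2 * r)) < d" for x
  proof -
    obtain V where V: "open V" "{x} \<subseteq> V" "var \<mu> (V - {x}) < d"
      using var_outer_regular[of "{x}" d] d by auto
    then obtain s where s: "s > 0" "cball x s \<subseteq> V" using open_contains_cball[THEN iffD1, OF V(1)] by auto
    have "var \<mu> (cball x (2 * (s / 2))) \<le> var \<mu> (V - {x} \<union> {x})"
      by (rule var_mono) (use s V in auto)
    also have "\<dots> \<le> var \<mu> (V - {x}) + var \<mu> {x}"
      by (rule var_subadd) (use V in auto)
    finally show ?thesis using V(3) atoms[of x] s(1) by (intro exI[of _ "s / 2"]) auto
  qed
  then obtain \<rho> where \<rho>: "\<And>x. \<rho> x > 0" "\<And>x. var \<mu> (cball x (2 * \<rho> x)) < d" by metis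
  have "compact (cball (0 :: real ^ 'n) (R + 1))" by simp
  moreover have "x \<in> UNIV \<Longrightarrow> open (ball x (\<rho> x))" for x by simp
  moreover have "cball 0 (R + 1) \<subseteq> (\<Union>x\<in>UNIV. ball x (\<rho> x))" using \<rho>(1) centre_in_ball by blast
  ultimately obtain X where X: "finite X" "cball 0 (R + 1) \<subseteq> (\<Union>x\<in>X. ball x (\<rho> x))"
    by (rule compactE_image)
  \<comment> \<open>r <= \<rho> x puts a ball centered in the cover into the doubled ball; r <= 1
    keeps balls centered beyond radius R + 1 away from \<open>ball 0 R\<close>.\<close>
  define r where "r = Min (insert 1 (\<rho> ` X))"
  have r: "r > 0" "r \<le> 1" "\<And>x. x \<in> X \<Longrightarrow> r \<le> \<rho> x"
    unfolding r_def using X(1) \<rho>(1) by auto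
  have "\<forall>\<^sub>F j in sequentially. \<forall>x\<in>X. var (\<mu>s j) (cball x (2 * \<rho> x)) \<le> e"
    using X(1) by (intro eventually_ball_finite ballI small \<rho>(2)) auto
  with out have "\<forall>\<^sub>F j in sequentially. \<forall>x. var (\<mu>s j) (ball x r) \<le> e"
  proof eventually_elim
    case (elim j)
    interpret J: vector_measure "\<mu>s j" by (rule ms)
    show ?case
    proof
      fix y
      show "var (\<mu>s j) (ball y r) \<le> e"
      proof (cases "y \<in> cball 0 (R + 1)")
        case True
        then obtain x where x: "x \<in> X" "y \<in> ball x (\<rho> x)" using X(2) by auto
        have "ball y r \<subseteq> cball x (2 * \<rho> x)"
        proof
          fix z assume "z \<in> ball y r"
          then show "z \<in> cball x (2 * \<rho> x)"
            using x r(3)[OF x(1)] dist_triangle[of x z y] by auto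
        qed
        then have "var (\<mu>s j) (ball y r) \<le> var (\<mu>s j) (cball x (2 * \<rho> x))"
          by (rule J.var_mono) auto
        then show ?thesis using elim(2) x(1) by fastforce
      next
        case False
        have "ball y r \<subseteq> - ball 0 R"
        proof
          fix z assume z: "z \<in> ball y r"
          have "norm y \<le> norm z + dist y z" by (metis norm_triangle_sub dist_norm)
          then show "z \<in> - ball 0 R" using z False r(2) by auto
        qed
        then have "var (\<mu>s j) (ball y r) \<le> var (\<mu>s j) (- ball 0 R)"
          by (rule J.var_mono) auto
        then show ?thesis using elim(1) by linarith
      qed
    qed
  qed
  then show ?thesis using that r(1) by blast
qed

section \<open>The symbol and oscillatory kernels\<close>

definition bdd_lipschitz :: "'a::real_normed_vector set \<Rightarrow> ('a \<Rightarrow> 'b::real_normed_vector) \<Rightarrow> bool" where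
  "bdd_lipschitz S f \<longleftrightarrow> (\<exists>C. (\<forall>x\<in>S. norm (f x) \<le> C) \<and> (\<forall>x\<in>S. \<forall>y\<in>S. norm (f x - f y) \<le> C * norm (x - y)))"

lemma bdd_lipschitzI:
  assumes "\<And>x. x \<in> S \<Longrightarrow> norm (f x) \<le> C" "\<And>x y. x \<in> S \<Longrightarrow> y \<in> S \<Longrightarrow> norm (f x - f y) \<le> D * norm (x - y)"
  shows "bdd_lipschitz S f"
proof -
  have "D * norm (x - y) \<le> max C D * norm (x - y)" for x y :: 'a by (intro mult_right_mono) auto
  then show ?thesis
    unfolding bdd_lipschitz_def using assms
    by (intro exI[of _ "max C D"]) (meson max.cobounded1 order_trans)
qed

lemma bdd_lipschitzE:
  assumes "bdd_lipschitz S f"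
  obtains C where "C \<ge> 0" "\<And>x. x \<in> S \<Longrightarrow> norm (f x) \<le> C"
    "\<And>x y. x \<in> S \<Longrightarrow> y \<in> S \<Longrightarrow> norm (f x - f y) \<le> C * norm (x - y)"
proof -
  obtain C where C: "\<And>x. x \<in> S \<Longrightarrow> norm (f x) \<le> C"
    "\<And>x y. x \<in> S \<Longrightarrow> y \<in> S \<Longrightarrow> norm (f x - f y) \<le> C * norm (x - y)"
    using assms unfolding bdd_lipschitz_def by blast
  have "C * norm (x - y) \<le> max C 0 * norm (x - y)" for x y :: 'a by (intro mult_right_mono) auto
  then have "norm (f x - f y) \<le> max C 0 * norm (x - y)" if "x \<in> S" "y \<in> S" for x y
    using C(2)[OF that] order_trans by blast
  then show ?thesis
    using C(1) by (intro that[of "max C 0"]) (auto simp: le_max_iff_disj)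
qed

lemma bdd_lipschitz_const: "bdd_lipschitz S (\<lambda>_. c)"
  by (rule bdd_lipschitzI[where C="norm c" and D=0]) auto

lemma bdd_lipschitz_add:
  assumes "bdd_lipschitz S f" "bdd_lipschitz S g"
  shows "bdd_lipschitz S (\<lambda>x. f x + g x)"
proof -
  obtain C where C: "\<And>x. x \<in> S \<Longrightarrow> norm (f x) \<le> C"
    "\<And>x y. x \<in> S \<Longrightarrow> y \<in> S \<Longrightarrow> norm (f x - f y) \<le> C * norm (x - y)"
    using bdd_lipschitzE[OF assms(1)] by metis
  obtain D where D: "\<And>x. x \<in> S \<Longrightarrow> norm (g x) \<le> D"
    "\<And>x y. x \<in> S \<Longrightarrow> y \<in> S \<Longrightarrow> norm (g x - g y) \<le> D * norm (x - y)"
    using bdd_lipschitzE[OF assms(2)] by metis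
  show ?thesis
  proof (rule bdd_lipschitzI[where C="C + D" and D="C + D"])
    fix x y assume xy: "x \<in> S" "y \<in> S"
    show "norm (f x + g x) \<le> C + D" using norm_triangle_mono[OF C(1) D(1)] xy by blast
    have "norm (f x + g x - (f y + g y)) \<le> norm (f x - f y) + norm (g x - g y)"
      using norm_triangle_ineq[of "f x - f y" "g x - g y"] by (simp add: algebra_simps)
    then show "norm (f x + g x - (f y + g y)) \<le> (C + D) * norm (x - y)"
      using C(2)[OF xy] D(2)[OF xy] by (simp add: distrib_right)
  qed
qed

text \<open>The Lipschitz estimate of a product uses the bounds of both factors, which is why
  boundedness is part of \<open>bdd_lipschitz\<close>.\<close>

lemma (in bounded_bilinear) bdd_lipschitz:
  assumes "bdd_lipschitz S f" "bdd_lipschitz S g"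
  shows "bdd_lipschitz S (\<lambda>x. prod (f x) (g x))"
proof -
  obtain C where C: "C \<ge> 0" "\<And>x. x \<in> S \<Longrightarrow> norm (f x) \<le> C"
    "\<And>x y. x \<in> S \<Longrightarrow> y \<in> S \<Longrightarrow> norm (f x - f y) \<le> C * norm (x - y)"
    using bdd_lipschitzE[OF assms(1)] by metis
  obtain D where D: "D \<ge> 0" "\<And>x. x \<in> S \<Longrightarrow> norm (g x) \<le> D"
    "\<And>x y. x \<in> S \<Longrightarrow> y \<in> S \<Longrightarrow> norm (g x - g y) \<le> D * norm (x - y)"
    using bdd_lipschitzE[OF assms(2)] by metis
  obtain K where K: "K > 0" "\<And>a b. norm (prod a b) \<le> norm a * norm b * K"
    using pos_bounded by blast
  show ?thesis
  proof (rule bdd_lipschitzI[where C="C * D * K" and D="2 * C * D * K"])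
    fix x y assume xy: "x \<in> S" "y \<in> S"
    show "norm (prod (f x) (g x)) \<le> C * D * K"
      by (rule order_trans[OF K(2)]) (use C D K xy in \<open>auto intro!: mult_mono\<close>)
    have "prod (f x) (g x) - prod (f y) (g y) = prod (f x - f y) (g x) + prod (f y) (g x - g y)"
      by (simp add: diff_left diff_right)
    also have "norm \<dots> \<le> norm (prod (f x - f y) (g x)) + norm (prod (f y) (g x - g y))"
      by (rule norm_triangle_ineq)
    also have "\<dots> \<le> (C * norm (x - y)) * D * K + C * (D * norm (x - y)) * K"
    proof (rule add_mono)
      have "norm (f x - f y) * norm (g x) * K \<le> (C * norm (x - y)) * D * K"
        using C(3)[OF xy] D(2)[OF xy(1)] C(1) D(1) K(1) by (intro mult_mono) auto
      then show "norm (prod (f x - f y) (g x)) \<le> (C * norm (x - y)) * D * K"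
        using K(2) order_trans by blast
      have "norm (f y) * norm (g x - g y) * K \<le> C * (D * norm (x - y)) * K"
        using C(2)[OF xy(2)] D(3)[OF xy] C(1) D(1) K(1) by (intro mult_mono) auto
      then show "norm (prod (f y) (g x - g y)) \<le> C * (D * norm (x - y)) * K"
        using K(2) order_trans by blast
    qed
    finally show "norm (prod (f x) (g x) - prod (f y) (g y)) \<le> 2 * C * D * K * norm (x - y)"
      by (simp add: mult_ac)
  qed
qed

lemmas bdd_lipschitz_mult = bounded_bilinear.bdd_lipschitz[OF bounded_bilinear_mult]
lemmas bdd_lipschitz_scaleR = bounded_bilinear.bdd_lipschitz[OF bounded_bilinear_scaleR]
lemmas bdd_lipschitz_inner = bounded_bilinear.bdd_lipschitz[OF bounded_bilinear_inner]
lemmas bdd_lipschitz_blinfun = bounded_bilinear.bdd_lipschitz[OF bounded_bilinear_blinfun_apply]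

lemma bdd_lipschitz_sum:
  assumes "\<And>i. i \<in> I \<Longrightarrow> bdd_lipschitz S (f i)"
  shows "bdd_lipschitz S (\<lambda>x. \<Sum>i\<in>I. f i x)"
  using assms by (induction I rule: infinite_finite_induct) (simp_all add: bdd_lipschitz_const bdd_lipschitz_add)

lemma bdd_lipschitz_prod:
  fixes f :: "'i \<Rightarrow> 'a::real_normed_vector \<Rightarrow> real"
  assumes "\<And>i. i \<in> I \<Longrightarrow> bdd_lipschitz S (f i)"
  shows "bdd_lipschitz S (\<lambda>x. \<Prod>i\<in>I. f i x)"
  using assms by (induction I rule: infinite_finite_induct) (simp_all add: bdd_lipschitz_const bdd_lipschitz_mult)

lemma bdd_lipschitz_power:
  fixes f :: "'a::real_normed_vector \<Rightarrow> real"
  shows "bdd_lipschitz S f \<Longrightarrow> bdd_lipschitz S (\<lambda>x. f x ^ k)"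
  by (induction k) (simp_all add: bdd_lipschitz_const bdd_lipschitz_mult)

lemma bdd_lipschitz_symbol:
  assumes "bounded S"
  shows "bdd_lipschitz S (symbol k B)"
proof -
  obtain R where R: "\<And>x. x \<in> S \<Longrightarrow> norm x \<le> R" using assms bounded_iff by blast
  have "bdd_lipschitz S (\<lambda>x. x $ i)" for i
  proof (rule bdd_lipschitzI[where C=R and D=1])
    show "norm (x $ i) \<le> R" if "x \<in> S" for x
      using order_trans[OF component_le_norm_cart R[OF that]] by simp
    show "norm (x $ i - y $ i) \<le> 1 * norm (x - y)" for x y :: "real ^ 'a"
      using component_le_norm_cart[of "x - y" i] by simp
  qed
  then have "bdd_lipschitz S (\<lambda>\<xi>. \<Sum>\<beta> | mi_order \<beta> = k. mi_power \<xi> \<beta> *\<^sub>R B \<beta>)"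
    unfolding mi_power_def
    by (intro bdd_lipschitz_sum bdd_lipschitz_scaleR bdd_lipschitz_prod bdd_lipschitz_power bdd_lipschitz_const)
  then show ?thesis by (simp add: symbol_def[abs_def])
qed

section \<open>Homogeneity of the symbol and dyadic cutoffs\<close>

lemma mi_power_scale: "mi_power (t *\<^sub>R \<xi>) \<beta> = t ^ mi_order \<beta> * mi_power \<xi> \<beta>"
  by (simp add: mi_power_def mi_order_def power_mult_distrib prod.distrib power_sum)

lemma symbol_scale: "symbol k B (t *\<^sub>R \<xi>) = t ^ k *\<^sub>R symbol k B \<xi>"
  unfolding symbol_def scaleR_sum_right by (intro sum.cong) (auto simp: mi_power_scale)

definition annulus :: "(real ^ 'n::finite) set" where
  "annulus = {\<xi>. 1 / 2 \<le> norm \<xi> \<and> norm \<xi> \<le> 2}"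

definition cutoff :: "real ^ 'n::finite \<Rightarrow> real" where
  "cutoff \<xi> = max 0 (min 1 (2 - norm \<xi>))"

text \<open>The difference of consecutive low-pass multipliers after rescaling. It lives on the
  annulus, away from frequency 0 where inverting the symbol is singular, and equals 1 on the unit
  sphere, the set that enters the definition of canceling.\<close>

definition ring_cutoff :: "real ^ 'n::finite \<Rightarrow> real" where
  "ring_cutoff \<xi> = cutoff \<xi> - cutoff (2 *\<^sub>R \<xi>)"

lemma ring_cutoff_props:
  "0 \<le> ring_cutoff \<xi>" "\<xi> \<notin> annulus \<Longrightarrow> ring_cutoff \<xi> = 0" "norm \<xi> = 1 \<Longrightarrow> ring_cutoff \<xi> = 1"
  by (auto simp: ring_cutoff_def cutoff_def annulus_def)

lemma ring_cutoff_lipschitz: "bdd_lipschitz UNIV ring_cutoff"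
proof (rule bdd_lipschitzI[where C=1 and D=3])
  show "norm (ring_cutoff x) \<le> 1" for x :: "real ^ 'a"
    by (auto simp: ring_cutoff_def cutoff_def)
  fix x y :: "real ^ 'a"
  have *: "\<bar>max 0 (min 1 (2 - a)) - max 0 (min 1 (2 - b))\<bar> \<le> \<bar>a - b\<bar>" for a b :: real
    by (simp add: max_def min_def abs_minus_commute)
  have d: "\<bar>2 * norm x - 2 * norm y\<bar> = 2 * \<bar>norm x - norm y\<bar>" by (simp add: abs_if)
  have 2: "\<bar>cutoff (2 *\<^sub>R x) - cutoff (2 *\<^sub>R y)\<bar> \<le> 2 * norm (x - y)"
  proof -
    have n: "norm (2 *\<^sub>R z) = 2 * norm z" for z :: "real ^ 'a" by simp
    show ?thesis
      using *[of "2 * norm x" "2 * norm y"] norm_triangle_ineq3[of x y] d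
      unfolding cutoff_def n by linarith
  qed
  have 1: "\<bar>cutoff x - cutoff y\<bar> \<le> norm (x - y)"
    using order_trans[OF *[of "norm x" "norm y"] norm_triangle_ineq3[of x y]]
    unfolding cutoff_def .
  then show "norm (ring_cutoff x - ring_cutoff y) \<le> 3 * norm (x - y)"
    using 1 2 unfolding ring_cutoff_def real_norm_def by linarith
qed

text \<open>Lipschitz multipliers with compact support: one order of decay of their Fourier transform is
  all that is needed.\<close>

definition multiplier :: "(real ^ 'n::finite \<Rightarrow> 'w::euclidean_space) \<Rightarrow> bool" where
  "multiplier m \<longleftrightarrow> bdd_lipschitz UNIV m \<and> (\<forall>\<xi>. norm \<xi> > 2 \<longrightarrow> m \<xi> = 0)"

text \<open>Control of \<open>f\<close> on the annulus is enough: the cutoff vanishes outside and is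
  itself Lipschitz, so a pair with one point outside is handled by the cutoff alone.\<close>

lemma multiplier_ring_cutoff:
  fixes f :: "real ^ 'n::finite \<Rightarrow> 'w::euclidean_space"
  assumes "bdd_lipschitz annulus f"
  shows "multiplier (\<lambda>\<xi>. ring_cutoff \<xi> *\<^sub>R f \<xi>)"
proof -
  obtain C where C: "C \<ge> 0" "\<And>x. x \<in> annulus \<Longrightarrow> norm (f x) \<le> C"
    "\<And>x y. x \<in> annulus \<Longrightarrow> y \<in> annulus \<Longrightarrow> norm (f x - f y) \<le> C * norm (x - y)"
    using bdd_lipschitzE[OF assms] by metis
  obtain D where D: "D \<ge> 0" "\<And>x :: real ^ 'n. norm (ring_cutoff x) \<le> D"
    "\<And>x y :: real ^ 'n. norm (ring_cutoff x - ring_cutoff y) \<le> D * norm (x - y)"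
    using bdd_lipschitzE[OF ring_cutoff_lipschitz] by (metis UNIV_I)
  have one: "norm (ring_cutoff x *\<^sub>R f x - ring_cutoff y *\<^sub>R f y) \<le> 2 * C * D * norm (x - y)"
    if x: "x \<in> annulus" for x y
  proof (cases "y \<in> annulus")
    case True
    have "ring_cutoff x *\<^sub>R f x - ring_cutoff y *\<^sub>R f y = (ring_cutoff x - ring_cutoff y) *\<^sub>R f x + ring_cutoff y *\<^sub>R (f x - f y)"
      by (simp add: algebra_simps)
    also have "norm \<dots> \<le> norm ((ring_cutoff x - ring_cutoff y) *\<^sub>R f x) + norm (ring_cutoff y *\<^sub>R (f x - f y))"
      by (rule norm_triangle_ineq)
    also have "\<dots> \<le> (D * norm (x - y)) * C + D * (C * norm (x - y))"
      unfolding norm_scaleR using C D x True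
      by (intro add_mono mult_mono) (auto simp flip: real_norm_def)
    finally show ?thesis by (simp add: mult_ac)
  next
    case False
    then have "norm (ring_cutoff x *\<^sub>R f x - ring_cutoff y *\<^sub>R f y) = norm (ring_cutoff x - ring_cutoff y) * norm (f x)"
      by (simp add: ring_cutoff_props)
    also have "\<dots> \<le> (D * norm (x - y)) * C"
      using C D x by (intro mult_mono) auto
    also have "\<dots> \<le> 2 * C * D * norm (x - y)"
      using C D by (simp add: mult_ac mult_left_mono)
    finally show ?thesis .
  qed
  have "bdd_lipschitz UNIV (\<lambda>\<xi>. ring_cutoff \<xi> *\<^sub>R f \<xi>)"
  proof (rule bdd_lipschitzI[where C="D * C" and D="2 * C * D"])
    fix x y :: "real ^ 'n"
    show "norm (ring_cutoff x *\<^sub>R f x) \<le> D * C"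
    proof (cases "x \<in> annulus")
      case True
      then show ?thesis unfolding norm_scaleR using C D by (intro mult_mono) (auto simp flip: real_norm_def)
    qed (use C D in \<open>auto simp: ring_cutoff_props\<close>)
    show "norm (ring_cutoff x *\<^sub>R f x - ring_cutoff y *\<^sub>R f y) \<le> 2 * C * D * norm (x - y)"
      using one[of x y] one[of y x] C D
      by (cases "x \<in> annulus"; cases "y \<in> annulus")
         (auto simp: norm_minus_commute ring_cutoff_props)
  qed
  moreover have "ring_cutoff \<xi> = 0" if "norm \<xi> > 2" for \<xi> :: "real ^ 'n"
    by (rule ring_cutoff_props) (use that in \<open>auto simp: annulus_def\<close>)
  ultimately show ?thesis by (auto simp: multiplier_def)
qed

lemma multiplier_continuous: "multiplier m \<Longrightarrow> continuous_on UNIV m"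
proof -
  assume "multiplier m"
  then obtain C where C: "C \<ge> 0" "\<And>x y. norm (m x - m y) \<le> C * norm (x - y)"
    unfolding multiplier_def using bdd_lipschitzE by (metis UNIV_I)
  have "C-lipschitz_on UNIV m"
    by (rule lipschitz_onI) (use C in \<open>auto simp: dist_norm\<close>)
  then show ?thesis by (rule lipschitz_on_continuous_on)
qed

section \<open>Boundedness, decay and Lipschitz continuity of oscillatory integrals\<close>

lemma integrable_bounded_support:
  fixes f :: "'a::euclidean_space \<Rightarrow> 'b::euclidean_space"
  assumes "f \<in> borel_measurable borel" "\<And>x. norm (f x) \<le> C" "\<And>x. norm x > R \<Longrightarrow> f x = 0"
  shows "integrable lborel f" "norm (integral\<^sup>L lborel f) \<le> C * measure lborel (cball 0 R :: 'a set)"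
proof -
  have ind: "integrable lborel (\<lambda>x. C * indicator (cball 0 R :: 'a set) x)"
    by (intro integrable_mult_right integrable_real_indicator emeasure_lborel_cball_finite) auto
  have le: "norm (f x) \<le> C * indicator (cball 0 R) x" for x
    using assms(2)[of x] assms(3)[of x] by (cases "norm x \<le> R") auto
  show i: "integrable lborel f"
    by (rule Bochner_Integration.integrable_bound[OF ind])
       (use assms(1) le in \<open>auto intro: order_trans[OF _ abs_ge_self]\<close>)
  have "norm (integral\<^sup>L lborel f) \<le> (LINT x|lborel. norm (f x))" by (rule integral_norm_bound)
  also have "\<dots> \<le> (LINT x|lborel. C * indicator (cball 0 R :: 'a set) x)"
    by (rule integral_mono[OF integrable_norm[OF i] ind le])
  finally show "norm (integral\<^sup>L lborel f) \<le> C * measure lborel (cball 0 R :: 'a set)" by simp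
qed

lemma lborel_integral_shift:
  fixes f :: "'a::euclidean_space \<Rightarrow> 'b::{banach, second_countable_topology}"
  assumes "f \<in> borel_measurable borel"
  shows "(LINT x|lborel. f (h + x)) = integral\<^sup>L lborel f"
proof -
  have "integral\<^sup>L lborel f = integral\<^sup>L (distr lborel borel ((+) h)) f"
    by (simp add: lborel_distr_plus)
  also have "\<dots> = (LINT x|lborel. f (h + x))"
    by (rule integral_distr) (use assms in auto)
  finally show ?thesis by simp
qed

definition osc :: "(real ^ 'n::finite \<Rightarrow> 'w::euclidean_space) \<Rightarrow> real \<Rightarrow> real ^ 'n \<Rightarrow> 'w" where
  "osc m t z = (LINT \<xi>|lborel. cos (\<xi> \<bullet> z + t) *\<^sub>R m \<xi>)"

lemma osc_integrable:
  fixes m :: "real ^ 'n::finite \<Rightarrow> 'w::euclidean_space"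
  assumes m: "multiplier m"
  shows "integrable lborel (\<lambda>\<xi>. cos (\<xi> \<bullet> z + t) *\<^sub>R m \<xi>)"
proof -
  obtain C where C: "\<And>\<xi>. norm (m \<xi>) \<le> C"
    using m unfolding multiplier_def using bdd_lipschitzE by (metis UNIV_I)
  have [measurable]: "m \<in> borel_measurable borel"
    by (rule borel_measurable_continuous_onI[OF multiplier_continuous[OF m]])
  show ?thesis
  proof (rule integrable_bounded_support(1)[where C=C and R=2])
    show "norm (cos (x \<bullet> z + t) *\<^sub>R m x) \<le> C" for x
      using C[of x] mult_left_le_one_le[of "norm (m x)" "\<bar>cos (x \<bullet> z + t)\<bar>"] by simp
  qed (use m in \<open>auto simp: multiplier_def\<close>)
qed

text \<open>The decay comes from a half-period shift instead of differentiation. Translating \<xi>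
  by a vector \<open>h\<close> along \<open>z\<close> with h \<bullet> z = pi reverses the sign of
  the cosine, so twice the integral is the integral of the cosine times m \<xi> - m (h + \<xi>), and
  the Lipschitz bound supplies the factor norm h = pi / norm z.\<close>

lemma osc_bounds:
  fixes m :: "real ^ 'n::finite \<Rightarrow> 'w::euclidean_space"
  assumes m: "multiplier m"
  obtains C where "C \<ge> 0" "\<And>t z. norm (osc m t z) \<le> C" "\<And>t z. norm (osc m t z) * norm z \<le> C"
    "\<And>t z z'. norm (osc m t z - osc m t z') \<le> C * norm (z - z')"
proof -
  obtain L where L: "L \<ge> 0" "\<And>\<xi>. norm (m \<xi>) \<le> L" "\<And>\<xi> \<eta>. norm (m \<xi> - m \<eta>) \<le> L * norm (\<xi> - \<eta>)"
    using m unfolding multiplier_def using bdd_lipschitzE by (metis UNIV_I)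
  have m0: "m \<xi> = 0" if "norm \<xi> > 2" for \<xi> using m that by (simp add: multiplier_def)
  have [measurable]: "m \<in> borel_measurable borel"
    by (rule borel_measurable_continuous_onI[OF multiplier_continuous[OF m]])
  \<comment> \<open>Radius 3 rather than 2: the translated multiplier is supported there, since the
    shift has length at most 1.\<close>
  define V where "V = measure lborel (cball (0 :: real ^ 'n) 3)"
  have V: "V \<ge> 0" by (simp add: V_def)
  have cos1: "norm (cos s *\<^sub>R w) \<le> norm w" for s and w :: 'w
    using mult_left_le_one_le[of "norm w" "\<bar>cos s\<bar>"] by simp
  have bound: "norm (osc m t z) \<le> L * V" for t z
    unfolding osc_def V_def
    by (rule integrable_bounded_support(2))
       (use L m0 order_trans[OF cos1 L(2)] in auto)
  have lip: "norm (osc m t z - osc m t z') \<le> 3 * L * V * norm (z - z')" for t z z'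
  proof -
    have "osc m t z - osc m t z' = (LINT \<xi>|lborel. (cos (\<xi> \<bullet> z + t) - cos (\<xi> \<bullet> z' + t)) *\<^sub>R m \<xi>)"
      unfolding osc_def by (simp add: osc_integrable[OF m] scaleR_diff_left)
    also have "norm \<dots> \<le> (3 * norm (z - z') * L) * V"
      unfolding V_def
    proof (rule integrable_bounded_support(2))
      fix \<xi> :: "real ^ 'n"
      show "norm ((cos (\<xi> \<bullet> z + t) - cos (\<xi> \<bullet> z' + t)) *\<^sub>R m \<xi>) \<le> 3 * norm (z - z') * L"
      proof (cases "norm \<xi> \<le> 3")
        case True
        have "\<bar>cos (\<xi> \<bullet> z + t) - cos (\<xi> \<bullet> z' + t)\<bar> \<le> \<bar>\<xi> \<bullet> (z - z')\<bar>"
        proof -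
          have "cos (\<xi> \<bullet> z + t) - cos (\<xi> \<bullet> z' + t)
            = 2 * sin ((\<xi> \<bullet> z + t + (\<xi> \<bullet> z' + t)) / 2) * sin ((\<xi> \<bullet> z' + t - (\<xi> \<bullet> z + t)) / 2)"
            by (rule cos_diff_cos)
          then have "\<bar>cos (\<xi> \<bullet> z + t) - cos (\<xi> \<bullet> z' + t)\<bar>
            \<le> 2 * 1 * \<bar>sin ((\<xi> \<bullet> z' + t - (\<xi> \<bullet> z + t)) / 2)\<bar>"
            unfolding abs_mult by (simp add: abs_mult mult_left_le_one_le)
          also have "\<dots> \<le> 2 * 1 * \<bar>(\<xi> \<bullet> z' + t - (\<xi> \<bullet> z + t)) / 2\<bar>"
            by (intro mult_left_mono abs_sin_x_le_abs_x) auto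
          finally show ?thesis by (simp add: inner_diff_right)
        qed
        also have "\<dots> \<le> norm \<xi> * norm (z - z')" by (rule Cauchy_Schwarz_ineq2)
        also have "\<dots> \<le> 3 * norm (z - z')" using True by (intro mult_right_mono) auto
        finally show ?thesis unfolding norm_scaleR real_norm_def using L
          by (intro mult_mono) auto
      qed (use m0 L in auto)
    qed (use m0 in auto)
    finally show ?thesis by (simp add: mult_ac)
  qed
  have decay: "norm (osc m t z) * norm z \<le> 4 * L * V" for t z
  proof (cases "norm z \<le> pi")
    \<comment> \<open>Here the shift could be longer than 1; boundedness of the integral and pi < 4
      are enough.\<close>
    case True
    have "norm (osc m t z) * norm z \<le> (L * V) * 4"
      using bound[of t z] True pi_less_4 L V by (intro mult_mono) auto
    then show ?thesis by (simp add: mult_ac)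
  next
    case False
    define h where "h = (pi / (norm z)\<^sup>2) *\<^sub>R z"
    have z0: "norm z > 0" using False pi_gt_zero by linarith
    have nh: "norm h = pi / norm z" using z0 by (simp add: h_def power2_eq_square)
    then have nh1: "norm h \<le> 1" using False z0 by simp
    have hz: "h \<bullet> z = pi" using z0 by (simp add: h_def power2_norm_eq_inner)
    have "osc m t z = (LINT \<xi>|lborel. cos ((h + \<xi>) \<bullet> z + t) *\<^sub>R m (h + \<xi>))"
      unfolding osc_def by (rule lborel_integral_shift[symmetric]) measurable
    also have "\<dots> = (LINT \<xi>|lborel. - (cos (\<xi> \<bullet> z + t) *\<^sub>R m (h + \<xi>)))"
    proof -
      have "cos ((h + \<xi>) \<bullet> z + t) = - cos (\<xi> \<bullet> z + t)" for \<xi>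
        using cos_periodic_pi[of "\<xi> \<bullet> z + t"] by (simp add: inner_add_left hz add_ac)
      then show ?thesis by simp
    qed
    finally have eq: "osc m t z = (LINT \<xi>|lborel. - (cos (\<xi> \<bullet> z + t) *\<^sub>R m (h + \<xi>)))" .
    have mh0: "m (h + \<xi>) = 0" if "norm \<xi> > 3" for \<xi>
    proof (rule m0)
      have "norm \<xi> \<le> norm (h + \<xi>) + norm h" by norm
      then show "norm (h + \<xi>) > 2" using nh1 that by linarith
    qed
    have int: "integrable lborel (\<lambda>\<xi>. - (cos (\<xi> \<bullet> z + t) *\<^sub>R m (h + \<xi>)))"
      by (rule integrable_bounded_support(1)[where C=L and R=3])
         (use mh0 order_trans[OF cos1 L(2)] in auto)
    have "2 *\<^sub>R osc m t z = osc m t z + osc m t z" by (rule scaleR_2)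
    also have "\<dots> = (LINT \<xi>|lborel. cos (\<xi> \<bullet> z + t) *\<^sub>R m \<xi>) + (LINT \<xi>|lborel. - (cos (\<xi> \<bullet> z + t) *\<^sub>R m (h + \<xi>)))"
      using eq by (simp only: osc_def)
    also have "\<dots> = (LINT \<xi>|lborel. cos (\<xi> \<bullet> z + t) *\<^sub>R (m \<xi> - m (h + \<xi>)))"
      by (subst Bochner_Integration.integral_add[OF osc_integrable[OF m] int, symmetric])
         (simp add: scaleR_diff_right)
    finally have "2 *\<^sub>R osc m t z = (LINT \<xi>|lborel. cos (\<xi> \<bullet> z + t) *\<^sub>R (m \<xi> - m (h + \<xi>)))" .
    also have "norm \<dots> \<le> (L * norm h) * V"
      unfolding V_def
    proof (rule integrable_bounded_support(2))
      show "norm (cos (\<xi> \<bullet> z + t) *\<^sub>R (m \<xi> - m (h + \<xi>))) \<le> L * norm h" for \<xi>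
        using order_trans[OF cos1 L(3)[of \<xi> "h + \<xi>"]] by simp
    qed (use m0 mh0 in auto)
    finally have "2 * norm (osc m t z) \<le> (L * (pi / norm z)) * V" by (simp add: nh)
    then have "2 * norm (osc m t z) * norm z \<le> (L * (pi / norm z)) * V * norm z"
      using z0 by (intro mult_right_mono) auto
    also have "\<dots> = pi * (L * V)" using z0 by simp
    also have "\<dots> \<le> 4 * (L * V)" using pi_less_4 L V by (intro mult_right_mono) auto
    finally have "2 * (norm (osc m t z) * norm z) \<le> 4 * (L * V)" by (simp only: mult.assoc)
    moreover have "0 \<le> L * V" using L V by simp
    ultimately have "norm (osc m t z) * norm z \<le> 4 * (L * V)" by linarith
    then show ?thesis by (simp only: mult.assoc)
  qed
  show ?thesis
  proof (rule that[of "4 * L * V"])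
    have LV: "0 \<le> L * V" using L V by simp
    then show "0 \<le> 4 * L * V" by simp
    show "norm (osc m t z) \<le> 4 * L * V" for t z using bound[of t z] LV by linarith
    show "norm (osc m t z) * norm z \<le> 4 * L * V" for t z by (rule decay)
    show "norm (osc m t z - osc m t z') \<le> 4 * L * V * norm (z - z')" for t z z'
      using lip[of t z z'] mult_right_mono[of "3 * L * V" "4 * L * V" "norm (z - z')"] LV by simp
  qed
qed

section \<open>Inverting an elliptic symbol on the annulus\<close>

locale elliptic_op =
  fixes k :: nat and B :: "('n::finite \<Rightarrow> nat) \<Rightarrow> 'v::euclidean_space \<Rightarrow>\<^sub>L 'w::euclidean_space"
  assumes ell: "elliptic k B"
begin

abbreviation S :: "real ^ 'n \<Rightarrow> 'v \<Rightarrow> 'w" where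
  "S \<xi> \<equiv> blinfun_apply (symbol k B \<xi>)"

lemma linear_S: "linear (S \<xi>)"
  by (rule bounded_linear.linear[OF blinfun.bounded_linear_right])

lemma annulus_nonzero: "\<xi> \<in> annulus \<Longrightarrow> \<xi> \<noteq> 0"
  by (auto simp: annulus_def)

lemma S_eq_0: "\<xi> \<noteq> 0 \<Longrightarrow> S \<xi> v = 0 \<Longrightarrow> v = 0"
  using ell unfolding elliptic_def by blast

text \<open>Compactness of the annulus and of the unit sphere turns ellipticity into a uniform lower
  bound; this is the reason for working on an annulus of frequencies.\<close>

lemma coercive:
  obtains c where "c > 0" "\<And>\<xi> v. \<xi> \<in> annulus \<Longrightarrow> c * norm v \<le> norm (S \<xi> v)"
proof -
  define K where "K = (annulus :: (real ^ 'n) set) \<times> sphere (0::'v) 1"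
  have ann: "annulus = cball (0 :: real ^ 'n) 2 - ball 0 (1 / 2)"
    by (auto simp: annulus_def)
  have K: "compact K" unfolding K_def ann
    by (intro compact_Times compact_diff compact_cball open_ball compact_sphere)
  have ne: "K \<noteq> {}"
  proof -
    obtain i :: 'n where True by blast
    have "axis i (1::real) \<in> annulus" by (simp add: annulus_def norm_axis_1)
    moreover obtain b :: 'v where "b \<in> Basis" using nonempty_Basis by blast
    ultimately have "(axis i 1, b) \<in> K" by (simp add: K_def)
    then show ?thesis by blast
  qed
  have cont: "continuous_on K (\<lambda>p. norm (S (fst p) (snd p)))"
    unfolding symbol_def mi_power_def by (intro continuous_intros)
  from continuous_attains_inf[OF K ne cont]
  obtain p where p: "p \<in> K" "\<And>q. q \<in> K \<Longrightarrow> norm (S (fst p) (snd p)) \<le> norm (S (fst q) (snd q))"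
    by blast
  define c where "c = norm (S (fst p) (snd p))"
  have "snd p \<noteq> 0" "fst p \<noteq> 0" using p(1) annulus_nonzero[of 0] by (auto simp: K_def)
  then have "c > 0" using S_eq_0 by (auto simp: c_def)
  moreover have "c * norm v \<le> norm (S \<xi> v)" if \<xi>: "\<xi> \<in> annulus" for \<xi> v
  proof (cases "v = 0")
    case False
    have "(\<xi>, v /\<^sub>R norm v) \<in> K" using \<xi> False by (simp add: K_def)
    from p(2)[OF this] have "c \<le> norm (S \<xi> (v /\<^sub>R norm v))" by (simp add: c_def)
    then show ?thesis using False by (simp add: blinfun.scaleR_right field_simps)
  qed simp
  ultimately show ?thesis using that by blast
qed

text \<open>The inverse of S^T S, where S^T is the adjoint of \<open>S \<xi>\<close>. In this weak
  form its Lipschitz dependence on \<xi> follows from coercivity, without formulas for inverse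
  matrices.\<close>

definition sol :: "real ^ 'n \<Rightarrow> 'v \<Rightarrow> 'v" where
  "sol \<xi> y = (SOME x. \<forall>z. S \<xi> x \<bullet> S \<xi> z = y \<bullet> z)"

lemma sol:
  assumes \<xi>: "\<xi> \<noteq> 0"
  shows "S \<xi> (sol \<xi> y) \<bullet> S \<xi> z = y \<bullet> z"
proof -
  define A where "A = adjoint (S \<xi>) \<circ> S \<xi>"
  have A: "A x \<bullet> z = S \<xi> x \<bullet> S \<xi> z" for x z
    using adjoint_works[OF linear_S, of z \<xi> "S \<xi> x"] by (simp add: A_def inner_commute)
  have lin: "linear A" unfolding A_def by (intro linear_compose linear_S adjoint_linear)
  have "inj A"
    unfolding linear_injective_0[OF lin]
  proof (intro allI impI)
    fix x assume "A x = 0"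
    then have "S \<xi> x = 0" using A[of x x] by simp
    then show "x = 0" using S_eq_0[OF \<xi>] by blast
  qed
  then have "surj A" by (rule linear_injective_imp_surjective[OF lin]) simp
  then obtain x where "A x = y" by (metis surjD)
  then have "\<forall>z. S \<xi> x \<bullet> S \<xi> z = y \<bullet> z" using A by metis
  then have "\<forall>z. S \<xi> (sol \<xi> y) \<bullet> S \<xi> z = y \<bullet> z" unfolding sol_def by (rule someI)
  then show ?thesis by blast
qed

lemma sol_unique:
  assumes \<xi>: "\<xi> \<noteq> 0" and x: "\<And>z. S \<xi> x \<bullet> S \<xi> z = y \<bullet> z"
  shows "sol \<xi> y = x"
proof -
  have "S \<xi> (sol \<xi> y - x) \<bullet> S \<xi> z = 0" for z
    unfolding blinfun.diff_right[of _ "sol \<xi> y"] inner_diff_left sol[OF \<xi>] x by simp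
  from this[of "sol \<xi> y - x"] have "S \<xi> (sol \<xi> y - x) = 0" by simp
  then show ?thesis using S_eq_0[OF \<xi>] by fastforce
qed

lemma bdd_lipschitz_S: "bdd_lipschitz annulus (symbol k B)"
proof (rule bdd_lipschitz_symbol)
  have "annulus \<subseteq> cball (0 :: real ^ 'n) 2" by (auto simp: annulus_def)
  then show "bounded (annulus :: (real ^ 'n) set)" by (rule bounded_subset[OF bounded_cball])
qed

text \<open>The difference \<open>z\<close> of two solutions is tested with itself, as for a
  perturbed coercive form: the right-hand sides and the two forms differ by O(norm (\<xi> -
  \<eta>)), and coercivity absorbs one factor norm z.\<close>

lemma sol_lipschitz:
  fixes y :: "real ^ 'n \<Rightarrow> 'v"
  assumes y: "bdd_lipschitz annulus y"
  shows "bdd_lipschitz annulus (\<lambda>\<xi>. sol \<xi> (y \<xi>))"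
proof -
  obtain c where c: "c > 0" "\<And>\<xi> v. \<xi> \<in> annulus \<Longrightarrow> c * norm v \<le> norm (S \<xi> v)"
    by (rule coercive) blast
  obtain C where C: "C \<ge> 0" "\<And>\<xi>. \<xi> \<in> annulus \<Longrightarrow> norm (symbol k B \<xi>) \<le> C"
    "\<And>\<xi> \<eta>. \<xi> \<in> annulus \<Longrightarrow> \<eta> \<in> annulus \<Longrightarrow> norm (symbol k B \<xi> - symbol k B \<eta>) \<le> C * norm (\<xi> - \<eta>)"
    using bdd_lipschitzE[OF bdd_lipschitz_S] by metis
  obtain L where L: "L \<ge> 0" "\<And>\<xi>. \<xi> \<in> annulus \<Longrightarrow> norm (y \<xi>) \<le> L"
    "\<And>\<xi> \<eta>. \<xi> \<in> annulus \<Longrightarrow> \<eta> \<in> annulus \<Longrightarrow> norm (y \<xi> - y \<eta>) \<le> L * norm (\<xi> - \<eta>)"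
    using bdd_lipschitzE[OF y] by metis
  have lax_milgram: "norm z \<le> K / c\<^sup>2"
    if \<xi>: "\<xi> \<in> annulus" and K: "S \<xi> z \<bullet> S \<xi> z \<le> K * norm z" "K \<ge> 0" for \<xi> z K
  proof (cases "z = 0")
    case False
    have "(c * norm z)\<^sup>2 \<le> (norm (S \<xi> z))\<^sup>2"
      using c \<xi> by (intro power_mono) auto
    also have "\<dots> \<le> K * norm z" using K(1) by (simp add: power2_norm_eq_inner)
    finally have "c\<^sup>2 * norm z * norm z \<le> K * norm z" by (simp add: power_mult_distrib power2_eq_square mult_ac)
    then have "c\<^sup>2 * norm z \<le> K" using False by simp
    then show ?thesis using c by (simp add: field_simps)
  qed (use K in simp)
  define M where "M = L / c\<^sup>2"
  have bound: "norm (sol \<xi> (y \<xi>)) \<le> M" if \<xi>: "\<xi> \<in> annulus" for \<xi>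
    unfolding M_def
  proof (rule lax_milgram[OF \<xi> _ L(1)])
    have "S \<xi> (sol \<xi> (y \<xi>)) \<bullet> S \<xi> (sol \<xi> (y \<xi>)) = y \<xi> \<bullet> sol \<xi> (y \<xi>)"
      by (rule sol[OF annulus_nonzero[OF \<xi>]])
    also have "\<dots> \<le> norm (y \<xi>) * norm (sol \<xi> (y \<xi>))" by (rule norm_cauchy_schwarz)
    also have "\<dots> \<le> L * norm (sol \<xi> (y \<xi>))" by (intro mult_right_mono L \<xi>) auto
    finally show "S \<xi> (sol \<xi> (y \<xi>)) \<bullet> S \<xi> (sol \<xi> (y \<xi>)) \<le> L * norm (sol \<xi> (y \<xi>))" .
  qed
  have M: "M \<ge> 0" using L(1) by (simp add: M_def)
  show ?thesis
  proof (rule bdd_lipschitzI[where C=M and D="(L + 2 * C * C * M) / c\<^sup>2"])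
    fix \<xi> \<eta> :: "real ^ 'n" assume \<xi>: "\<xi> \<in> annulus" and \<eta>: "\<eta> \<in> annulus"
    define x where "x = sol \<xi> (y \<xi>)"
    define x' where "x' = sol \<eta> (y \<eta>)"
    define z where "z = x - x'"
    have Sz: "norm (S \<zeta> v) \<le> C * norm v" if "\<zeta> \<in> annulus" for \<zeta> v
      by (rule order_trans[OF norm_blinfun mult_right_mono[OF C(2)[OF that] norm_ge_zero]])
    have D: "norm (S \<xi> v - S \<eta> v) \<le> C * norm (\<xi> - \<eta>) * norm v" for v
      unfolding blinfun.diff_left[symmetric]
      by (rule order_trans[OF norm_blinfun mult_right_mono[OF C(3)[OF \<xi> \<eta>] norm_ge_zero]])
    have "S \<xi> z \<bullet> S \<xi> z = S \<xi> x \<bullet> S \<xi> z - S \<xi> x' \<bullet> S \<xi> z"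
      unfolding z_def blinfun.diff_right inner_diff_left ..
    also have "S \<xi> x \<bullet> S \<xi> z = y \<xi> \<bullet> z"
      unfolding x_def by (rule sol[OF annulus_nonzero[OF \<xi>]])
    also have "y \<xi> \<bullet> z - S \<xi> x' \<bullet> S \<xi> z = (y \<xi> - y \<eta>) \<bullet> z + (S \<eta> x' \<bullet> S \<eta> z - S \<xi> x' \<bullet> S \<xi> z)"
      using sol[OF annulus_nonzero[OF \<eta>], of "y \<eta>" z] by (simp add: x'_def inner_diff_left)
    also have "S \<eta> x' \<bullet> S \<eta> z - S \<xi> x' \<bullet> S \<xi> z = - ((S \<xi> x' - S \<eta> x') \<bullet> S \<eta> z + S \<xi> x' \<bullet> (S \<xi> z - S \<eta> z))"
      by (simp add: inner_diff_left inner_diff_right)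
    also have "(y \<xi> - y \<eta>) \<bullet> z + - ((S \<xi> x' - S \<eta> x') \<bullet> S \<eta> z + S \<xi> x' \<bullet> (S \<xi> z - S \<eta> z))
        \<le> norm (y \<xi> - y \<eta>) * norm z + (norm (S \<xi> x' - S \<eta> x') * norm (S \<eta> z) + norm (S \<xi> x') * norm (S \<xi> z - S \<eta> z))"
      using norm_cauchy_schwarz[of "y \<xi> - y \<eta>" z] Cauchy_Schwarz_ineq2[of "S \<xi> x' - S \<eta> x'" "S \<eta> z"]
        Cauchy_Schwarz_ineq2[of "S \<xi> x'" "S \<xi> z - S \<eta> z"] by linarith
    also have "\<dots> \<le> (L * norm (\<xi> - \<eta>)) * norm z + ((C * norm (\<xi> - \<eta>) * M) * (C * norm z) + (C * M) * (C * norm (\<xi> - \<eta>) * norm z))"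
    proof (intro add_mono mult_mono)
      have x'M: "norm x' \<le> M" unfolding x'_def by (rule bound[OF \<eta>])
      show "norm (y \<xi> - y \<eta>) \<le> L * norm (\<xi> - \<eta>)" by (rule L(3)[OF \<xi> \<eta>])
      show "norm (S \<xi> x' - S \<eta> x') \<le> C * norm (\<xi> - \<eta>) * M"
        using C(1) x'M by (intro order_trans[OF D] mult_left_mono) auto
      show "norm (S \<eta> z) \<le> C * norm z" by (rule Sz[OF \<eta>])
      show "norm (S \<xi> x') \<le> C * M"
        using C(1) x'M by (intro order_trans[OF Sz[OF \<xi>]] mult_left_mono) auto
      show "norm (S \<xi> z - S \<eta> z) \<le> C * norm (\<xi> - \<eta>) * norm z" by (rule D)
    qed (use C(1) L(1) M in auto)
    also have "\<dots> = ((L + 2 * C * C * M) * norm (\<xi> - \<eta>)) * norm z" by (simp add: algebra_simps)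
    finally have "S \<xi> z \<bullet> S \<xi> z \<le> ((L + 2 * C * C * M) * norm (\<xi> - \<eta>)) * norm z" .
    from lax_milgram[OF \<xi> this] show "norm (sol \<xi> (y \<xi>) - sol \<eta> (y \<eta>)) \<le> (L + 2 * C * C * M) / c\<^sup>2 * norm (\<xi> - \<eta>)"
      using C(1) L(1) M by (simp add: z_def x_def x'_def)
  qed (rule bound)
qed

section \<open>Projection onto the complement of the range\<close>

lemma adjoint_S_lipschitz: "bdd_lipschitz annulus (\<lambda>\<xi>. adjoint (S \<xi>) w)"
proof -
  have "adjoint (S \<xi>) w = (\<Sum>b\<in>Basis. (S \<xi> b \<bullet> w) *\<^sub>R b)" for \<xi>
  proof (rule euclidean_eqI)
    fix b :: 'v assume "b \<in> Basis"
    then show "adjoint (S \<xi>) w \<bullet> b = (\<Sum>b\<in>Basis. (S \<xi> b \<bullet> w) *\<^sub>R b) \<bullet> b"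
      using adjoint_works[OF linear_S, of b \<xi> w] by (simp add: inner_sum_left_Basis inner_commute[of b])
  qed
  moreover have "bdd_lipschitz annulus (\<lambda>\<xi>. \<Sum>b\<in>Basis. (S \<xi> b \<bullet> w) *\<^sub>R b)"
    by (intro bdd_lipschitz_sum bdd_lipschitz_scaleR bdd_lipschitz_inner bdd_lipschitz_blinfun
        bdd_lipschitz_const bdd_lipschitz_S)
  ultimately show ?thesis by simp
qed

text \<open>S (S^T S)^{-1} S^T is the orthogonal projection onto the range of
  \<open>S \<xi>\<close>, so this is the projection onto the orthogonal complement. The formula
  exhibits its Lipschitz dependence on \<xi>.\<close>

definition proj :: "real ^ 'n \<Rightarrow> 'w \<Rightarrow> 'w" where
  "proj \<xi> w = w - S \<xi> (sol \<xi> (adjoint (S \<xi>) w))"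

lemma proj_orth: "\<xi> \<noteq> 0 \<Longrightarrow> proj \<xi> w \<bullet> S \<xi> z = 0"
  using sol[of \<xi> "adjoint (S \<xi>) w" z] adjoint_works[OF linear_S, of z \<xi> w]
  by (simp add: proj_def inner_diff_left inner_diff_right inner_commute)

lemma proj_inner: "\<xi> \<noteq> 0 \<Longrightarrow> w \<bullet> proj \<xi> w = proj \<xi> w \<bullet> proj \<xi> w"
  using proj_orth[of \<xi> w "sol \<xi> (adjoint (S \<xi>) w)"]
  by (simp add: proj_def inner_diff_left inner_diff_right inner_commute)

lemma proj_lipschitz: "bdd_lipschitz annulus (\<lambda>\<xi>. proj \<xi> w)"
proof -
  have "bdd_lipschitz annulus (\<lambda>\<xi>. w + (- 1) *\<^sub>R S \<xi> (sol \<xi> (adjoint (S \<xi>) w)))"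
    by (intro bdd_lipschitz_add bdd_lipschitz_scaleR bdd_lipschitz_blinfun bdd_lipschitz_const
        bdd_lipschitz_S sol_lipschitz adjoint_S_lipschitz)
  then show ?thesis by (simp add: proj_def)
qed

lemma proj_linear: "\<xi> \<noteq> 0 \<Longrightarrow> linear (proj \<xi>)"
proof -
  assume \<xi>: "\<xi> \<noteq> 0"
  have "sol \<xi> (y + y') = sol \<xi> y + sol \<xi> y'" for y y'
    by (rule sol_unique[OF \<xi>]) (simp add: blinfun.add_right inner_add_left sol[OF \<xi>])
  moreover have "sol \<xi> (r *\<^sub>R y) = r *\<^sub>R sol \<xi> y" for r y
    by (rule sol_unique[OF \<xi>]) (simp add: blinfun.scaleR_right sol[OF \<xi>])
  ultimately show ?thesis
    by (intro linearI) (simp_all add: proj_def linear_add[OF adjoint_linear[OF linear_S]]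
        linear_scale[OF adjoint_linear[OF linear_S]] blinfun.add_right blinfun.scaleR_right scaleR_diff_right)
qed

definition proj_mult :: "'w \<Rightarrow> real ^ 'n \<Rightarrow> 'w" where
  "proj_mult w \<xi> = ring_cutoff \<xi> *\<^sub>R proj \<xi> w"

lemma multiplier_proj_mult: "multiplier (proj_mult w)"
  unfolding proj_mult_def[abs_def] by (rule multiplier_ring_cutoff[OF proj_lipschitz])

lemma proj_mult_orth: "proj_mult w \<xi> \<bullet> S \<xi> z = 0"
proof (cases "\<xi> \<in> annulus")
  case True
  then show ?thesis using proj_orth[OF annulus_nonzero] by (simp add: proj_mult_def)
qed (simp add: proj_mult_def ring_cutoff_props)

text \<open>At phase 0 and z = 0 the cosine is 1, so the kernel is a weighted mean of projections,
  linear in \<open>w\<close>, whose quadratic form is the mean of norm (proj \<xi> w)^2. If the mean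
  kills \<open>w\<close>, then \<open>w\<close> lies in the range of \<open>S \<xi>\<close> for
  every unit \<xi>; by canceling the map is injective, hence surjective.\<close>

lemma osc_proj_mult_surj:
  assumes "canceling k B"
  obtains w where "osc (proj_mult w) 0 0 = t"
proof -
  define J where "J w = osc (proj_mult w) 0 0" for w
  have int: "integrable lborel (proj_mult w)" for w
    using osc_integrable[OF multiplier_proj_mult[of w], of 0 0] by simp
  have J: "J w = (LINT \<xi>|lborel. proj_mult w \<xi>)" for w
    by (simp add: J_def osc_def)
  have add: "proj_mult (w + w') \<xi> = proj_mult w \<xi> + proj_mult w' \<xi>"
    and scale: "proj_mult (r *\<^sub>R w) \<xi> = r *\<^sub>R proj_mult w \<xi>" for w w' \<xi> r
    by (cases "\<xi> \<in> annulus";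
        simp add: proj_mult_def ring_cutoff_props linear_add[OF proj_linear[OF annulus_nonzero]]
          linear_scale[OF proj_linear[OF annulus_nonzero]] scaleR_add_right)+
  have lin: "linear J"
    by (rule linearI) (simp_all add: J add scale int)
  have "inj J"
    unfolding linear_injective_0[OF lin]
  proof (intro allI impI)
    fix w assume Jw: "J w = 0"
    have sq: "w \<bullet> proj_mult w \<xi> = ring_cutoff \<xi> * (norm (proj \<xi> w))\<^sup>2" for \<xi>
      by (cases "\<xi> \<in> annulus")
         (simp_all add: proj_mult_def ring_cutoff_props proj_inner[OF annulus_nonzero] power2_norm_eq_inner)
    have nonneg: "0 \<le> w \<bullet> proj_mult w \<xi>" for \<xi> unfolding sq by (simp add: ring_cutoff_props)
    have "(LINT \<xi>|lborel. w \<bullet> proj_mult w \<xi>) = w \<bullet> J w" unfolding J using int by simp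
    then have "(LINT \<xi>|lborel. w \<bullet> proj_mult w \<xi>) = 0" using Jw by simp
    then have "AE \<xi> in lborel. w \<bullet> proj_mult w \<xi> = 0"
      using integral_nonneg_eq_0_iff_AE[of lborel "\<lambda>\<xi>. w \<bullet> proj_mult w \<xi>"] int nonneg by simp
    then have ae: "AE \<xi> in lebesgue. \<xi> \<in> {\<xi>. w \<bullet> proj_mult w \<xi> = 0}"
      using AE_completion by auto
    \<comment> \<open>The unit sphere is a null set, so the almost everywhere statement must be
      extended by continuity before it can be evaluated there.\<close>
    have cont: "continuous_on UNIV (\<lambda>\<xi>. w \<bullet> proj_mult w \<xi>)"
      by (intro continuous_intros multiplier_continuous multiplier_proj_mult)
    have "closed {\<xi>. w \<bullet> proj_mult w \<xi> = 0}"
      using cont by (intro closed_Collect_eq) auto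
    then have zero: "w \<bullet> proj_mult w \<xi> = 0" for \<xi>
      using mem_closed_if_AE_lebesgue[OF _ ae] by blast
    have "w \<in> range (S \<xi>)" if "\<xi> \<in> sphere 0 1" for \<xi>
    proof -
      have "norm (proj \<xi> w) = 0" using zero[of \<xi>] that unfolding sq by (simp add: ring_cutoff_props)
      then have "w = S \<xi> (sol \<xi> (adjoint (S \<xi>) w))" by (simp add: proj_def)
      then show ?thesis by blast
    qed
    then have "w \<in> (\<Inter>\<xi>\<in>sphere 0 1. range (S \<xi>))" by blast
    then show "w = 0" using assms unfolding canceling_def by blast
  qed
  then have "surj J" by (rule linear_injective_imp_surjective[OF lin]) simp
  then obtain w where "J w = t" by (metis surjD)
  then show ?thesis using that[of w] by (simp add: J_def)
qed

text \<open>Up to the cutoff this is S (S^T S)^{-1} v, whose inner product with S \<xi> z is v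
  \<bullet> z. Pairing with it therefore recovers the component of u along v from the transform of
  the equation.\<close>

definition inv_mult :: "'v \<Rightarrow> real ^ 'n \<Rightarrow> 'w" where
  "inv_mult v \<xi> = ring_cutoff \<xi> *\<^sub>R S \<xi> (sol \<xi> v)"

lemma multiplier_inv_mult: "multiplier (inv_mult v)"
  unfolding inv_mult_def[abs_def]
  by (intro multiplier_ring_cutoff bdd_lipschitz_blinfun bdd_lipschitz_S sol_lipschitz bdd_lipschitz_const)

lemma inv_mult_inner: "inv_mult v \<xi> \<bullet> S \<xi> z = ring_cutoff \<xi> * (v \<bullet> z)"
  by (cases "\<xi> \<in> annulus") (simp_all add: inv_mult_def sol[OF annulus_nonzero] ring_cutoff_props)

text \<open>Canceling allows correcting the multiplier by one that annihilates the range of the symbol,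
  so that the kernel vanishes at the origin; this makes the sum over all dyadic scales converge.\<close>

lemma canceling_kernel:
  assumes "canceling k B"
  obtains w C where "C \<ge> 0"
    "\<And>z. norm (osc (inv_mult v) s z - osc (proj_mult w) 0 z) \<le> C * min (norm z) (1 / norm z)"
    "\<And>z. norm (osc (inv_mult v) s z - osc (proj_mult w) 0 z) \<le> C"
proof -
  obtain w where w: "osc (proj_mult w) 0 0 = osc (inv_mult v) s 0"
    by (rule osc_proj_mult_surj[OF assms])
  obtain C where C: "C \<ge> 0" "\<And>t z. norm (osc (inv_mult v) t z) \<le> C" "\<And>t z. norm (osc (inv_mult v) t z) * norm z \<le> C"
    "\<And>t z z'. norm (osc (inv_mult v) t z - osc (inv_mult v) t z') \<le> C * norm (z - z')"
    by (rule osc_bounds[OF multiplier_inv_mult]) blast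
  obtain D where D: "D \<ge> 0" "\<And>t z. norm (osc (proj_mult w) t z) \<le> D" "\<And>t z. norm (osc (proj_mult w) t z) * norm z \<le> D"
    "\<And>t z z'. norm (osc (proj_mult w) t z - osc (proj_mult w) t z') \<le> D * norm (z - z')"
    by (rule osc_bounds[OF multiplier_proj_mult]) blast
  define \<kappa> where "\<kappa> z = osc (inv_mult v) s z - osc (proj_mult w) 0 z" for z
  have tri: "norm (\<kappa> z) \<le> norm (osc (inv_mult v) s z) + norm (osc (proj_mult w) 0 z)" for z
    unfolding \<kappa>_def by (rule norm_triangle_ineq4)
  have 1: "norm (\<kappa> z) \<le> C + D" for z
    using tri[of z] C(2)[of s z] D(2)[of 0 z] by linarith
  have 2: "norm (\<kappa> z) \<le> (C + D) * norm z" for z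
  proof -
    \<comment> \<open>The two kernels agree at 0 by the choice of \<open>w\<close>, so their values
      there can be inserted and both differences estimated by the Lipschitz bounds.\<close>
    have "\<kappa> z = (osc (inv_mult v) s z - osc (inv_mult v) s 0) - (osc (proj_mult w) 0 z - osc (proj_mult w) 0 0)"
      by (simp add: \<kappa>_def w)
    then have "norm (\<kappa> z) \<le> norm (osc (inv_mult v) s z - osc (inv_mult v) s 0) + norm (osc (proj_mult w) 0 z - osc (proj_mult w) 0 0)"
      by (metis norm_triangle_ineq4)
    then show ?thesis using C(4)[of s z 0] D(4)[of 0 z 0] by (simp add: distrib_right)
  qed
  have 3: "norm (\<kappa> z) * norm z \<le> C + D" for z
  proof -
    have "norm (\<kappa> z) * norm z \<le> (norm (osc (inv_mult v) s z) + norm (osc (proj_mult w) 0 z)) * norm z"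
      by (intro mult_right_mono tri) auto
    then show ?thesis using C(3)[of s z] D(3)[of 0 z] by (simp add: distrib_right)
  qed
  have "norm (\<kappa> z) \<le> (C + D) * min (norm z) (1 / norm z)" for z
  proof (cases "z = 0")
    \<comment> \<open>At z = 0 the value 1 / norm z is 0, so the bound asserts that the kernel
      vanishes.\<close>
    case True
    then show ?thesis using 2[of 0] by simp
  next
    case False
    then have "norm (\<kappa> z) \<le> (C + D) * (1 / norm z)" using 3[of z] by (simp add: field_simps)
    then show ?thesis using 2[of z] by (simp add: min_def)
  qed
  then show ?thesis using that[of "C + D" w] 1 C(1) D(1) unfolding \<kappa>_def by auto
qed

end

section \<open>The Fourier transform of the equation\<close>

lemma integrable_bounded_mult:
  fixes u :: "'a::euclidean_space \<Rightarrow> 'v::euclidean_space"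
  assumes u: "integrable lborel u" and [measurable]: "f \<in> borel_measurable borel"
    and f: "\<And>x. \<bar>f x\<bar> \<le> C"
  shows "integrable lborel (\<lambda>x. f x *\<^sub>R u x)"
proof (rule Bochner_Integration.integrable_bound[OF integrable_scaleR_right[OF u, of C]])
  show "(\<lambda>x. f x *\<^sub>R u x) \<in> borel_measurable lborel" using u by measurable
  show "AE x in lborel. norm (f x *\<^sub>R u x) \<le> norm (C *\<^sub>R u x)"
    using f by (auto intro!: AE_I2 mult_right_mono order_trans[OF f abs_ge_self])
qed

lemma cos_integral_dct:
  fixes u :: "'a::euclidean_space \<Rightarrow> 'v::euclidean_space"
  assumes u: "integrable lborel u"
    and m: "\<And>j. f j \<in> borel_measurable borel" "g \<in> borel_measurable borel"
    and b: "\<And>j x. \<bar>f j x\<bar> \<le> C" and l: "\<And>x. (\<lambda>j. f j x) \<longlonglongrightarrow> g x"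
  shows "(\<lambda>j. LINT x|lborel. f j x *\<^sub>R u x) \<longlonglongrightarrow> (LINT x|lborel. g x *\<^sub>R u x)"
proof (rule integral_dominated_convergence[where w="\<lambda>x. C * norm (u x)"])
  show "integrable lborel (\<lambda>x. C * norm (u x))" using u by (intro integrable_mult_right integrable_norm)
  show "AE x in lborel. (\<lambda>j. f j x *\<^sub>R u x) \<longlonglongrightarrow> g x *\<^sub>R u x"
    by (intro AE_I2 tendsto_scaleR l tendsto_const)
  show "AE x in lborel. norm (f j x *\<^sub>R u x) \<le> C * norm (u x)" for j
    using b by (auto intro!: AE_I2 mult_right_mono)
  show "(\<lambda>x. g x *\<^sub>R u x) \<in> borel_measurable lborel" "(\<lambda>x. f j x *\<^sub>R u x) \<in> borel_measurable lborel" for j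
    using u m by (auto intro!: borel_measurable_scaleR)
qed

lemma symbol_apply: "blinfun_apply (symbol k B \<xi>) v = (\<Sum>\<beta> | mi_order \<beta> = k. mi_power \<xi> \<beta> *\<^sub>R blinfun_apply (B \<beta>) v)"
  unfolding symbol_def by (simp add: blinfun.sum_left blinfun.scaleR_left)

text \<open>The exponential is approximated by the test functions \<open>cos (\<xi> \<bullet> x + t) * \<eta> (x / R)\<close>, where
  \<open>\<eta> 0 \<noteq> 0\<close> need not be 1.\<close>

lemma fourier_relation:
  fixes B :: "('n::finite \<Rightarrow> nat) \<Rightarrow> 'v::euclidean_space \<Rightarrow>\<^sub>L 'w::euclidean_space"
  assumes u: "integrable lborel u" and \<mu>: "is_op_measure k B u \<mu>"
  shows "vector_integral \<mu> (\<lambda>x. cos (\<xi> \<bullet> x + t)) =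
    (-1) ^ k *\<^sub>R blinfun_apply (symbol k B \<xi>) (LINT x|lborel. cos (\<xi> \<bullet> x + (t + real k * pi / 2)) *\<^sub>R u x)"
proof -
  interpret vector_measure \<mu> using \<mu> by (simp add: vector_measure_def is_op_measure_def)
  define \<eta> :: "real ^ 'n \<Rightarrow> real" where "\<eta> = ball_bump 0 1"
  have \<eta>0: "\<eta> x = 0" if "norm x > 1" for x
    using ball_bump_props(2)[of 1 x 0] that by (simp add: \<eta>_def)
  have \<eta>1: "0 \<le> \<eta> x" "\<eta> x \<le> 1" for x
    using ball_bump_props(3)[of 1 0 x] ball_bump_props(4)[of 1 0 x] by (auto simp: \<eta>_def less_imp_le)
  have \<eta>pos: "\<eta> 0 > 0" using ball_bump_props(1)[of 1 0 0] by (simp add: \<eta>_def)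
  have sm\<eta>: "smooth_expr \<eta>" by (simp add: \<eta>_def smooth_expr_ball_bump)
  define g where "g j x = \<eta> (inverse (real (Suc j)) *\<^sub>R x)" for j :: nat and x
  have smsc: "smooth_expr (\<lambda>x. \<eta> (r *\<^sub>R x))" for r
  proof -
    have "(\<lambda>x. \<eta> (r *\<^sub>R x)) = bump 0 (r\<^sup>2) 0"
      by (simp add: \<eta>_def ball_bump_def bump_def[abs_def] power2_eq_square mult.assoc)
    then show ?thesis using smooth_expr.bump[of 0 "r\<^sup>2" 0] by metis
  qed
  have smg: "smooth_expr (g j)" for j unfolding g_def by (rule smsc)
  let ?c = "\<lambda>x. cos (\<xi> \<bullet> x + t)"
  have smc: "smooth_expr ?c" by (rule smooth_expr.cos)
  define f where "f j x = ?c x * g j x" for j x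
  have smf: "smooth_expr (f j)" for j unfolding f_def by (intro smooth_expr.mult smc smg)
  have test: "f j \<in> test_functions" for j
  proof (rule test_functionI[OF smf])
    fix x :: "real ^ 'n" assume "real (Suc j) < norm x"
    then have "norm (inverse (real (Suc j)) *\<^sub>R x) > 1" by (simp add: field_simps)
    then show "f j x = 0" using \<eta>0 by (simp add: f_def g_def)
  qed
  have meas: "h \<in> borel_measurable borel" if "smooth_expr h" for h :: "real ^ 'n \<Rightarrow> real"
    by (rule borel_measurable_continuous_onI[OF smooth_expr_continuous[OF that]])
  have glim: "(\<lambda>j. g j x) \<longlonglongrightarrow> \<eta> 0" for x
  proof -
    have "(\<lambda>j. inverse (real (Suc j)) *\<^sub>R x) \<longlonglongrightarrow> 0 *\<^sub>R x"
      by (intro tendsto_scaleR LIMSEQ_inverse_real_of_nat tendsto_const)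
    then have "(\<lambda>j. inverse (real (Suc j)) *\<^sub>R x) \<longlonglongrightarrow> 0" by simp
    moreover have "isCont \<eta> 0"
      using smooth_expr_continuous[OF sm\<eta>] by (simp add: continuous_on_eq_continuous_at)
    ultimately show ?thesis unfolding g_def by (rule isCont_tendsto_compose[rotated])
  qed
  have "(\<lambda>j. vector_integral \<mu> (f j)) \<longlonglongrightarrow> vector_integral \<mu> (\<lambda>x. ?c x * \<eta> 0)"
  proof (rule vector_integral_dct[where C=1])
    show "\<bar>f j x\<bar> \<le> 1" for j x
      unfolding f_def g_def abs_mult using \<eta>1 by (intro mult_le_one) (auto simp: abs_le_iff)
    show "(\<lambda>j. f j x) \<longlonglongrightarrow> ?c x * \<eta> 0" for x
      unfolding f_def by (intro tendsto_mult tendsto_const glim)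
  qed (rule meas[OF smf])
  moreover have "vector_integral \<mu> (\<lambda>x. ?c x * \<eta> 0) = \<eta> 0 *\<^sub>R vector_integral \<mu> ?c"
    using vector_integral_sum[of "{()}" "\<lambda>_. ?c" 1 "\<lambda>_. \<eta> 0"] meas[OF smc] by (simp add: mult.commute)
  ultimately have lim1: "(\<lambda>j. vector_integral \<mu> (f j)) \<longlonglongrightarrow> \<eta> 0 *\<^sub>R vector_integral \<mu> ?c" by simp

  have "\<exists>D\<ge>0. \<forall>js x. length js \<le> k \<longrightarrow> \<bar>foldr pd js \<eta> x\<bar> \<le> D"
    by (rule foldr_pd_bounded[OF sm\<eta>]) (rule \<eta>0)
  then obtain D where D: "D \<ge> 0" "\<And>js x. length js \<le> k \<Longrightarrow> \<bar>foldr pd js \<eta> x\<bar> \<le> D"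
    by auto
  \<comment> \<open>Each derivative of the cosine contributes one component of \<xi>; the added 1
    lets the exponent k dominate all shorter words.\<close>
  define C where "C = (1 + norm \<xi>) ^ k"
  have C: "\<bar>foldr pd js ?c x\<bar> \<le> C" if "length js \<le> k" for js x
  proof -
    have p: "\<bar>\<Prod>i\<leftarrow>js. \<xi> $ i\<bar> \<le> (1 + norm \<xi>) ^ length js"
    proof (induction js)
      case (Cons i js)
      have "\<bar>\<xi> $ i\<bar> \<le> 1 + norm \<xi>" using component_le_norm_cart[of \<xi> i] by simp
      then show ?case using Cons by (simp add: abs_mult mult_mono)
    qed simp
    have "\<bar>foldr pd js ?c x\<bar> \<le> \<bar>\<Prod>i\<leftarrow>js. \<xi> $ i\<bar> * 1"
      unfolding foldr_pd_cos abs_mult by (intro mult_left_mono) auto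
    also have "\<dots> \<le> (1 + norm \<xi>) ^ length js" using p by simp
    also have "\<dots> \<le> C" unfolding C_def using that by (intro power_increasing) auto
    finally show ?thesis .
  qed
  have C0: "C \<ge> 0" by (simp add: C_def)
  have almost: "\<bar>mi_deriv \<beta> (f j) x - mi_deriv \<beta> ?c x * g j x\<bar> \<le> 2 ^ k * C * (D / real (Suc j))"
    if \<beta>: "mi_order \<beta> = k" for \<beta> j x
    unfolding mi_deriv_word f_def \<beta>[symmetric] length_mi_word[symmetric]
  proof (rule foldr_pd_mult_almost[OF smc smg])
    fix js :: "'n list" and x
    assume js: "js \<noteq> []" "length js \<le> length (mi_word \<beta>)"
    have "foldr pd js (g j) = (\<lambda>x. inverse (real (Suc j)) ^ length js * foldr pd js \<eta> (inverse (real (Suc j)) *\<^sub>R x))"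
      unfolding g_def by (rule foldr_pd_scale[OF sm\<eta>]) (rule smsc)
    then have "\<bar>foldr pd js (g j) x\<bar> = inverse (real (Suc j)) ^ length js * \<bar>foldr pd js \<eta> (inverse (real (Suc j)) *\<^sub>R x)\<bar>"
      by (simp add: abs_mult power_abs)
    \<comment> \<open>At least one derivative falls on the dilated bump, so at least one factor 1 /
      (j + 1) survives.\<close>
    also have "\<dots> \<le> inverse (real (Suc j)) ^ 1 * D"
    proof (intro mult_mono power_decreasing)
      show "1 \<le> length js" using js(1) by (cases js) auto
      show "inverse (real (Suc j)) \<le> 1" by (simp add: inverse_le_1_iff)
      show "\<bar>foldr pd js \<eta> (inverse (real (Suc j)) *\<^sub>R x)\<bar> \<le> D"
        using D(2) js(2) \<beta> by (simp add: length_mi_word)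
    qed auto
    finally show "\<bar>foldr pd js (g j) x\<bar> \<le> D / real (Suc j)" by (simp add: divide_inverse mult.commute)
  qed (use C C0 D(1) \<beta> in \<open>auto simp: length_mi_word\<close>)
  have dlim: "(\<lambda>j. LINT x|lebesgue. mi_deriv \<beta> (f j) x *\<^sub>R u x) \<longlonglongrightarrow>
      (LINT x|lborel. (mi_deriv \<beta> ?c x * \<eta> 0) *\<^sub>R u x)" if \<beta>: "mi_order \<beta> = k" for \<beta>
  proof -
    have smd: "smooth_expr (mi_deriv \<beta> h)" if "smooth_expr h" for h
      using that by (simp add: mi_deriv_word smooth_expr_foldr)
    have small: "(\<lambda>j. 2 ^ k * C * (D / real (Suc j))) \<longlonglongrightarrow> 0"
    proof -
      have "(\<lambda>j. (2 ^ k * C * D) * inverse (real (Suc j))) \<longlonglongrightarrow> (2 ^ k * C * D) * 0"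
        by (intro tendsto_mult tendsto_const LIMSEQ_inverse_real_of_nat)
      then show ?thesis by (simp add: divide_inverse mult.assoc)
    qed
    have "(\<lambda>j. LINT x|lborel. mi_deriv \<beta> (f j) x *\<^sub>R u x) \<longlonglongrightarrow>
      (LINT x|lborel. (mi_deriv \<beta> ?c x * \<eta> 0) *\<^sub>R u x)"
    proof (rule cos_integral_dct[OF u, where C="2 ^ k * C * D + C"])
      show "mi_deriv \<beta> (f j) \<in> borel_measurable borel" for j by (intro meas smd smf)
      show "(\<lambda>x. mi_deriv \<beta> ?c x * \<eta> 0) \<in> borel_measurable borel"
        using meas[OF smd[OF smc]] by measurable
      show "\<bar>mi_deriv \<beta> (f j) x\<bar> \<le> 2 ^ k * C * D + C" for j x
      proof -
        have "\<bar>mi_deriv \<beta> ?c x * g j x\<bar> \<le> C * 1"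
          unfolding abs_mult using C[of "mi_word \<beta>" x] \<beta> \<eta>1 C0
          by (intro mult_mono) (auto simp: mi_deriv_word length_mi_word g_def abs_le_iff)
        moreover have "2 ^ k * C * (D / real (Suc j)) \<le> 2 ^ k * C * D"
          using divide_left_mono[of 1 "real (Suc j)" D] D(1) C0 by (intro mult_left_mono) auto
        ultimately show ?thesis using almost[OF \<beta>, of j x] by linarith
      qed
      show "(\<lambda>j. mi_deriv \<beta> (f j) x) \<longlonglongrightarrow> mi_deriv \<beta> ?c x * \<eta> 0" for x
      proof -
        have "(\<lambda>j. mi_deriv \<beta> (f j) x - mi_deriv \<beta> ?c x * g j x) \<longlonglongrightarrow> 0"
          by (rule Lim_null_comparison[OF _ small]) (use almost[OF \<beta>] in auto)
        moreover have "(\<lambda>j. mi_deriv \<beta> ?c x * g j x) \<longlonglongrightarrow> mi_deriv \<beta> ?c x * \<eta> 0"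
          by (intro tendsto_mult tendsto_const glim)
        ultimately have "(\<lambda>j. (mi_deriv \<beta> (f j) x - mi_deriv \<beta> ?c x * g j x) + mi_deriv \<beta> ?c x * g j x)
            \<longlonglongrightarrow> 0 + mi_deriv \<beta> ?c x * \<eta> 0" by (rule tendsto_add)
        then show ?thesis by simp
      qed
    qed
    moreover have "(LINT x|lebesgue. mi_deriv \<beta> (f j) x *\<^sub>R u x) = (LINT x|lborel. mi_deriv \<beta> (f j) x *\<^sub>R u x)" for j
      by (rule integral_completion) (use meas[OF smd[OF smf]] u in \<open>auto intro!: borel_measurable_scaleR\<close>)
    ultimately show ?thesis by simp
  qed
  have "(\<lambda>j. op_dist k B u (f j)) \<longlonglongrightarrow>
      (\<Sum>\<beta> | mi_order \<beta> = k. (-1) ^ k *\<^sub>R blinfun_apply (B \<beta>) (LINT x|lborel. (mi_deriv \<beta> ?c x * \<eta> 0) *\<^sub>R u x))"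
    unfolding op_dist_def
    by (intro tendsto_sum tendsto_scaleR tendsto_const blinfun.tendsto dlim) auto
  moreover have "op_dist k B u (f j) = vector_integral \<mu> (f j)" for j
    using \<mu> test unfolding is_op_measure_def by blast
  ultimately have lim2: "(\<lambda>j. vector_integral \<mu> (f j)) \<longlonglongrightarrow>
      (\<Sum>\<beta> | mi_order \<beta> = k. (-1) ^ k *\<^sub>R blinfun_apply (B \<beta>) (LINT x|lborel. (mi_deriv \<beta> ?c x * \<eta> 0) *\<^sub>R u x))"
    by simp
  have "\<eta> 0 *\<^sub>R vector_integral \<mu> ?c =
      (\<Sum>\<beta> | mi_order \<beta> = k. (-1) ^ k *\<^sub>R blinfun_apply (B \<beta>) (LINT x|lborel. (mi_deriv \<beta> ?c x * \<eta> 0) *\<^sub>R u x))"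
    by (rule LIMSEQ_unique[OF lim1 lim2])
  also have "\<dots> = (\<Sum>\<beta> | mi_order \<beta> = k. \<eta> 0 *\<^sub>R (-1) ^ k *\<^sub>R mi_power \<xi> \<beta> *\<^sub>R
      blinfun_apply (B \<beta>) (LINT x|lborel. cos (\<xi> \<bullet> x + (t + real k * pi / 2)) *\<^sub>R u x))"
  proof (rule sum.cong[OF refl])
    fix \<beta> :: "'n \<Rightarrow> nat" assume "\<beta> \<in> {\<beta>. mi_order \<beta> = k}"
    then have eq: "(mi_deriv \<beta> ?c x * \<eta> 0) *\<^sub>R u x = (mi_power \<xi> \<beta> * \<eta> 0) *\<^sub>R (cos (\<xi> \<bullet> x + (t + real k * pi / 2)) *\<^sub>R u x)" for x
      by (simp add: mi_deriv_cos mult_ac)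
    show "(-1) ^ k *\<^sub>R blinfun_apply (B \<beta>) (LINT x|lborel. (mi_deriv \<beta> ?c x * \<eta> 0) *\<^sub>R u x) =
      \<eta> 0 *\<^sub>R (-1) ^ k *\<^sub>R mi_power \<xi> \<beta> *\<^sub>R
      blinfun_apply (B \<beta>) (LINT x|lborel. cos (\<xi> \<bullet> x + (t + real k * pi / 2)) *\<^sub>R u x)"
      unfolding eq integral_scaleR_right blinfun.scaleR_right by (simp add: mult_ac)
  qed
  also have "\<dots> = \<eta> 0 *\<^sub>R (-1) ^ k *\<^sub>R
      blinfun_apply (symbol k B \<xi>) (LINT x|lborel. cos (\<xi> \<bullet> x + (t + real k * pi / 2)) *\<^sub>R u x)"
    unfolding symbol_apply scaleR_sum_right ..
  finally show ?thesis by (rule scaleR_left_imp_eq[rotated]) (use \<eta>pos in simp)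
qed

section \<open>Dyadic low-pass approximations\<close>

lemma lborel_integral_scale:
  fixes F :: "'a::euclidean_space \<Rightarrow> 'b::{banach, second_countable_topology}"
  assumes F: "F \<in> borel_measurable borel" and c: "c \<noteq> 0"
  shows "integral\<^sup>L lborel F = \<bar>c\<bar> ^ DIM('a) *\<^sub>R (LINT x|lborel. F (c *\<^sub>R x))"
proof -
  have "integral\<^sup>L lborel F = integral\<^sup>L (density (distr lborel borel (\<lambda>x. 0 + c *\<^sub>R x)) (\<lambda>_. ennreal (\<bar>c\<bar> ^ DIM('a)))) F"
  proof -
    have eq: "(lborel :: 'a measure) = density (distr lborel borel (\<lambda>x. 0 + c *\<^sub>R x)) (\<lambda>_. ennreal (\<bar>c\<bar> ^ DIM('a)))"
      by (rule lborel_affine[OF c])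
    show ?thesis by (subst eq) (rule refl)
  qed
  also have "\<dots> = (LINT x|distr lborel borel (\<lambda>x. 0 + c *\<^sub>R x). \<bar>c\<bar> ^ DIM('a) *\<^sub>R F x)"
    by (rule integral_density) (use F in auto)
  also have "\<dots> = \<bar>c\<bar> ^ DIM('a) *\<^sub>R (LINT x|distr lborel borel (\<lambda>x. 0 + c *\<^sub>R x). F x)"
    by simp
  also have "(LINT x|distr lborel borel (\<lambda>x. 0 + c *\<^sub>R x). F x) = (LINT x|lborel. F (0 + c *\<^sub>R x))"
    by (rule integral_distr) (use F in auto)
  finally show ?thesis by simp
qed

text \<open>Doubling \<open>x\<close> shifts the sum by one scale. For the induction the bound is
  refined to 2/x when x >= 1, a geometric tail, and to 4 - 2x when 0 < x < 1. Uniformity in the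
  number of scales and in \<open>x\<close> is what the sum of kernels requires.\<close>

lemma dyadic_sum_le_4:
  assumes "x \<ge> 0"
  shows "(\<Sum>j<m. min (2 ^ j * x) (1 / (2 ^ j * x))) \<le> (4::real)"
proof -
  let ?T = "\<lambda>m x::real. \<Sum>j<m. min (2 ^ j * x) (1 / (2 ^ j * x))"
  have "(x \<ge> 1 \<longrightarrow> ?T m x \<le> 2 / x) \<and> (0 < x \<and> x < 1 \<longrightarrow> ?T m x \<le> 4 - 2 * x)" for x :: real
  proof (induction m arbitrary: x)
    case (Suc m)
    have step: "?T (Suc m) x = min x (1 / x) + ?T m (2 * x)"
      by (subst sum.lessThan_Suc_shift) (simp add: mult_ac)
    show ?case
    proof (intro conjI impI)
      assume x: "x \<ge> 1"
      then have "min x (1 / x) \<le> 1 / x" "?T m (2 * x) \<le> 2 / (2 * x)" using Suc[of "2 * x"] by auto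
      moreover have "2 / x = 1 / x + 2 / (2 * x)" by simp
      ultimately show "?T (Suc m) x \<le> 2 / x" unfolding step by linarith
    next
      assume x: "0 < x \<and> x < 1"
      show "?T (Suc m) x \<le> 4 - 2 * x"
      proof (cases "2 * x < 1")
        case True
        then have "?T m (2 * x) \<le> 4 - 2 * (2 * x)" using Suc[of "2 * x"] x by auto
        then show ?thesis unfolding step using x min.cobounded1[of x "1 / x"] by linarith
      next
        case False
        then have "?T m (2 * x) \<le> 2 / (2 * x)" using Suc[of "2 * x"] by auto
        moreover have "3 * x + 1 / x \<le> 4"
        proof -
          \<comment> \<open>The claim is 3x^2 - 4x + 1 <= 0, with roots 1/3 and 1; in this case 1/2
            <= x < 1.\<close>
          have "(3 * x - 1) * (x - 1) \<le> 0" using False x by (intro mult_nonneg_nonpos) auto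
          then have "3 * x * x + 1 \<le> 4 * x" by (simp add: algebra_simps)
          then show ?thesis using x by (simp add: field_simps)
        qed
        moreover have "2 / (2 * x) = 1 / x" by simp
        ultimately show ?thesis unfolding step using x min.cobounded1[of x "1 / x"] by linarith
      qed
    qed
  qed simp
  note * = this[of x]
  consider "x = 0" | "0 < x" "x < 1" | "x \<ge> 1" using assms by linarith
  then show ?thesis
  proof cases
    case 3
    then have "2 / x \<le> 4" by (simp add: field_simps)
    then show ?thesis using * 3 by linarith
  qed (use * in auto)
qed

section \<open>Low-pass filters on the frequency side\<close>

definition ft :: "(real ^ 'n::finite \<Rightarrow> real) \<Rightarrow> real ^ 'n \<Rightarrow> real \<Rightarrow> real" where
  "ft f \<eta> t = (LINT y|lborel. cos (\<eta> \<bullet> y + t) * f y)"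

text \<open>The filter with multiplier \<open>cutoff\<close> at frequency 2^j. The factor (2
  pi)^{-n} of the inversion formula is left out, so the expected limit is (2 pi)^n f.\<close>

definition lowpass :: "(real ^ 'n::finite \<Rightarrow> real) \<Rightarrow> nat \<Rightarrow> real ^ 'n \<Rightarrow> real" where
  "lowpass f j x = (2 ^ j) ^ CARD('n) * (LINT y|lborel. osc cutoff 0 ((2 ^ j) *\<^sub>R (y - x)) * f y)"

lemma multiplier_cutoff: "multiplier (cutoff :: real ^ 'n::finite \<Rightarrow> real)"
  unfolding multiplier_def
proof (intro conjI allI impI)
  show "bdd_lipschitz UNIV (cutoff :: real ^ 'n \<Rightarrow> real)"
  proof (rule bdd_lipschitzI[where C=1 and D=1])
    fix x y :: "real ^ 'n"
    have "\<bar>max 0 (min 1 (2 - a)) - max 0 (min 1 (2 - b))\<bar> \<le> \<bar>a - b\<bar>" for a b :: real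
      by (simp add: max_def min_def abs_minus_commute)
    from order_trans[OF this norm_triangle_ineq3]
    show "norm (cutoff x - cutoff y) \<le> 1 * norm (x - y)"
      unfolding cutoff_def real_norm_def by simp
  qed (auto simp: cutoff_def)
qed (auto simp: cutoff_def)

lemma osc_continuous:
  assumes "multiplier m"
  shows "continuous_on UNIV (osc m t)"
proof -
  obtain C where C: "C \<ge> 0" "\<And>t z z'. norm (osc m t z - osc m t z') \<le> C * norm (z - z')"
    by (rule osc_bounds[OF assms]) blast
  have "C-lipschitz_on UNIV (osc m t)"
    by (rule lipschitz_onI) (use C in \<open>auto simp: dist_norm\<close>)
  then show ?thesis by (rule lipschitz_on_continuous_on)
qed

lemma osc_measurable: "multiplier m \<Longrightarrow> osc m t \<in> borel_measurable borel"
  by (rule borel_measurable_continuous_onI[OF osc_continuous])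

lemma integrable_pair_mult:
  fixes g :: "'a::euclidean_space \<Rightarrow> real" and f :: "'b::euclidean_space \<Rightarrow> real"
  assumes g: "integrable lborel g" and f: "integrable lborel f"
    and h: "(\<lambda>(x, y). h x y) \<in> borel_measurable (borel \<Otimes>\<^sub>M borel)" "\<And>x y. \<bar>h x y\<bar> \<le> (C::real)"
  shows "integrable (lborel \<Otimes>\<^sub>M lborel) (\<lambda>(x, y). h x y * g x * f y)"
proof -
  have gm: "g \<in> borel_measurable borel" "f \<in> borel_measurable borel" using g f by auto
  have base: "integrable (lborel \<Otimes>\<^sub>M lborel) (\<lambda>z. g (fst z) * f (snd z))"
  proof (rule lborel_pair.Fubini_integrable)
    show "(\<lambda>z. g (fst z) * f (snd z)) \<in> borel_measurable (lborel \<Otimes>\<^sub>M lborel)"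
      using gm by measurable
    show "integrable lborel (\<lambda>x. LINT y|lborel. norm (g (fst (x, y)) * f (snd (x, y))))"
      using integrable_norm[OF g] integrable_norm[OF f] by (simp add: abs_mult)
    show "AE x in lborel. integrable lborel (\<lambda>y. g (fst (x, y)) * f (snd (x, y)))"
      using f by simp
  qed
  have hm: "(\<lambda>z. h (fst z) (snd z)) \<in> borel_measurable (lborel \<Otimes>\<^sub>M lborel)"
    using h(1) by (simp add: case_prod_beta' cong: measurable_cong_sets)
  show ?thesis
    unfolding case_prod_beta'
  proof (rule Bochner_Integration.integrable_bound[OF integrable_mult_right[OF base, of C]])
    show "(\<lambda>z. h (fst z) (snd z) * g (fst z) * f (snd z)) \<in> borel_measurable (lborel \<Otimes>\<^sub>M lborel)"
      using hm gm by measurable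
    show "AE z in lborel \<Otimes>\<^sub>M lborel. norm (h (fst z) (snd z) * g (fst z) * f (snd z)) \<le> norm (C * (g (fst z) * f (snd z)))"
    proof (intro AE_I2)
      fix z :: "'a \<times> 'b"
      have "\<bar>h (fst z) (snd z)\<bar> * \<bar>g (fst z) * f (snd z)\<bar> \<le> \<bar>C\<bar> * \<bar>g (fst z) * f (snd z)\<bar>"
        by (intro mult_right_mono order_trans[OF h(2) abs_ge_self]) auto
      then show "norm (h (fst z) (snd z) * g (fst z) * f (snd z)) \<le> norm (C * (g (fst z) * f (snd z)))"
        by (simp add: abs_mult mult.assoc)
    qed
  qed
qed

text \<open>Moves the filter to the frequency side. Translation by \<open>x\<close> becomes a shift
  of the phase argument of \<open>ft\<close>, so no complex exponential is needed.\<close>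

lemma osc_fubini:
  fixes m :: "real ^ 'n::finite \<Rightarrow> real"
  assumes m: "multiplier m" and f: "integrable lborel f"
  shows "(LINT y|lborel. osc m t (r *\<^sub>R (y - x)) * f y) = (LINT \<xi>|lborel. m \<xi> * ft f (r *\<^sub>R \<xi>) (t - r * (\<xi> \<bullet> x)))"
proof -
  have mi: "integrable lborel m" using osc_integrable[OF m, of 0 0] by simp
  have "integrable (lborel \<Otimes>\<^sub>M lborel) (\<lambda>(\<xi>, y). cos (\<xi> \<bullet> (r *\<^sub>R (y - x)) + t) * m \<xi> * f y)"
    by (rule integrable_pair_mult[OF mi f, where C=1]) auto
  from lborel_pair.Fubini_integral[OF this]
  have "(LINT y|lborel. LINT \<xi>|lborel. cos (\<xi> \<bullet> (r *\<^sub>R (y - x)) + t) * m \<xi> * f y)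
      = (LINT \<xi>|lborel. LINT y|lborel. cos (\<xi> \<bullet> (r *\<^sub>R (y - x)) + t) * m \<xi> * f y)" .
  also have "(LINT y|lborel. LINT \<xi>|lborel. cos (\<xi> \<bullet> (r *\<^sub>R (y - x)) + t) * m \<xi> * f y)
      = (LINT y|lborel. osc m t (r *\<^sub>R (y - x)) * f y)"
    by (simp add: osc_def)
  also have "(LINT \<xi>|lborel. LINT y|lborel. cos (\<xi> \<bullet> (r *\<^sub>R (y - x)) + t) * m \<xi> * f y)
      = (LINT \<xi>|lborel. m \<xi> * ft f (r *\<^sub>R \<xi>) (t - r * (\<xi> \<bullet> x)))"
  proof (rule Bochner_Integration.integral_cong[OF refl])
    fix \<xi> :: "real ^ 'n"
    have arg: "\<xi> \<bullet> (r *\<^sub>R (y - x)) + t = (r *\<^sub>R \<xi>) \<bullet> y + (t - r * (\<xi> \<bullet> x))" for y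
      by (simp add: inner_diff_right right_diff_distrib)
    have "cos (\<xi> \<bullet> (r *\<^sub>R (y - x)) + t) * m \<xi> * f y = m \<xi> * (cos ((r *\<^sub>R \<xi>) \<bullet> y + (t - r * (\<xi> \<bullet> x))) * f y)" for y
      unfolding arg by (simp only: mult_ac)
    then show "(LINT y|lborel. cos (\<xi> \<bullet> (r *\<^sub>R (y - x)) + t) * m \<xi> * f y)
        = m \<xi> * ft f (r *\<^sub>R \<xi>) (t - r * (\<xi> \<bullet> x))"
      by (simp only: ft_def integral_mult_right_zero)
  qed
  finally show ?thesis .
qed

lemma ft_bound:
  assumes "integrable lborel f"
  shows "\<bar>ft f \<eta> t\<bar> \<le> (LINT y|lborel. \<bar>f y\<bar>)"
proof -
  have le: "\<bar>cos (\<eta> \<bullet> y + t) * f y\<bar> \<le> \<bar>f y\<bar>" for y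
    by (simp add: abs_mult mult_left_le_one_le)
  have i: "integrable lborel (\<lambda>y. cos (\<eta> \<bullet> y + t) * f y)"
    using integrable_bounded_mult[OF assms, of "\<lambda>y. cos (\<eta> \<bullet> y + t)" 1] by simp
  have "\<bar>ft f \<eta> t\<bar> \<le> (LINT y|lborel. \<bar>cos (\<eta> \<bullet> y + t) * f y\<bar>)"
    unfolding ft_def by (rule integral_abs_bound)
  also have "\<dots> \<le> (LINT y|lborel. \<bar>f y\<bar>)"
    by (rule integral_mono[OF integrable_abs[OF i] integrable_abs[OF assms] le])
  finally show ?thesis .
qed

lemma ft_measurable:
  fixes f :: "real ^ 'n::finite \<Rightarrow> real"
  assumes f: "integrable lborel f"
  shows "(\<lambda>\<xi>. ft f (r *\<^sub>R \<xi>) (c * (\<xi> \<bullet> x))) \<in> borel_measurable borel"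
proof -
  have [measurable]: "f \<in> borel_measurable borel" using f by auto
  have "(\<lambda>\<xi>. LINT y|lborel. cos ((r *\<^sub>R \<xi>) \<bullet> y + c * (\<xi> \<bullet> x)) * f y) \<in> borel_measurable borel"
    by (rule sigma_finite_measure.borel_measurable_lebesgue_integral[OF lborel.sigma_finite_measure_axioms]) measurable
  then show ?thesis by (simp add: ft_def)
qed

lemma lowpass_eq:
  fixes f :: "real ^ 'n::finite \<Rightarrow> real"
  assumes f: "integrable lborel f"
  shows "lowpass f j x = (2 ^ j) ^ CARD('n) * (LINT \<xi>|lborel. cutoff \<xi> * ft f ((2 ^ j) *\<^sub>R \<xi>) (- (2 ^ j) * (\<xi> \<bullet> x)))"
  unfolding lowpass_def osc_fubini[OF multiplier_cutoff f] by simp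

text \<open>Replacing \<xi> by 2 \<xi> in the coarser filter gives both integrals the same transform
  and the same power of 2; the multipliers then subtract to \<open>ring_cutoff\<close>.\<close>

lemma lowpass_Suc:
  fixes f :: "real ^ 'n::finite \<Rightarrow> real"
  assumes f: "integrable lborel f"
  shows "lowpass f (Suc j) x - lowpass f j x =
    (2 ^ Suc j) ^ CARD('n) * (LINT \<xi>|lborel. ring_cutoff \<xi> * ft f ((2 ^ Suc j) *\<^sub>R \<xi>) (- (2 ^ Suc j) * (\<xi> \<bullet> x)))"
proof -
  let ?H = "\<lambda>\<xi>. ft f ((2 ^ Suc j) *\<^sub>R \<xi>) (- (2 ^ Suc j) * (\<xi> \<bullet> x))"
  have cm[measurable]: "cutoff \<in> borel_measurable (borel :: (real ^ 'n) measure)"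
    by (rule borel_measurable_continuous_onI[OF multiplier_continuous[OF multiplier_cutoff]])
  have Hm[measurable]: "?H \<in> borel_measurable borel" by (rule ft_measurable[OF f])
  have "(LINT \<xi>|lborel. cutoff \<xi> * ft f ((2 ^ j) *\<^sub>R \<xi>) (- (2 ^ j) * (\<xi> \<bullet> x)))
      = \<bar>2\<bar> ^ DIM(real ^ 'n) *\<^sub>R (LINT \<xi>|lborel. cutoff (2 *\<^sub>R \<xi>) * ft f ((2 ^ j) *\<^sub>R (2 *\<^sub>R \<xi>)) (- (2 ^ j) * ((2 *\<^sub>R \<xi>) \<bullet> x)))"
    by (rule lborel_integral_scale[OF borel_measurable_times[OF cm ft_measurable[OF f]]]) simp
  moreover have "ft f ((2 ^ j) *\<^sub>R (2 *\<^sub>R \<xi>)) (- (2 ^ j) * ((2 *\<^sub>R \<xi>) \<bullet> x)) = ?H \<xi>" for \<xi>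
    by (simp add: mult_ac)
  ultimately have "(LINT \<xi>|lborel. cutoff \<xi> * ft f ((2 ^ j) *\<^sub>R \<xi>) (- (2 ^ j) * (\<xi> \<bullet> x)))
      = 2 ^ CARD('n) * (LINT \<xi>|lborel. cutoff (2 *\<^sub>R \<xi>) * ?H \<xi>)" by simp
  then have 1: "lowpass f j x = (2 ^ Suc j) ^ CARD('n) * (LINT \<xi>|lborel. cutoff (2 *\<^sub>R \<xi>) * ?H \<xi>)"
    unfolding lowpass_eq[OF f] power_Suc2 power_mult_distrib by (simp only: mult_ac)
  define N where "N = (LINT y|lborel. \<bar>f y\<bar>)"
  have N: "\<bar>?H \<xi>\<bar> \<le> N" for \<xi> unfolding N_def by (rule ft_bound[OF f])
  have N0: "N \<ge> 0" unfolding N_def by simp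
  have i: "integrable lborel (\<lambda>\<xi>. cutoff (c *\<^sub>R \<xi>) * ?H \<xi>)" if "c \<ge> 1" for c
  proof (rule integrable_bounded_support(1)[where C=N and R=2])
    show "norm (cutoff (c *\<^sub>R \<xi>) * ?H \<xi>) \<le> N" for \<xi>
    proof -
      have "\<bar>cutoff (c *\<^sub>R \<xi>)\<bar> * \<bar>?H \<xi>\<bar> \<le> 1 * N" by (intro mult_mono N) (auto simp: cutoff_def)
      then show ?thesis by (simp add: abs_mult)
    qed
    show "cutoff (c *\<^sub>R \<xi>) * ?H \<xi> = 0" if "2 < norm \<xi>" for \<xi> :: "real ^ 'n"
    proof -
      have "1 * norm \<xi> \<le> c * norm \<xi>" using \<open>c \<ge> 1\<close> by (intro mult_right_mono) auto
      then show ?thesis using that \<open>c \<ge> 1\<close> by (simp add: cutoff_def)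
    qed
  qed measurable
  have "lowpass f (Suc j) x - lowpass f j x
      = (2 ^ Suc j) ^ CARD('n) * ((LINT \<xi>|lborel. cutoff \<xi> * ?H \<xi>) - (LINT \<xi>|lborel. cutoff (2 *\<^sub>R \<xi>) * ?H \<xi>))"
    unfolding 1 unfolding lowpass_eq[OF f] by (simp only: right_diff_distrib)
  also have "(LINT \<xi>|lborel. cutoff \<xi> * ?H \<xi>) - (LINT \<xi>|lborel. cutoff (2 *\<^sub>R \<xi>) * ?H \<xi>)
      = (LINT \<xi>|lborel. ring_cutoff \<xi> * ?H \<xi>)"
    using i[of 1] i[of 2] unfolding ring_cutoff_def left_diff_distrib by simp
  finally show ?thesis .
qed

section \<open>Dyadic pieces as pairings with the measure\<close>

context elliptic_op
begin

text \<open>Fubini reduces the pairing to \<open>fourier_relation\<close> at frequency r \<xi>, and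
  homogeneity of the symbol produces r^k. For k equal to the dimension this is exactly the prefactor
  in \<open>lowpass_Suc\<close>.\<close>

lemma pairing_osc:
  assumes u: "integrable lborel u" and \<mu>: "is_op_measure k B u \<mu>" and m: "multiplier m"
  shows "pairing \<mu> (\<lambda>y. osc m s (r *\<^sub>R (y - x))) =
    (LINT \<xi>|lborel. r ^ k * (-1) ^ k * (m \<xi> \<bullet> S \<xi> (LINT y|lborel. cos ((r *\<^sub>R \<xi>) \<bullet> y + (s - r * (\<xi> \<bullet> x) + real k * pi / 2)) *\<^sub>R u y)))"
proof -
  interpret vector_measure \<mu> using \<mu> by (simp add: vector_measure_def is_op_measure_def)
  have mi: "integrable lborel m" using osc_integrable[OF m, of 0 0] by simp
  then have [measurable]: "m \<in> borel_measurable borel" by auto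
  have "pairing \<mu> (\<lambda>y. osc m s (r *\<^sub>R (y - x))) = (LINT \<xi>|lborel. pairing \<mu> (\<lambda>y. cos (\<xi> \<bullet> (r *\<^sub>R (y - x)) + s) *\<^sub>R m \<xi>))"
    unfolding osc_def
  proof (rule pairing_fubini(1)[OF _ integrable_norm[OF mi]])
    show "norm (cos (\<xi> \<bullet> (r *\<^sub>R (y - x)) + s) *\<^sub>R m \<xi>) \<le> norm (m \<xi>)" for \<xi> y
      by (simp add: mult_left_le_one_le)
  qed measurable
  also have "\<dots> = (LINT \<xi>|lborel. r ^ k * (-1) ^ k * (m \<xi> \<bullet> S \<xi> (LINT y|lborel. cos ((r *\<^sub>R \<xi>) \<bullet> y + (s - r * (\<xi> \<bullet> x) + real k * pi / 2)) *\<^sub>R u y)))"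
  proof (rule Bochner_Integration.integral_cong[OF refl])
    fix \<xi> :: "real ^ 'n"
    have arg: "\<xi> \<bullet> (r *\<^sub>R (y - x)) + s = (r *\<^sub>R \<xi>) \<bullet> y + (s - r * (\<xi> \<bullet> x))" for y
      by (simp add: inner_diff_right right_diff_distrib)
    have "pairing \<mu> (\<lambda>y. cos (\<xi> \<bullet> (r *\<^sub>R (y - x)) + s) *\<^sub>R m \<xi>)
        = vector_integral \<mu> (\<lambda>y. cos ((r *\<^sub>R \<xi>) \<bullet> y + (s - r * (\<xi> \<bullet> x)))) \<bullet> m \<xi>"
      unfolding arg by (rule pairing_scaleR)
    also have "\<dots> = r ^ k * (-1) ^ k * (m \<xi> \<bullet> S \<xi> (LINT y|lborel. cos ((r *\<^sub>R \<xi>) \<bullet> y + (s - r * (\<xi> \<bullet> x) + real k * pi / 2)) *\<^sub>R u y))"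
      unfolding fourier_relation[OF u \<mu>] unfolding symbol_scale blinfun.scaleR_left
      by (simp only: inner_scaleR_left inner_scaleR_right inner_commute mult_ac)
    finally show "pairing \<mu> (\<lambda>y. cos (\<xi> \<bullet> (r *\<^sub>R (y - x)) + s) *\<^sub>R m \<xi>) =
      r ^ k * (-1) ^ k * (m \<xi> \<bullet> S \<xi> (LINT y|lborel. cos ((r *\<^sub>R \<xi>) \<bullet> y + (s - r * (\<xi> \<bullet> x) + real k * pi / 2)) *\<^sub>R u y))" .
  qed
  finally show ?thesis .
qed

lemma pairing_proj_mult:
  assumes u: "integrable lborel u" and \<mu>: "is_op_measure k B u \<mu>"
  shows "pairing \<mu> (\<lambda>y. osc (proj_mult w) s (r *\<^sub>R (y - x))) = 0"
  unfolding pairing_osc[OF u \<mu> multiplier_proj_mult] proj_mult_orth by simp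

lemma pairing_inv_mult:
  assumes u: "integrable lborel u" and \<mu>: "is_op_measure k B u \<mu>"
  shows "pairing \<mu> (\<lambda>y. osc (inv_mult v) (real k * pi / 2) (r *\<^sub>R (y - x))) =
    r ^ k * (LINT \<xi>|lborel. ring_cutoff \<xi> * ft (\<lambda>y. v \<bullet> u y) (r *\<^sub>R \<xi>) (- r * (\<xi> \<bullet> x)))"
proof -
  have eq: "r ^ k * (-1) ^ k * (inv_mult v \<xi> \<bullet> S \<xi> (LINT y|lborel. cos ((r *\<^sub>R \<xi>) \<bullet> y + (real k * pi / 2 - r * (\<xi> \<bullet> x) + real k * pi / 2)) *\<^sub>R u y))
      = r ^ k * (ring_cutoff \<xi> * ft (\<lambda>y. v \<bullet> u y) (r *\<^sub>R \<xi>) (- r * (\<xi> \<bullet> x)))" for \<xi>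
  proof -
    \<comment> \<open>The phase k pi / 2 of the kernel adds to the k pi / 2 created by k
      derivatives; the resulting shift by k pi gives a sign that cancels the (-1)^k of the
      distributional derivative.\<close>
    have c: "cos ((r *\<^sub>R \<xi>) \<bullet> y + (real k * pi / 2 - r * (\<xi> \<bullet> x) + real k * pi / 2)) = (-1) ^ k * cos ((r *\<^sub>R \<xi>) \<bullet> y + - r * (\<xi> \<bullet> x))" for y
    proof -
      have "(r *\<^sub>R \<xi>) \<bullet> y + (real k * pi / 2 - r * (\<xi> \<bullet> x) + real k * pi / 2) = ((r *\<^sub>R \<xi>) \<bullet> y + - r * (\<xi> \<bullet> x)) + real k * pi"
        by simp
      then show ?thesis by (simp only: cos_add cos_npi sin_npi) simp
    qed
    have i: "integrable lborel (\<lambda>y. cos ((r *\<^sub>R \<xi>) \<bullet> y + - r * (\<xi> \<bullet> x)) *\<^sub>R u y)"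
      by (rule integrable_bounded_mult[OF u, where C=1]) auto
    have e1: "(LINT y|lborel. cos ((r *\<^sub>R \<xi>) \<bullet> y + (real k * pi / 2 - r * (\<xi> \<bullet> x) + real k * pi / 2)) *\<^sub>R u y)
      = (-1) ^ k *\<^sub>R (LINT y|lborel. cos ((r *\<^sub>R \<xi>) \<bullet> y + - r * (\<xi> \<bullet> x)) *\<^sub>R u y)"
      unfolding c scaleR_scaleR[symmetric] by (rule integral_scaleR_right)
    have e2: "v \<bullet> (LINT y|lborel. cos ((r *\<^sub>R \<xi>) \<bullet> y + - r * (\<xi> \<bullet> x)) *\<^sub>R u y)
        = ft (\<lambda>y. v \<bullet> u y) (r *\<^sub>R \<xi>) (- r * (\<xi> \<bullet> x))"
      using integral_inner_right[OF i, of v] by (simp add: ft_def)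
    have "(-1) ^ k * ((-1) ^ k * a) = (a::real)" for a
      by (simp flip: mult.assoc power_mult_distrib)
    then show ?thesis
      unfolding e1 inv_mult_inner blinfun.scaleR_right inner_scaleR_right e2 mult.assoc by simp
  qed
  show ?thesis
    unfolding pairing_osc[OF u \<mu> multiplier_inv_mult] eq by simp
qed

text \<open>Kernels built from \<open>proj_mult w\<close> pair to 0 with the measure at every scale.
  With \<open>w\<close> chosen so that the value at the origin is \<open>\<mu> {x}\<close>, the
  dilated kernels tend to that value at x and to 0 elsewhere, so the pairings tend to the squared
  norm of \<open>\<mu> {x}\<close>.\<close>

lemma no_atoms:
  assumes u: "integrable lborel u" and \<mu>: "is_op_measure k B u \<mu>" and can: "canceling k B"
  shows "var \<mu> {x} = 0"
proof -
  interpret vector_measure \<mu> using \<mu> by (simp add: vector_measure_def is_op_measure_def)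
  obtain w where w: "osc (proj_mult w) 0 0 = \<mu> {x}" by (rule osc_proj_mult_surj[OF can])
  obtain C where C: "C \<ge> 0" "\<And>t z. norm (osc (proj_mult w) t z) \<le> C" "\<And>t z. norm (osc (proj_mult w) t z) * norm z \<le> C"
    by (rule osc_bounds[OF multiplier_proj_mult]) blast
  note [measurable] = osc_measurable[OF multiplier_proj_mult]
  have "(\<lambda>j. pairing \<mu> (\<lambda>y. osc (proj_mult w) 0 ((2 ^ j) *\<^sub>R (y - x)))) \<longlonglongrightarrow> pairing \<mu> (\<lambda>y. indicator {x} y *\<^sub>R \<mu> {x})"
  proof (rule pairing_dct[where C=C])
    show "(\<lambda>y. osc (proj_mult w) 0 ((2 ^ j) *\<^sub>R (y - x))) \<in> borel_measurable borel" for j by measurable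
    show "norm (osc (proj_mult w) 0 ((2 ^ j) *\<^sub>R (y - x))) \<le> C" for j y by (rule C)
    show "(\<lambda>j. osc (proj_mult w) 0 ((2 ^ j) *\<^sub>R (y - x))) \<longlonglongrightarrow> indicator {x} y *\<^sub>R \<mu> {x}" for y
    proof (cases "y = x")
      case False
      have "(\<lambda>j. C / norm (y - x) * (1 / 2) ^ j) \<longlonglongrightarrow> C / norm (y - x) * 0"
        by (intro tendsto_mult tendsto_const LIMSEQ_realpow_zero) auto
      then have l: "(\<lambda>j. C / norm (y - x) * (1 / 2) ^ j) \<longlonglongrightarrow> 0" by simp
      have "norm (osc (proj_mult w) 0 ((2 ^ j) *\<^sub>R (y - x))) \<le> C / norm (y - x) * (1 / 2) ^ j" for j
      proof -
        have n: "norm ((2 ^ j) *\<^sub>R (y - x)) = 2 ^ j * norm (y - x)" by simp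
        have "norm (osc (proj_mult w) 0 ((2 ^ j) *\<^sub>R (y - x))) \<le> C / (2 ^ j * norm (y - x))"
          using C(3)[of 0 "(2 ^ j) *\<^sub>R (y - x)"] False unfolding n by (subst pos_le_divide_eq) auto
        also have "\<dots> = C / norm (y - x) * (1 / 2) ^ j" by (simp add: power_one_over)
        finally show ?thesis .
      qed
      then have "(\<lambda>j. osc (proj_mult w) 0 ((2 ^ j) *\<^sub>R (y - x))) \<longlonglongrightarrow> 0"
        by (intro Lim_null_comparison[OF _ l]) auto
      then show ?thesis using False by simp
    qed (simp add: w)
  qed
  then have "pairing \<mu> (\<lambda>y. indicator {x} y *\<^sub>R \<mu> {x}) = 0"
    unfolding pairing_proj_mult[OF u \<mu>] by (simp add: LIMSEQ_const_iff)
  then have z: "\<mu> {x} = 0" by (simp add: pairing_scaleR vector_integral_indicator)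
  have "tv \<mu> {x} \<le> 0"
  proof (rule tv_le)
    fix P assume P: "partition_on {x} P"
    have "E = {x}" if "E \<in> P" for E
    proof -
      have "E \<subseteq> {x}" "E \<noteq> {}" using P that by (auto simp: partition_on_def)
      then show ?thesis by blast
    qed
    then show "(\<Sum>E\<in>P. norm (\<mu> E)) \<le> 0" using z by (intro sum_nonpos) auto
  qed simp
  then have "tv \<mu> {x} = 0" using tv_nonneg[of "{x}"] by linarith
  then show ?thesis using var_le_tv[of "{x}"] var_nonneg[of "{x}"] by simp
qed

end

text \<open>The kernels of all scales are summed before pairing with the measure. The sum is at most
  4C everywhere by \<open>dyadic_sum_le_4\<close>, and outside the ball the bounds by 1/|z| form a
  geometric series. \<open>C\<close> is fixed before u, the point, the radius and the
  scales.\<close>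

lemma lowpass_estimate:
  fixes B :: "('n::finite \<Rightarrow> nat) \<Rightarrow> 'v::euclidean_space \<Rightarrow>\<^sub>L 'w::euclidean_space"
  assumes "elliptic CARD('n) B" and can: "canceling CARD('n) B"
  obtains C where "C \<ge> 0" "\<And>u \<mu> x r a b. integrable lborel u \<Longrightarrow> is_op_measure CARD('n) B u \<mu> \<Longrightarrow> r > 0 \<Longrightarrow> b \<le> a \<Longrightarrow>
     \<bar>lowpass (\<lambda>y. v \<bullet> u y) a x - lowpass (\<lambda>y. v \<bullet> u y) b x\<bar> \<le> C * (var \<mu> (ball x r) + var \<mu> UNIV / (2 ^ b * r))"
proof -
  let ?n = "CARD('n)"
  interpret elliptic_op ?n B by standard (rule assms(1))
  obtain w C where C: "C \<ge> 0"
    "\<And>z. norm (osc (inv_mult v) (real ?n * pi / 2) z - osc (proj_mult w) 0 z) \<le> C * min (norm z) (1 / norm z)"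
    "\<And>z. norm (osc (inv_mult v) (real ?n * pi / 2) z - osc (proj_mult w) 0 z) \<le> C"
    by (rule canceling_kernel[OF can, of v "real ?n * pi / 2"]) blast
  obtain C1 where C1: "\<And>t z. norm (osc (inv_mult v) t z) \<le> C1" by (rule osc_bounds[OF multiplier_inv_mult]) blast
  obtain C2 where C2: "\<And>t z. norm (osc (proj_mult w) t z) \<le> C2" by (rule osc_bounds[OF multiplier_proj_mult]) blast
  define \<kappa> where "\<kappa> z = osc (inv_mult v) (real ?n * pi / 2) z - osc (proj_mult w) 0 z" for z
  note om[measurable] = osc_measurable[OF multiplier_inv_mult] osc_measurable[OF multiplier_proj_mult]
  have [measurable]: "\<kappa> \<in> borel_measurable borel"
    unfolding \<kappa>_def by measurable
  show ?thesis
  proof (rule that[of "4 * C"])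
    fix u \<mu> and x :: "real ^ 'n" and r :: real and a b :: nat
    assume u: "integrable lborel u" and \<mu>: "is_op_measure ?n B u \<mu>" and r: "r > 0" and ab: "b \<le> a"
    interpret vector_measure \<mu> using \<mu> by (simp add: vector_measure_def is_op_measure_def)
    let ?f = "\<lambda>y. v \<bullet> u y"
    have f: "integrable lborel ?f" using u by simp
    have piece: "lowpass ?f (Suc j) x - lowpass ?f j x = pairing \<mu> (\<lambda>y. \<kappa> ((2 ^ Suc j) *\<^sub>R (y - x)))" for j
    proof -
      have "pairing \<mu> (\<lambda>y. \<kappa> ((2 ^ Suc j) *\<^sub>R (y - x)))
         = pairing \<mu> (\<lambda>y. osc (inv_mult v) (real ?n * pi / 2) ((2 ^ Suc j) *\<^sub>R (y - x)) + - osc (proj_mult w) 0 ((2 ^ Suc j) *\<^sub>R (y - x)))"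
        by (simp add: \<kappa>_def)
      also have "\<dots> = pairing \<mu> (\<lambda>y. osc (inv_mult v) (real ?n * pi / 2) ((2 ^ Suc j) *\<^sub>R (y - x)))
          + pairing \<mu> (\<lambda>y. - osc (proj_mult w) 0 ((2 ^ Suc j) *\<^sub>R (y - x)))"
      proof (rule pairing_add[where C=C1 and D=C2])
        show "norm (- osc (proj_mult w) 0 ((2 ^ Suc j) *\<^sub>R (y - x))) \<le> C2" for y
          unfolding norm_minus_cancel by (rule C2)
      qed (measurable, rule C1, measurable)
      also have "\<dots> = pairing \<mu> (\<lambda>y. osc (inv_mult v) (real ?n * pi / 2) ((2 ^ Suc j) *\<^sub>R (y - x)))"
        unfolding pairing_uminus pairing_proj_mult[OF u \<mu>] by simp
      finally show ?thesis
        unfolding lowpass_Suc[OF f] pairing_inv_mult[OF u \<mu>] by simp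
    qed
    define F where "F y = (\<Sum>j=b..<a. \<kappa> ((2 ^ Suc j) *\<^sub>R (y - x)))" for y
    have "lowpass ?f a x - lowpass ?f b x = (\<Sum>j=b..<a. lowpass ?f (Suc j) x - lowpass ?f j x)"
      by (rule sum_Suc_diff'[OF ab, symmetric])
    also have "\<dots> = pairing \<mu> F"
      unfolding piece F_def
    proof (rule pairing_sum[symmetric, where C=C])
      show "norm (\<kappa> ((2 ^ Suc j) *\<^sub>R (y - x))) \<le> C" for j y unfolding \<kappa>_def by (rule C(3))
    qed measurable
    finally have eq: "lowpass ?f a x - lowpass ?f b x = pairing \<mu> F" .
    have Fn: "norm (F y) \<le> C * (\<Sum>j=b..<a. min (2 ^ Suc j * norm (y - x)) (1 / (2 ^ Suc j * norm (y - x))))" for y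
    proof -
      have "norm (F y) \<le> (\<Sum>j=b..<a. C * min (2 ^ Suc j * norm (y - x)) (1 / (2 ^ Suc j * norm (y - x))))"
        unfolding F_def
      proof (rule sum_norm_le)
        fix j
        have n: "norm ((2 ^ Suc j) *\<^sub>R (y - x)) = 2 ^ Suc j * norm (y - x)" by simp
        show "norm (\<kappa> ((2 ^ Suc j) *\<^sub>R (y - x))) \<le> C * min (2 ^ Suc j * norm (y - x)) (1 / (2 ^ Suc j * norm (y - x)))"
          using C(2)[of "(2 ^ Suc j) *\<^sub>R (y - x)"] unfolding n \<kappa>_def .
      qed
      then show ?thesis unfolding sum_distrib_left .
    qed
    have F4: "norm (F y) \<le> 4 * C" for y
    proof -
      \<comment> \<open>The kernels carry 2^(j+1) while \<open>dyadic_sum_le_4\<close> has 2^j; the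
        surplus factor 2 is absorbed into its variable.\<close>
      have "(\<Sum>j=b..<a. min (2 ^ Suc j * norm (y - x)) (1 / (2 ^ Suc j * norm (y - x))))
          = (\<Sum>j=b..<a. min (2 ^ j * (2 * norm (y - x))) (1 / (2 ^ j * (2 * norm (y - x)))))"
        unfolding power_Suc2 mult.assoc ..
      also have "\<dots> \<le> (\<Sum>j<a. min (2 ^ j * (2 * norm (y - x))) (1 / (2 ^ j * (2 * norm (y - x)))))"
        by (rule sum_mono2) auto
      also have "\<dots> \<le> 4" by (rule dyadic_sum_le_4) simp
      finally have "C * (\<Sum>j=b..<a. min (2 ^ Suc j * norm (y - x)) (1 / (2 ^ Suc j * norm (y - x)))) \<le> C * 4"
        using C(1) by (intro mult_left_mono)
      then show ?thesis using Fn[of y] by linarith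
    qed
    have Fout: "norm (F y) \<le> C / (2 ^ b * r)" if y: "y \<notin> ball x r" for y
    proof -
      have ry: "r \<le> norm (y - x)" using y by (simp add: dist_norm norm_minus_commute)
      \<comment> \<open>1 / 2^(j+1) is written as a difference so that the sum telescopes and stays
        below 1 / 2^b for every \<open>a\<close>.\<close>
      have "(\<Sum>j=b..<a. min (2 ^ Suc j * norm (y - x)) (1 / (2 ^ Suc j * norm (y - x)))) \<le> (\<Sum>j=b..<a. ((- 1 / 2 ^ Suc j) - (- 1 / 2 ^ j)) * (1 / r))"
      proof (rule sum_mono)
        fix j
        have "min (2 ^ Suc j * norm (y - x)) (1 / (2 ^ Suc j * norm (y - x))) \<le> 1 / (2 ^ Suc j * norm (y - x))" by simp
        also have "\<dots> \<le> 1 / (2 ^ Suc j * r)"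
          using r ry by (intro divide_left_mono mult_left_mono mult_pos_pos) auto
        also have "\<dots> = ((- 1 / 2 ^ Suc j) - (- 1 / 2 ^ j)) * (1 / r)" using r by (simp add: field_simps)
        finally show "min (2 ^ Suc j * norm (y - x)) (1 / (2 ^ Suc j * norm (y - x))) \<le> ((- 1 / 2 ^ Suc j) - (- 1 / 2 ^ j)) * (1 / r)" .
      qed
      also have "\<dots> = (\<Sum>j=b..<a. (- 1 / 2 ^ Suc j) - (- 1 / 2 ^ j)) * (1 / r)"
        unfolding sum_distrib_right ..
      also have "(\<Sum>j=b..<a. (- 1 / 2 ^ Suc j) - (- 1 / 2 ^ j)) = (- 1 / 2 ^ a) - (- 1 / 2 ^ b :: real)"
        by (rule sum_Suc_diff'[OF ab])
      also have "\<dots> * (1 / r) \<le> (1 / 2 ^ b) * (1 / r)" using r by (intro mult_right_mono) auto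
      finally have "C * (\<Sum>j=b..<a. min (2 ^ Suc j * norm (y - x)) (1 / (2 ^ Suc j * norm (y - x)))) \<le> C * ((1 / 2 ^ b) * (1 / r))"
        using C(1) by (intro mult_left_mono)
      then show ?thesis using Fn[of y] by simp
    qed
    have "\<bar>pairing \<mu> F\<bar> \<le> 4 * C * var \<mu> (ball x r) + C / (2 ^ b * r) * var \<mu> UNIV"
    proof (rule pairing_bound)
      show "F \<in> borel_measurable borel" unfolding F_def by measurable
      have nn: "0 \<le> C / (2 ^ b * r)" using C(1) r by simp
      show "norm (F y) \<le> 4 * C * indicator (ball x r) y + C / (2 ^ b * r)" for y
      proof (cases "y \<in> ball x r")
        case True
        then show ?thesis using F4[of y] nn by simp
      next
        case False
        then show ?thesis using Fout[of y] by simp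
      qed
    qed (use C(1) r in auto)
    also have "\<dots> \<le> 4 * C * (var \<mu> (ball x r) + var \<mu> UNIV / (2 ^ b * r))"
    proof -
      have "0 \<le> C * (var \<mu> UNIV / (2 ^ b * r))" using C(1) r var_nonneg[of UNIV] by simp
      moreover have "C / (2 ^ b * r) * var \<mu> UNIV = C * (var \<mu> UNIV / (2 ^ b * r))" by simp
      ultimately show ?thesis by (simp only: distrib_left mult.assoc)
    qed
    finally show "\<bar>lowpass ?f a x - lowpass ?f b x\<bar> \<le> 4 * C * (var \<mu> (ball x r) + var \<mu> UNIV / (2 ^ b * r))"
      by (simp only: eq)
  qed (use C in simp)
qed

section \<open>Inversion with Gaussians\<close>

definition gauss :: "'a::euclidean_space \<Rightarrow> real" where
  "gauss x = exp (- (x \<bullet> x) / 2)"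

definition gauss_mass :: "'a::euclidean_space itself \<Rightarrow> real" where
  "gauss_mass _ = sqrt (2 * pi) ^ DIM('a)"

lemma gauss_mass_pos: "gauss_mass TYPE('a::euclidean_space) > 0"
  by (simp add: gauss_mass_def)

lemma gauss_bounds: "0 \<le> gauss x" "gauss x \<le> 1"
  by (auto simp: gauss_def)

lemma abs_gauss [simp]: "\<bar>gauss x\<bar> = gauss x"
  by (simp add: gauss_def)

lemma gauss_minus [simp]: "gauss (- x) = gauss x"
  by (simp add: gauss_def)

lemma gauss_measurable [measurable]: "gauss \<in> borel_measurable borel"
  unfolding gauss_def[abs_def] by measurable

text \<open>Up to the factor sqrt (2 pi) this is the characteristic function of the standard normal
  distribution.\<close>

lemma cis_gauss_1d:
  "integrable lborel (\<lambda>s::real. exp (- s\<^sup>2 / 2) *\<^sub>R cis (t * s))"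
  "(LINT s|lborel. exp (- s\<^sup>2 / 2) *\<^sub>R cis (t * s)) = complex_of_real (sqrt (2 * pi) * exp (- t\<^sup>2 / 2))"
proof -
  have eq: "exp (- s\<^sup>2 / 2) *\<^sub>R cis (t * s) = sqrt (2 * pi) *\<^sub>R (std_normal_density s *\<^sub>R cis (t * s))" for s
    by (simp add: std_normal_density_def)
  have d: "integrable lborel std_normal_density"
    using integrable_normal_density[of 1 0] by simp
  have i: "integrable lborel (\<lambda>s. std_normal_density s *\<^sub>R cis (t * s))"
  proof (rule Bochner_Integration.integrable_bound[OF d])
    show "(\<lambda>s. std_normal_density s *\<^sub>R cis (t * s)) \<in> borel_measurable lborel"
      by (intro borel_measurable_scaleR) (auto intro!: borel_measurable_continuous_onI continuous_intros)
  qed (auto simp: norm_mult)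
  have "(LINT s|std_normal_distribution. cis (t * s)) = complex_of_real (exp (- t\<^sup>2 / 2))"
    using fun_cong[OF char_std_normal_distribution, of t] by (simp add: char_def cis_conv_exp)
  also have "(LINT s|std_normal_distribution. cis (t * s)) = (LINT s|lborel. std_normal_density s *\<^sub>R cis (t * s))"
    by (rule integral_density) (auto intro!: borel_measurable_continuous_onI continuous_intros)
  finally show "(LINT s|lborel. exp (- s\<^sup>2 / 2) *\<^sub>R cis (t * s)) = complex_of_real (sqrt (2 * pi) * exp (- t\<^sup>2 / 2))"
    unfolding eq by (simp add: scaleR_conv_of_real)
  show "integrable lborel (\<lambda>s::real. exp (- s\<^sup>2 / 2) *\<^sub>R cis (t * s))"
    unfolding eq by (rule integrable_scaleR_right[OF i])
qed

lemma cis_sum: "finite A \<Longrightarrow> cis (\<Sum>b\<in>A. f b) = (\<Prod>b\<in>A. cis (f b))"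
  by (induction A rule: finite_induct) (auto simp: cis_mult[symmetric])

text \<open>Lebesgue measure is the image of a product measure under expansion in the basis, and the
  integrand factors over the coordinates.\<close>

lemma cis_gauss:
  fixes \<xi> :: "'a::euclidean_space"
  shows "integrable lborel (\<lambda>x. gauss x *\<^sub>R cis (\<xi> \<bullet> x))"
    and "(LINT x|lborel. gauss x *\<^sub>R cis (\<xi> \<bullet> x)) = complex_of_real (gauss_mass TYPE('a) * gauss \<xi>)"
proof -
  let ?f = "\<lambda>b s. exp (- s\<^sup>2 / 2) *\<^sub>R cis ((\<xi> \<bullet> b) * s)"
  let ?M = "\<Pi>\<^sub>M b\<in>(Basis::'a set). (lborel :: real measure)"
  let ?T = "\<lambda>f. \<Sum>b\<in>(Basis::'a set). f b *\<^sub>R b"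
  interpret product_sigma_finite "\<lambda>_::'a. lborel :: real measure" by standard
  have fac: "gauss x *\<^sub>R cis (\<xi> \<bullet> x) = (\<Prod>b\<in>Basis. ?f b (x \<bullet> b))" for x :: 'a
  proof -
    have "gauss x = (\<Prod>b\<in>Basis. exp (- (x \<bullet> b)\<^sup>2 / 2))"
      unfolding gauss_def
      by (subst euclidean_inner) (simp add: exp_sum[symmetric] sum_negf sum_divide_distrib power2_eq_square)
    moreover have "cis (\<xi> \<bullet> x) = (\<Prod>b\<in>Basis. cis ((\<xi> \<bullet> b) * (x \<bullet> b)))"
      by (subst euclidean_inner) (simp add: cis_sum)
    ultimately show ?thesis by (simp add: scaleR_conv_of_real prod.distrib)
  qed
  have T: "?T \<in> measurable ?M borel" by measurable
  have comp: "?T f \<bullet> b = f b" if "b \<in> Basis" for f and b :: 'a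
    using that by (simp add: inner_sum_left_Basis)
  have fac': "gauss (?T f) *\<^sub>R cis (\<xi> \<bullet> ?T f) = (\<Prod>b\<in>Basis. ?f b (f b))" for f
    unfolding fac by (intro prod.cong refl) (simp only: comp)
  have meas: "(\<lambda>x. gauss x *\<^sub>R cis (\<xi> \<bullet> x)) \<in> borel_measurable borel"
    unfolding gauss_def by (intro borel_measurable_continuous_onI continuous_intros) auto
  have "integrable ?M (\<lambda>f. \<Prod>b\<in>Basis. ?f b (f b))"
    by (rule product_integrable_prod) (use cis_gauss_1d(1) in auto)
  then have "integrable ?M (\<lambda>f. gauss (?T f) *\<^sub>R cis (\<xi> \<bullet> ?T f))" by (simp only: fac')
  then show "integrable lborel (\<lambda>x. gauss x *\<^sub>R cis (\<xi> \<bullet> x))"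
    by (subst lborel_eq, subst integrable_distr_eq[OF T meas])
  have "(LINT x|lborel. gauss x *\<^sub>R cis (\<xi> \<bullet> x)) = (LINT f|?M. gauss (?T f) *\<^sub>R cis (\<xi> \<bullet> ?T f))"
    by (subst lborel_eq, subst integral_distr[OF T meas]) (rule refl)
  also have "\<dots> = (LINT f|?M. (\<Prod>b\<in>Basis. ?f b (f b)))" by (simp only: fac')
  also have "\<dots> = (\<Prod>b\<in>Basis. (LINT s|lborel. ?f b s))"
    by (rule product_integral_prod) (use cis_gauss_1d(1) in auto)
  also have "\<dots> = (\<Prod>b\<in>(Basis::'a set). complex_of_real (sqrt (2 * pi) * exp (- (\<xi> \<bullet> b)\<^sup>2 / 2)))"
    by (simp only: cis_gauss_1d(2))
  also have "\<dots> = complex_of_real (\<Prod>b\<in>(Basis::'a set). sqrt (2 * pi) * exp (- (\<xi> \<bullet> b)\<^sup>2 / 2))"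
    by simp
  also have "(\<Prod>b\<in>(Basis::'a set). sqrt (2 * pi) * exp (- (\<xi> \<bullet> b)\<^sup>2 / 2)) = gauss_mass TYPE('a) * gauss \<xi>"
  proof -
    have "gauss \<xi> = (\<Prod>b\<in>Basis. exp (- (\<xi> \<bullet> b)\<^sup>2 / 2))"
      unfolding gauss_def
      by (subst euclidean_inner) (simp add: exp_sum[symmetric] sum_negf sum_divide_distrib power2_eq_square)
    then show ?thesis by (simp only: prod.distrib gauss_mass_def prod_constant)
  qed
  finally show "(LINT x|lborel. gauss x *\<^sub>R cis (\<xi> \<bullet> x)) = complex_of_real (gauss_mass TYPE('a) * gauss \<xi>)" .
qed

lemma gauss_integrable: "integrable lborel (gauss :: 'a::euclidean_space \<Rightarrow> real)"
  using integrable_Re[OF cis_gauss(1)[of "0 :: 'a"]] by simp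

text \<open>The transform is real, so the sine term of the addition formula integrates to 0.\<close>

lemma gauss_cos:
  fixes \<xi> :: "'a::euclidean_space"
  shows "(LINT x|lborel. cos (\<xi> \<bullet> x + t) * gauss x) = gauss_mass TYPE('a) * gauss \<xi> * cos t"
proof -
  have re: "(LINT x|lborel. Re (gauss x *\<^sub>R cis (\<xi> \<bullet> x))) = gauss_mass TYPE('a) * gauss \<xi>"
    unfolding integral_Re[OF cis_gauss(1)] cis_gauss(2) by simp
  have im: "(LINT x|lborel. Im (gauss x *\<^sub>R cis (\<xi> \<bullet> x))) = 0"
    unfolding integral_Im[OF cis_gauss(1)] cis_gauss(2) by simp
  have i: "integrable lborel (\<lambda>x. Re (gauss x *\<^sub>R cis (\<xi> \<bullet> x)))" "integrable lborel (\<lambda>x. Im (gauss x *\<^sub>R cis (\<xi> \<bullet> x)))"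
    by (rule integrable_Re[OF cis_gauss(1)], rule integrable_Im[OF cis_gauss(1)])
  have "cos (\<xi> \<bullet> x + t) * gauss x = cos t * Re (gauss x *\<^sub>R cis (\<xi> \<bullet> x)) - sin t * Im (gauss x *\<^sub>R cis (\<xi> \<bullet> x))" for x
    by (simp add: cos_add algebra_simps)
  then have "(LINT x|lborel. cos (\<xi> \<bullet> x + t) * gauss x)
      = cos t * (LINT x|lborel. Re (gauss x *\<^sub>R cis (\<xi> \<bullet> x))) - sin t * (LINT x|lborel. Im (gauss x *\<^sub>R cis (\<xi> \<bullet> x)))"
    using i by simp
  then show ?thesis unfolding re im by simp
qed

lemma gauss_integral: "(LINT x|lborel. gauss (x::'a::euclidean_space)) = gauss_mass TYPE('a)"
  using gauss_cos[of "0::'a" 0] by (simp add: gauss_def)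

section \<open>Gaussian averages and the filtered Gaussian\<close>

lemma lborel_integrable_scale:
  fixes F :: "'a::euclidean_space \<Rightarrow> 'b::{banach, second_countable_topology}"
  assumes F: "integrable lborel F" and c: "c \<noteq> 0"
  shows "integrable lborel (\<lambda>x. F (c *\<^sub>R x))"
proof -
  have [measurable]: "F \<in> borel_measurable borel" using F by auto
  have eq: "(lborel :: 'a measure) = density (distr lborel borel (\<lambda>x. 0 + c *\<^sub>R x)) (\<lambda>_. ennreal (\<bar>c\<bar> ^ DIM('a)))"
    by (rule lborel_affine[OF c])
  have "integrable (density (distr lborel borel (\<lambda>x. 0 + c *\<^sub>R x)) (\<lambda>_. ennreal (\<bar>c\<bar> ^ DIM('a)))) F"
    using F unfolding eq[symmetric] .
  then have "integrable (distr lborel borel (\<lambda>x. 0 + c *\<^sub>R x)) (\<lambda>x. \<bar>c\<bar> ^ DIM('a) *\<^sub>R F x)"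
    by (subst (asm) integrable_density) auto
  then have "integrable (distr lborel borel (\<lambda>x. 0 + c *\<^sub>R x))
      (\<lambda>x. (1 / \<bar>c\<bar> ^ DIM('a)) *\<^sub>R (\<bar>c\<bar> ^ DIM('a) *\<^sub>R F x))" by (rule integrable_scaleR_right)
  then have "integrable (distr lborel borel (\<lambda>x. 0 + c *\<^sub>R x)) F" using c by simp
  then show ?thesis by (subst (asm) integrable_distr_eq) auto
qed

text \<open>An average with a Gaussian of width s that is not normalised: as s tends to 0 it tends
  to \<open>gauss_mass\<close> times the value of a bounded continuous function.\<close>

definition mollify :: "('a::euclidean_space \<Rightarrow> real) \<Rightarrow> real \<Rightarrow> 'a \<Rightarrow> real" where
  "mollify h s p = (LINT x|lborel. h x * gauss ((x - p) /\<^sub>R s)) / s ^ DIM('a)"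

lemma mollify_eq:
  fixes h :: "'a::euclidean_space \<Rightarrow> real"
  assumes [measurable]: "h \<in> borel_measurable borel" and s: "s > 0"
  shows "mollify h s p = (LINT x|lborel. h (p + s *\<^sub>R x) * gauss x)"
proof -
  have "(LINT x|lborel. h x * gauss ((x - p) /\<^sub>R s)) = (LINT x|lborel. h (p + x) * gauss ((p + x - p) /\<^sub>R s))"
    by (rule lborel_integral_shift[symmetric]) measurable
  also have "\<dots> = (LINT x|lborel. h (p + x) * gauss (x /\<^sub>R s))" by simp
  also have "\<dots> = \<bar>s\<bar> ^ DIM('a) *\<^sub>R (LINT x|lborel. h (p + s *\<^sub>R x) * gauss ((s *\<^sub>R x) /\<^sub>R s))"
    by (rule lborel_integral_scale) (measurable, use s in simp)
  finally show ?thesis using s by (simp add: mollify_def)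
qed

lemma mollify_bound:
  fixes h :: "'a::euclidean_space \<Rightarrow> real"
  assumes [measurable]: "h \<in> borel_measurable borel" and s: "s > 0" and M: "\<And>x. \<bar>h x\<bar> \<le> M"
  shows "\<bar>mollify h s p\<bar> \<le> M * gauss_mass TYPE('a)"
proof -
  have i: "integrable lborel (\<lambda>x. h (p + s *\<^sub>R x) * gauss x)"
    using integrable_bounded_mult[OF gauss_integrable, of "\<lambda>x. h (p + s *\<^sub>R x)" M] M by simp
  have "\<bar>mollify h s p\<bar> \<le> (LINT x|lborel. \<bar>h (p + s *\<^sub>R x) * gauss x\<bar>)"
    unfolding mollify_eq[OF assms(1) s] by (rule integral_abs_bound)
  also have "\<dots> \<le> (LINT x|lborel. M * gauss (x::'a))"
    by (rule integral_mono[OF integrable_abs[OF i]])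
       (use gauss_integrable M gauss_bounds in \<open>auto simp: abs_mult intro!: mult_right_mono\<close>)
  also have "\<dots> = M * gauss_mass TYPE('a)" by (simp add: gauss_integral)
  finally show ?thesis .
qed

lemma mollify_tendsto:
  fixes h :: "'a::euclidean_space \<Rightarrow> real"
  assumes h: "continuous_on UNIV h" and M: "\<And>x. \<bar>h x\<bar> \<le> M"
  shows "(\<lambda>j. mollify h (1 / real (Suc j)) p) \<longlonglongrightarrow> h p * gauss_mass TYPE('a)"
proof -
  have hm[measurable]: "h \<in> borel_measurable borel" by (rule borel_measurable_continuous_onI[OF h])
  have "(\<lambda>j. LINT x|lborel. h (p + (1 / real (Suc j)) *\<^sub>R x) *\<^sub>R gauss x) \<longlonglongrightarrow> (LINT x|lborel. h p *\<^sub>R gauss (x::'a))"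
  proof (rule cos_integral_dct[OF gauss_integrable, where C=M])
    show "(\<lambda>j. h (p + (1 / real (Suc j)) *\<^sub>R x)) \<longlonglongrightarrow> h p" for x
    proof -
      have "(\<lambda>j. 1 / real (Suc j)) \<longlonglongrightarrow> 0" using LIMSEQ_inverse_real_of_nat by (simp add: inverse_eq_divide)
      then have "(\<lambda>j. p + (1 / real (Suc j)) *\<^sub>R x) \<longlonglongrightarrow> p + 0 *\<^sub>R x"
        by (intro tendsto_intros)
      then have "(\<lambda>j. p + (1 / real (Suc j)) *\<^sub>R x) \<longlonglongrightarrow> p" by simp
      moreover have "isCont h p" using h by (simp add: continuous_on_eq_continuous_at)
      ultimately show ?thesis by (rule isCont_tendsto_compose[rotated])
    qed
  qed (use M in auto)
  then show ?thesis by (simp add: mollify_eq[OF hm] gauss_integral)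
qed

lemma mollify_symmetric:
  fixes f \<phi> :: "'a::euclidean_space \<Rightarrow> real"
  assumes f: "integrable lborel f" and \<phi>: "integrable lborel \<phi>"
  shows "(LINT p|lborel. \<phi> p * mollify f s p) = (LINT x|lborel. f x * mollify \<phi> s x)"
proof -
  have "integrable (lborel \<Otimes>\<^sub>M lborel) (\<lambda>(p, x). gauss ((x - p) /\<^sub>R s) * \<phi> p * f x)"
    by (rule integrable_pair_mult[OF \<phi> f, where C=1]) (use gauss_bounds in auto)
  note fubini = lborel_pair.Fubini_integral[OF this]
  have left: "(LINT x|lborel. gauss ((x - p) /\<^sub>R s) * \<phi> p * f x) = \<phi> p * (LINT x|lborel. f x * gauss ((x - p) /\<^sub>R s))" for p
    by (simp add: mult_ac flip: integral_mult_right_zero)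
  have right: "(LINT p|lborel. gauss ((x - p) /\<^sub>R s) * \<phi> p * f x) = f x * (LINT p|lborel. \<phi> p * gauss ((p - x) /\<^sub>R s))" for x
  proof -
    have "gauss ((x - p) /\<^sub>R s) = gauss ((p - x) /\<^sub>R s)" for p
      using gauss_minus[of "(p - x) /\<^sub>R s"] by (simp add: scaleR_minus_right[symmetric] del: gauss_minus)
    then show ?thesis by (simp add: mult_ac flip: integral_mult_right_zero)
  qed
  show ?thesis using fubini unfolding left right by (simp add: mollify_def)
qed

lemma osc_even: "osc m 0 (- z) = osc m 0 z"
  by (simp add: osc_def)

text \<open>The kernel is even, so the filter can be shifted from \<open>f\<close> to a second
  function; a Gaussian there makes its convergence explicit.\<close>

lemma lowpass_symmetric:
  fixes f g :: "real ^ 'n::finite \<Rightarrow> real"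
  assumes f: "integrable lborel f" and g: "integrable lborel g"
  shows "(LINT x|lborel. lowpass f j x * g x) = (LINT y|lborel. f y * lowpass g j y)"
proof -
  obtain C where C: "\<And>t z. norm (osc (cutoff :: real ^ 'n \<Rightarrow> real) t z) \<le> C"
    by (rule osc_bounds[OF multiplier_cutoff]) blast
  note [measurable] = osc_measurable[OF multiplier_cutoff]
  have "integrable (lborel \<Otimes>\<^sub>M lborel) (\<lambda>(x, y). osc cutoff 0 ((2 ^ j) *\<^sub>R (y - x)) * g x * f y)"
    by (rule integrable_pair_mult[OF g f, where C=C]) (use C[unfolded real_norm_def] in auto)
  from lborel_pair.Fubini_integral[OF this]
  have "(LINT y|lborel. LINT x|lborel. osc cutoff 0 ((2 ^ j) *\<^sub>R (y - x)) * g x * f y)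
      = (LINT x|lborel. LINT y|lborel. osc cutoff 0 ((2 ^ j) *\<^sub>R (y - x)) * g x * f y)" .
  moreover have "(LINT y|lborel. osc cutoff 0 ((2 ^ j) *\<^sub>R (y - x)) * g x * f y)
      = (LINT y|lborel. osc cutoff 0 ((2 ^ j) *\<^sub>R (y - x)) * f y) * g x" for x
    by (simp add: mult_ac flip: integral_mult_right_zero)
  moreover have "(LINT x|lborel. osc cutoff 0 ((2 ^ j) *\<^sub>R (y - x)) * g x * f y)
      = f y * (LINT x|lborel. osc cutoff 0 ((2 ^ j) *\<^sub>R (x - y)) * g x)" for y
  proof -
    have "osc cutoff 0 ((2 ^ j) *\<^sub>R (y - x)) = osc (cutoff :: real ^ 'n \<Rightarrow> real) 0 ((2 ^ j) *\<^sub>R (x - y))" for x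
      using osc_even[of cutoff "(2 ^ j) *\<^sub>R (x - y)"] by (simp only: scaleR_minus_right[symmetric] minus_diff_eq)
    then show ?thesis by (simp add: mult_ac flip: integral_mult_right_zero)
  qed
  ultimately have eq: "(LINT y|lborel. f y * (LINT x|lborel. osc cutoff 0 ((2 ^ j) *\<^sub>R (x - y)) * g x))
      = (LINT x|lborel. (LINT y|lborel. osc cutoff 0 ((2 ^ j) *\<^sub>R (y - x)) * f y) * g x)"
    by (simp only:)
  have "(LINT x|lborel. lowpass f j x * g x)
      = (2 ^ j) ^ CARD('n) * (LINT x|lborel. (LINT y|lborel. osc cutoff 0 ((2 ^ j) *\<^sub>R (y - x)) * f y) * g x)"
    unfolding lowpass_def mult.assoc by (rule integral_mult_right_zero)
  moreover have "f y * lowpass g j y = (2 ^ j) ^ CARD('n) * (f y * (LINT x|lborel. osc cutoff 0 ((2 ^ j) *\<^sub>R (x - y)) * g x))" for y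
    unfolding lowpass_def by (rule mult.left_commute)
  ultimately show ?thesis unfolding eq[symmetric] by (simp only: integral_mult_right_zero)
qed

lemma ft_gauss:
  fixes p :: "real ^ 'n::finite"
  assumes s: "s > 0"
  shows "ft (\<lambda>x. gauss ((x - p) /\<^sub>R s)) \<xi> t = s ^ CARD('n) * gauss_mass TYPE(real ^ 'n) * gauss (s *\<^sub>R \<xi>) * cos (\<xi> \<bullet> p + t)"
proof -
  have m: "(\<lambda>x. cos (\<xi> \<bullet> x + t)) \<in> borel_measurable (borel :: (real ^ 'n) measure)" by measurable
  have "ft (\<lambda>x. gauss ((x - p) /\<^sub>R s)) \<xi> t = s ^ CARD('n) * mollify (\<lambda>x. cos (\<xi> \<bullet> x + t)) s p"
    using s by (simp add: ft_def mollify_def)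
  also have "mollify (\<lambda>x. cos (\<xi> \<bullet> x + t)) s p = (LINT x|lborel. cos ((s *\<^sub>R \<xi>) \<bullet> x + (\<xi> \<bullet> p + t)) * gauss x)"
    unfolding mollify_eq[OF m s] by (simp add: inner_add_right add_ac)
  also have "\<dots> = gauss_mass TYPE(real ^ 'n) * gauss (s *\<^sub>R \<xi>) * cos (\<xi> \<bullet> p + t)"
    by (rule gauss_cos)
  finally show ?thesis by simp
qed

text \<open>After rescaling, the filter becomes the integral of cutoff (2^{-j} \<xi>) against a
  fixed Gaussian oscillation. The cutoff tends to 1 under a Gaussian bound, and the remaining
  integral is a Gaussian transform again: this is Fourier inversion for a Gaussian, with one
  \<open>gauss_mass\<close> from each transform.\<close>

lemma lowpass_gauss:
  fixes p :: "real ^ 'n::finite"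
  assumes s: "s > 0"
  defines "G \<equiv> \<lambda>x. gauss ((x - p) /\<^sub>R s)"
  shows "(\<lambda>j. lowpass G j y) \<longlonglongrightarrow> (gauss_mass TYPE(real ^ 'n))\<^sup>2 * G y"
    and "\<exists>M. \<forall>j y. \<bar>lowpass G j y\<bar> \<le> M"
    and "integrable lborel G"
proof -
  let ?m = "gauss_mass TYPE(real ^ 'n)"
  let ?n = "CARD('n)"
  have Gm[measurable]: "G \<in> borel_measurable borel" unfolding G_def by measurable
  have scale: "integrable lborel (\<lambda>x. gauss (s *\<^sub>R x :: real ^ 'n))" if "s > 0" for s
  proof -
    show ?thesis by (rule lborel_integrable_scale) (use that gauss_integrable in auto)
  qed
  show GI: "integrable lborel G"
  proof -
    have "integrable (distr lborel borel ((+) (- p))) (\<lambda>x. gauss (inverse s *\<^sub>R x :: real ^ 'n))"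
      using scale[of "inverse s"] s by (simp add: lborel_distr_plus)
    then have "integrable lborel (\<lambda>x. gauss (inverse s *\<^sub>R (- p + x)))"
      by (subst (asm) integrable_distr_eq) auto
    then show ?thesis by (simp add: G_def)
  qed
  have cm[measurable]: "cutoff \<in> borel_measurable (borel :: (real ^ 'n) measure)"
    by (rule borel_measurable_continuous_onI[OF multiplier_continuous[OF multiplier_cutoff]])
  define H where "H y \<xi> = s ^ ?n * ?m * gauss (s *\<^sub>R \<xi>) * cos (\<xi> \<bullet> p - \<xi> \<bullet> y)" for y \<xi> :: "real ^ 'n"
  have [measurable]: "H y \<in> borel_measurable borel" for y unfolding H_def by measurable
  have eq: "lowpass G j y = (LINT \<xi>|lborel. cutoff ((1 / 2 ^ j) *\<^sub>R \<xi>) * H y \<xi>)" for j y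
  proof -
    have "(LINT \<xi>|lborel. cutoff ((1 / 2 ^ j) *\<^sub>R \<xi>) * H y \<xi>)
        = \<bar>2 ^ j\<bar> ^ DIM(real ^ 'n) *\<^sub>R (LINT \<xi>|lborel. cutoff ((1 / 2 ^ j) *\<^sub>R ((2 ^ j) *\<^sub>R \<xi>)) * H y ((2 ^ j) *\<^sub>R \<xi>))"
      by (rule lborel_integral_scale[OF borel_measurable_times[OF measurable_compose[OF _ cm]]]) simp_all
    also have "\<dots> = (2 ^ j) ^ ?n * (LINT \<xi>|lborel. cutoff \<xi> * ft G ((2 ^ j) *\<^sub>R \<xi>) (- (2 ^ j) * (\<xi> \<bullet> y)))"
      unfolding G_def ft_gauss[OF s] by (simp add: H_def)
    finally show ?thesis unfolding lowpass_eq[OF GI] by simp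
  qed
  have Hb: "\<bar>H y \<xi>\<bar> \<le> s ^ ?n * ?m * gauss (s *\<^sub>R \<xi>)" for y \<xi>
  proof -
    have "\<bar>H y \<xi>\<bar> = s ^ ?n * ?m * gauss (s *\<^sub>R \<xi>) * \<bar>cos (\<xi> \<bullet> p - \<xi> \<bullet> y)\<bar>"
      unfolding H_def abs_mult using s gauss_bounds gauss_mass_pos[where 'a="real ^ 'n"] by simp
    also have "\<dots> \<le> s ^ ?n * ?m * gauss (s *\<^sub>R \<xi>) * 1"
    proof (rule mult_left_mono[OF abs_cos_le_one])
      show "0 \<le> s ^ ?n * ?m * gauss (s *\<^sub>R \<xi>)"
        using s by (intro mult_nonneg_nonneg gauss_bounds less_imp_le[OF gauss_mass_pos]) auto
    qed
    finally show ?thesis by simp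
  qed
  have dom: "integrable lborel (\<lambda>\<xi>. s ^ ?n * ?m * gauss (s *\<^sub>R \<xi> :: real ^ 'n))"
    using scale[OF s] by simp
  have c01: "0 \<le> cutoff z" "cutoff z \<le> 1" for z :: "real ^ 'n" by (auto simp: cutoff_def)
  have cH: "\<bar>cutoff z * H y \<xi>\<bar> \<le> s ^ ?n * ?m * gauss (s *\<^sub>R \<xi>)" for z y \<xi> :: "real ^ 'n"
  proof -
    have "\<bar>cutoff z * H y \<xi>\<bar> \<le> 1 * \<bar>H y \<xi>\<bar>"
      unfolding abs_mult using c01[of z] by (intro mult_right_mono) auto
    then show ?thesis using Hb[of y \<xi>] by linarith
  qed
  have "(\<lambda>j. LINT \<xi>|lborel. cutoff ((1 / 2 ^ j) *\<^sub>R \<xi>) * H y \<xi>) \<longlonglongrightarrow> (LINT \<xi>|lborel. H y \<xi>)"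
  proof (rule integral_dominated_convergence[OF _ _ dom])
    show "AE \<xi> in lborel. (\<lambda>j. cutoff ((1 / 2 ^ j) *\<^sub>R \<xi>) * H y \<xi>) \<longlonglongrightarrow> H y \<xi>"
    proof (rule AE_I2)
      fix \<xi> :: "real ^ 'n"
      have "(\<lambda>j. norm \<xi> * (1 / 2) ^ j) \<longlonglongrightarrow> norm \<xi> * 0"
        by (intro tendsto_mult tendsto_const LIMSEQ_realpow_zero) auto
      then have "(\<lambda>j. norm ((1 / 2 ^ j) *\<^sub>R \<xi>)) \<longlonglongrightarrow> 0" by (simp add: power_one_over)
      then have "(\<lambda>j. cutoff ((1 / 2 ^ j) *\<^sub>R \<xi>)) \<longlonglongrightarrow> max 0 (min 1 (2 - 0))"
        unfolding cutoff_def by (intro tendsto_intros)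
      then have "(\<lambda>j. cutoff ((1 / 2 ^ j) *\<^sub>R \<xi>) * H y \<xi>) \<longlonglongrightarrow> max 0 (min 1 (2 - 0)) * H y \<xi>"
        by (intro tendsto_mult tendsto_const)
      then show "(\<lambda>j. cutoff ((1 / 2 ^ j) *\<^sub>R \<xi>) * H y \<xi>) \<longlonglongrightarrow> H y \<xi>" by simp
    qed
    show "AE \<xi> in lborel. norm (cutoff ((1 / 2 ^ j) *\<^sub>R \<xi>) * H y \<xi>) \<le> s ^ ?n * ?m * gauss (s *\<^sub>R \<xi>)" for j
      using cH by auto
  qed measurable
  moreover have "(LINT \<xi>|lborel. H y \<xi>) = ?m\<^sup>2 * G y"
  proof -
    have "(LINT \<xi>|lborel. H y \<xi>) = \<bar>1 / s\<bar> ^ DIM(real ^ 'n) *\<^sub>R (LINT \<xi>|lborel. H y ((1 / s) *\<^sub>R \<xi>))"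
      by (rule lborel_integral_scale) (measurable, use s in simp)
    also have "\<dots> = ?m * (LINT \<xi>|lborel. cos (((p - y) /\<^sub>R s) \<bullet> \<xi> + 0) * gauss \<xi>)"
    proof -
      have "H y ((1 / s) *\<^sub>R \<xi>) = s ^ ?n * ?m * (cos (((p - y) /\<^sub>R s) \<bullet> \<xi> + 0) * gauss \<xi>)" for \<xi>
        using s by (simp add: H_def inner_diff_right inner_commute[of _ \<xi>] field_simps)
      then show ?thesis using s by (simp add: power_one_over)
    qed
    also have "\<dots> = ?m * (?m * gauss ((p - y) /\<^sub>R s))" unfolding gauss_cos by simp
    also have "gauss ((p - y) /\<^sub>R s) = G y"
      unfolding G_def using gauss_minus[of "(y - p) /\<^sub>R s"] by (simp add: scaleR_minus_right[symmetric] del: gauss_minus)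
    finally show ?thesis by (simp add: power2_eq_square)
  qed
  ultimately show "(\<lambda>j. lowpass G j y) \<longlonglongrightarrow> ?m\<^sup>2 * G y" unfolding eq by simp
  have "\<bar>lowpass G j y\<bar> \<le> (LINT \<xi>|lborel. s ^ ?n * ?m * gauss (s *\<^sub>R \<xi> :: real ^ 'n))" for j y
  proof -
    have i: "integrable lborel (\<lambda>\<xi>. cutoff ((1 / 2 ^ j) *\<^sub>R \<xi>) * H y \<xi>)"
    proof (rule Bochner_Integration.integrable_bound[OF dom])
      show "AE \<xi> in lborel. norm (cutoff ((1 / 2 ^ j) *\<^sub>R \<xi>) * H y \<xi>) \<le> norm (s ^ ?n * ?m * gauss (s *\<^sub>R \<xi>))"
        unfolding real_norm_def by (rule AE_I2, rule order_trans[OF cH abs_ge_self])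
    qed measurable
    have "\<bar>lowpass G j y\<bar> \<le> (LINT \<xi>|lborel. \<bar>cutoff ((1 / 2 ^ j) *\<^sub>R \<xi>) * H y \<xi>\<bar>)"
      unfolding eq by (rule integral_abs_bound)
    also have "\<dots> \<le> (LINT \<xi>|lborel. s ^ ?n * ?m * gauss (s *\<^sub>R \<xi> :: real ^ 'n))"
      by (rule integral_mono[OF integrable_abs[OF i] dom cH])
    finally show ?thesis .
  qed
  then show "\<exists>M. \<forall>j y. \<bar>lowpass G j y\<bar> \<le> M" by blast
qed

section \<open>A single filter: stability, continuity and decay\<close>

lemma osc_cutoff_bounds:
  obtains C where "C \<ge> 0" "\<And>z. \<bar>osc (cutoff :: real ^ 'n::finite \<Rightarrow> real) 0 z\<bar> \<le> C"
    "\<And>z. \<bar>osc (cutoff :: real ^ 'n::finite \<Rightarrow> real) 0 z\<bar> * norm z \<le> C"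
proof -
  obtain C where "C \<ge> 0" "\<And>t z. norm (osc (cutoff :: real ^ 'n \<Rightarrow> real) t z) \<le> C"
    "\<And>t z. norm (osc (cutoff :: real ^ 'n \<Rightarrow> real) t z) * norm z \<le> C"
    by (rule osc_bounds[OF multiplier_cutoff]) blast
  then show ?thesis using that[of C] by simp
qed

text \<open>The kernel of one filter is bounded, so L^1 convergence becomes uniform convergence
  after filtering. The bound \<open>D\<close> depends on \<open>j\<close>, hence it is applied at
  one fixed scale.\<close>

lemma lowpass_diff_bound:
  obtains D where "\<And>f g x. integrable lborel f \<Longrightarrow> integrable lborel g \<Longrightarrow>
    \<bar>lowpass f j x - lowpass g j (x :: real ^ 'n::finite)\<bar> \<le> D * (LINT y|lborel. \<bar>f y - g y\<bar>)"
proof -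
  obtain C where C: "C \<ge> 0" "\<And>z. \<bar>osc (cutoff :: real ^ 'n \<Rightarrow> real) 0 z\<bar> \<le> C"
    by (rule osc_cutoff_bounds) blast
  note [measurable] = osc_measurable[OF multiplier_cutoff]
  let ?K = "\<lambda>x y. osc (cutoff :: real ^ 'n \<Rightarrow> real) 0 ((2 ^ j) *\<^sub>R (y - x))"
  show ?thesis
  proof (rule that)
    fix f g :: "real ^ 'n \<Rightarrow> real" and x :: "real ^ 'n" assume f: "integrable lborel f" and g: "integrable lborel g"
    have Km: "?K x \<in> borel_measurable borel" by measurable
    have i: "integrable lborel (\<lambda>y. ?K x y * h y)" if "integrable lborel h" for h
      using integrable_bounded_mult[OF that Km, of C] C(2) by simp
    have fg: "integrable lborel (\<lambda>y. f y - g y)" using f g by simp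
    have "lowpass f j x - lowpass g j x = (2 ^ j) ^ CARD('n) * (LINT y|lborel. ?K x y * (f y - g y))"
      unfolding lowpass_def right_diff_distrib[symmetric]
      by (subst Bochner_Integration.integral_diff[OF i[OF f] i[OF g], symmetric]) (simp only: right_diff_distrib)
    then have "\<bar>lowpass f j x - lowpass g j x\<bar> = (2 ^ j) ^ CARD('n) * \<bar>LINT y|lborel. ?K x y * (f y - g y)\<bar>"
      by (simp add: abs_mult)
    also have "\<dots> \<le> (2 ^ j) ^ CARD('n) * (LINT y|lborel. C * \<bar>f y - g y\<bar>)"
    proof (rule mult_left_mono)
      have "\<bar>LINT y|lborel. ?K x y * (f y - g y)\<bar> \<le> (LINT y|lborel. \<bar>?K x y * (f y - g y)\<bar>)"
        by (rule integral_abs_bound)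
      also have "\<dots> \<le> (LINT y|lborel. C * \<bar>f y - g y\<bar>)"
        by (rule integral_mono[OF integrable_abs[OF i[OF fg]] integrable_mult_right[OF integrable_abs[OF fg]]])
           (use C in \<open>auto simp: abs_mult intro!: mult_right_mono\<close>)
      finally show "\<bar>LINT y|lborel. ?K x y * (f y - g y)\<bar> \<le> (LINT y|lborel. C * \<bar>f y - g y\<bar>)" .
    qed simp
    finally show "\<bar>lowpass f j x - lowpass g j x\<bar> \<le> ((2 ^ j) ^ CARD('n) * C) * (LINT y|lborel. \<bar>f y - g y\<bar>)"
      by (simp add: mult.assoc)
  qed
qed

lemma lowpass_zero: "lowpass (\<lambda>_. 0) j x = 0"
  by (simp add: lowpass_def)

text \<open>Dominated convergence in the kernel. It covers continuity, with X i tending to a point,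
  and decay at infinity, with norm (X i) tending to infinity and limit kernel 0.\<close>

lemma lowpass_limit:
  fixes f :: "real ^ 'n::finite \<Rightarrow> real"
  assumes f: "integrable lborel f"
    and lim: "\<And>y. (\<lambda>i. osc (cutoff :: real ^ 'n \<Rightarrow> real) 0 ((2 ^ j) *\<^sub>R (y - X i))) \<longlonglongrightarrow> k y"
    and k: "k \<in> borel_measurable borel"
  shows "(\<lambda>i. lowpass f j (X i)) \<longlonglongrightarrow> (2 ^ j) ^ CARD('n) * (LINT y|lborel. k y * f y)"
proof -
  obtain C where C: "\<And>z. \<bar>osc (cutoff :: real ^ 'n \<Rightarrow> real) 0 z\<bar> \<le> C"
    by (rule osc_cutoff_bounds) blast
  note [measurable] = osc_measurable[OF multiplier_cutoff]
  have "(\<lambda>i. LINT y|lborel. osc (cutoff :: real ^ 'n \<Rightarrow> real) 0 ((2 ^ j) *\<^sub>R (y - X i)) *\<^sub>R f y) \<longlonglongrightarrow> (LINT y|lborel. k y *\<^sub>R f y)"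
  proof (rule cos_integral_dct[OF f, where C=C])
    show "(\<lambda>y. osc (cutoff :: real ^ 'n \<Rightarrow> real) 0 ((2 ^ j) *\<^sub>R (y - X i))) \<in> borel_measurable borel" for i by measurable
  qed (rule k C lim)+
  then show ?thesis unfolding lowpass_def by (intro tendsto_mult tendsto_const) simp
qed

lemma lowpass_continuous:
  assumes f: "integrable lborel f"
  shows "continuous_on UNIV (lowpass f j)"
proof (rule continuous_at_imp_continuous_on, rule ballI, rule continuous_at_sequentiallyI)
  fix x :: "real ^ 'a" and X assume X: "X \<longlonglongrightarrow> x"
  note [measurable] = osc_measurable[OF multiplier_cutoff]
  have "(\<lambda>i. lowpass f j (X i)) \<longlonglongrightarrow> (2 ^ j) ^ CARD('a) * (LINT y|lborel. osc cutoff 0 ((2 ^ j) *\<^sub>R (y - x)) * f y)"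
  proof (rule lowpass_limit[OF f])
    have "continuous_on UNIV (osc (cutoff :: real ^ 'a \<Rightarrow> real) 0)"
      by (rule osc_continuous[OF multiplier_cutoff])
    then have "isCont (osc (cutoff :: real ^ 'a \<Rightarrow> real) 0) z" for z
      by (simp add: continuous_on_eq_continuous_at)
    then show "(\<lambda>i. osc (cutoff :: real ^ 'a \<Rightarrow> real) 0 ((2 ^ j) *\<^sub>R (y - X i))) \<longlonglongrightarrow> osc cutoff 0 ((2 ^ j) *\<^sub>R (y - x))" for y
      by (rule isCont_tendsto_compose) (intro tendsto_intros X)
  qed measurable
  then show "(\<lambda>i. lowpass f j (X i)) \<longlonglongrightarrow> lowpass f j x" by (simp add: lowpass_def)
qed

lemma lowpass_at_infinity:
  fixes f :: "real ^ 'n::finite \<Rightarrow> real"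
  assumes f: "integrable lborel f"
  shows "(lowpass f j \<longlongrightarrow> 0) at_infinity"
  unfolding Lim_at_infinity
proof (rule ccontr)
  assume "\<not> (\<forall>e>0. \<exists>b. \<forall>x. b \<le> norm x \<longrightarrow> dist (lowpass f j x) 0 < e)"
  then obtain e where e: "e > 0" "\<And>b. \<exists>x. b \<le> norm x \<and> \<not> dist (lowpass f j x) 0 < e" by blast
  then have "\<exists>x. real i \<le> norm x \<and> \<not> dist (lowpass f j x) 0 < e" for i :: nat by blast
  then obtain X where X: "\<And>i. real i \<le> norm (X i)" "\<And>i. \<not> dist (lowpass f j (X i)) 0 < e" by metis
  obtain C where C: "C \<ge> 0" "\<And>z. \<bar>osc (cutoff :: real ^ 'n \<Rightarrow> real) 0 z\<bar> * norm z \<le> C"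
    by (rule osc_cutoff_bounds) blast
  have "(\<lambda>i. lowpass f j (X i)) \<longlonglongrightarrow> (2 ^ j) ^ CARD('n) * (LINT y|lborel. 0 * f y)"
  proof (rule lowpass_limit[OF f])
    fix y :: "real ^ 'n"
    have "filterlim (\<lambda>i. real i - norm y) at_top sequentially"
      using filterlim_tendsto_add_at_top[OF tendsto_const[of "- norm y"] filterlim_real_sequentially] by simp
    then have inv: "(\<lambda>i. C * inverse (real i - norm y)) \<longlonglongrightarrow> C * 0"
      by (intro tendsto_mult tendsto_const tendsto_inverse_0_at_top)
    have "\<forall>\<^sub>F i in sequentially. norm (osc (cutoff :: real ^ 'n \<Rightarrow> real) 0 ((2 ^ j) *\<^sub>R (y - X i))) \<le> C * inverse (real i - norm y)"
    proof -
      obtain i0 :: nat where i0: "norm y < real i0" using reals_Archimedean2 by blast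
      show ?thesis
        using eventually_ge_at_top[of i0]
      proof eventually_elim
        case (elim i)
        let ?z = "(2 ^ j) *\<^sub>R (y - X i)"
        have pos: "real i - norm y > 0" using i0 elim by linarith
        have "norm (X i) \<le> norm (y - X i) + norm y" by (metis norm_minus_commute norm_triangle_sub add.commute)
        then have "real i - norm y \<le> 1 * norm (y - X i)" using X(1)[of i] by simp
        also have "\<dots> \<le> 2 ^ j * norm (y - X i)" by (intro mult_right_mono) auto
        finally have z: "real i - norm y \<le> norm ?z" by simp
        have "\<bar>osc (cutoff :: real ^ 'n \<Rightarrow> real) 0 ?z\<bar> * (real i - norm y) \<le> \<bar>osc (cutoff :: real ^ 'n \<Rightarrow> real) 0 ?z\<bar> * norm ?z"
          by (rule mult_left_mono[OF z]) simp
        also have "\<dots> \<le> C" by (rule C(2))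
        finally show ?case using pos by (simp add: pos_le_divide_eq divide_inverse[symmetric])
      qed
    qed
    from Lim_null_comparison[OF this] inv
    show "(\<lambda>i. osc (cutoff :: real ^ 'n \<Rightarrow> real) 0 ((2 ^ j) *\<^sub>R (y - X i))) \<longlonglongrightarrow> 0" by simp
  qed simp
  then have "(\<lambda>i. lowpass f j (X i)) \<longlonglongrightarrow> 0" by simp
  from tendstoD[OF this e(1)] have "\<forall>\<^sub>F i in sequentially. False" using X(2) by simp
  then show False by simp
qed

section \<open>Identification of the uniform limit\<close>

lemma continuous_imp_locally_integrable:
  fixes w :: "real ^ 'n::finite \<Rightarrow> real"
  assumes "continuous_on UNIV w"
  shows "locally_integrable w"
  unfolding locally_integrable_def
proof (intro allI impI)
  fix K :: "(real ^ 'n) set" assume K: "compact K"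
  have "set_integrable lborel K w"
    unfolding set_integrable_def
    by (rule borel_integrable_compact[OF K continuous_on_subset[OF assms]]) simp
  then show "set_integrable lebesgue K w"
    unfolding set_integrable_def by (subst integrable_completion) auto
qed

lemma mollify_measurable:
  fixes h :: "'a::euclidean_space \<Rightarrow> real"
  assumes [measurable]: "h \<in> borel_measurable borel"
  shows "mollify h s \<in> borel_measurable borel"
proof -
  have "(\<lambda>p. LINT x|lborel. h x * gauss ((x - p) /\<^sub>R s)) \<in> borel_measurable borel"
    by (rule sigma_finite_measure.borel_measurable_lebesgue_integral[OF lborel.sigma_finite_measure_axioms]) measurable
  then show ?thesis by (simp add: mollify_def[abs_def])
qed

text \<open>Moved onto a Gaussian, the filter converges to (2 pi)^n times that Gaussian, so Gaussian
  averages of \<open>w\<close> are (2 pi)^n times those of \<open>f\<close>. The averaging is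
  symmetric too and can be moved onto a test function; letting its width tend to 0 removes
  it.\<close>

lemma lowpass_uniform_limit_AE:
  fixes f w :: "real ^ 'n::finite \<Rightarrow> real"
  assumes f: "integrable lborel f" and w: "uniform_limit UNIV (lowpass f) w sequentially"
    and cont: "continuous_on UNIV w"
  shows "AE x in lebesgue. w x = (gauss_mass TYPE(real ^ 'n))\<^sup>2 * f x"
proof -
  let ?m = "gauss_mass TYPE(real ^ 'n)"
  have wm[measurable]: "w \<in> borel_measurable borel" by (rule borel_measurable_continuous_onI[OF cont])
  have lm: "lowpass g j \<in> borel_measurable borel" if "integrable lborel g" for g :: "real ^ 'n \<Rightarrow> real" and j
    by (rule borel_measurable_continuous_onI[OF lowpass_continuous[OF that]])
  obtain J where J: "\<And>j x. j \<ge> J \<Longrightarrow> dist (lowpass f j x) (w x) < 1"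
    using uniform_limitD[OF w zero_less_one] by (auto simp: eventually_sequentially)
  obtain D where D: "\<And>f g x. integrable lborel f \<Longrightarrow> integrable lborel g \<Longrightarrow>
      \<bar>lowpass f J x - lowpass g J (x :: real ^ 'n)\<bar> \<le> D * (LINT y|lborel. \<bar>f y - g y\<bar>)"
    by (rule lowpass_diff_bound) blast
  \<comment> \<open>Level \<open>J\<close> is bounded by the L^1 norm of \<open>f\<close>;
    \<open>w\<close> is within 1 of level \<open>J\<close>, and all later levels are within 1 of
    \<open>w\<close>, which accounts for the 2.\<close>
  define M where "M = D * (LINT y|lborel. \<bar>f y\<bar>) + 2"
  have wM1: "\<bar>w x\<bar> \<le> M - 1" for x
    using D[OF f, of "\<lambda>_. 0" x] J[of J x] by (simp add: lowpass_zero M_def dist_real_def)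
  then have wM: "\<bar>w x\<bar> \<le> M" for x using wM1[of x] by linarith
  have lim: "(\<lambda>j. lowpass f j x) \<longlonglongrightarrow> w x" for x
    using tendsto_uniform_limitI[OF w] by simp
  have moll: "mollify w s p = ?m\<^sup>2 * mollify f s p" if s: "s > 0" for s p
  proof -
    define G where "G = (\<lambda>x. gauss ((x - p) /\<^sub>R s))"
    have G: "(\<lambda>j. lowpass G j y) \<longlonglongrightarrow> ?m\<^sup>2 * G y" "\<exists>M. \<forall>j y. \<bar>lowpass G j y\<bar> \<le> M" "integrable lborel G" for y
      using lowpass_gauss[OF s, of p] by (simp_all add: G_def)
    obtain N where N: "\<And>j y. \<bar>lowpass G j y\<bar> \<le> N" using G(2) by blast
    have Gm: "G \<in> borel_measurable borel" using G(3) by auto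
    have "(\<lambda>j. LINT y|lborel. lowpass G j y *\<^sub>R f y) \<longlonglongrightarrow> (LINT y|lborel. (?m\<^sup>2 * G y) *\<^sub>R f y)"
      by (rule cos_integral_dct[OF f lm[OF G(3)] _ N G(1)]) (use Gm in measurable)
    moreover have "(LINT y|lborel. lowpass G j y *\<^sub>R f y) = (LINT x|lborel. lowpass f j x * G x)" for j
      using lowpass_symmetric[OF f G(3), of j] by (simp add: mult.commute)
    ultimately have 1: "(\<lambda>j. LINT x|lborel. lowpass f j x * G x) \<longlonglongrightarrow> (LINT y|lborel. (?m\<^sup>2 * G y) *\<^sub>R f y)" by simp
    \<comment> \<open>Shifted by \<open>J\<close> because the uniform bound \<open>M\<close> is
      available from that level on.\<close>
    have "(\<lambda>j. LINT x|lborel. lowpass f (j + J) x *\<^sub>R G x) \<longlonglongrightarrow> (LINT x|lborel. w x *\<^sub>R G x)"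
    proof (rule cos_integral_dct[OF G(3) lm[OF f] wm, where C=M])
      show "\<bar>lowpass f (j + J) x\<bar> \<le> M" for j x
        using J[of "j + J" x] wM1[of x] by (simp add: dist_real_def)
      show "(\<lambda>j. lowpass f (j + J) x) \<longlonglongrightarrow> w x" for x
        by (rule LIMSEQ_ignore_initial_segment[OF lim])
    qed
    then have "(\<lambda>j. LINT x|lborel. lowpass f j x * G x) \<longlonglongrightarrow> (LINT x|lborel. w x * G x)"
      using LIMSEQ_offset[of "\<lambda>j. LINT x|lborel. lowpass f j x * G x" J] by simp
    from LIMSEQ_unique[OF this 1] have "(LINT x|lborel. w x * G x) = (LINT y|lborel. ?m\<^sup>2 * (f y * G y))"
      by (simp add: mult_ac)
    then have "(LINT x|lborel. w x * G x) = ?m\<^sup>2 * (LINT y|lborel. f y * G y)" by simp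
    then show ?thesis by (simp add: mollify_def G_def)
  qed
  have "(LINT x|lebesgue. \<phi> x *\<^sub>R w x) = (LINT x|lebesgue. \<phi> x *\<^sub>R (?m\<^sup>2 * f x))" if \<phi>: "\<phi> \<in> test_functions" for \<phi> :: "real ^ 'n \<Rightarrow> real"
  proof -
    obtain C R where CR: "\<And>x. \<bar>\<phi> x\<bar> \<le> C" "\<And>x. norm x > R \<Longrightarrow> \<phi> x = 0"
      using test_function_bounded[OF \<phi>] by metis
    have \<phi>m[measurable]: "\<phi> \<in> borel_measurable borel"
      by (rule borel_measurable_continuous_onI[OF test_function_continuous[OF \<phi>]])
    have \<phi>i: "integrable lborel \<phi>"
      by (rule integrable_bounded_support(1)[where C=C and R=R]) (use CR in auto)
    have fm[measurable]: "f \<in> borel_measurable borel" using f by auto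
    let ?s = "\<lambda>j. 1 / real (Suc j)"
    have 1: "(\<lambda>j. LINT p|lborel. mollify w (?s j) p *\<^sub>R \<phi> p) \<longlonglongrightarrow> (LINT p|lborel. (w p * ?m) *\<^sub>R \<phi> p)"
      by (rule cos_integral_dct[OF \<phi>i mollify_measurable[OF wm] _ mollify_bound[OF wm _ wM] mollify_tendsto[OF cont wM]]) auto
    have 2: "(\<lambda>j. LINT x|lborel. mollify \<phi> (?s j) x *\<^sub>R f x) \<longlonglongrightarrow> (LINT x|lborel. (\<phi> x * ?m) *\<^sub>R f x)"
      by (rule cos_integral_dct[OF f mollify_measurable[OF \<phi>m] _ mollify_bound[OF \<phi>m _ CR(1)]
            mollify_tendsto[OF test_function_continuous[OF \<phi>] CR(1)]]) auto
    have "(LINT p|lborel. mollify w (?s j) p *\<^sub>R \<phi> p) = ?m\<^sup>2 * (LINT x|lborel. mollify \<phi> (?s j) x *\<^sub>R f x)" for j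
    proof -
      have "(LINT p|lborel. mollify w (?s j) p *\<^sub>R \<phi> p) = (LINT p|lborel. ?m\<^sup>2 * (\<phi> p * mollify f (?s j) p))"
        by (intro Bochner_Integration.integral_cong refl) (simp add: moll mult_ac)
      also have "\<dots> = ?m\<^sup>2 * (LINT x|lborel. f x * mollify \<phi> (?s j) x)"
        unfolding mollify_symmetric[OF f \<phi>i, symmetric] by simp
      finally show ?thesis by (simp add: mult.commute)
    qed
    then have "(\<lambda>j. ?m\<^sup>2 * (LINT x|lborel. mollify \<phi> (?s j) x *\<^sub>R f x)) \<longlonglongrightarrow> (LINT p|lborel. (w p * ?m) *\<^sub>R \<phi> p)"
      using 1 by simp
    from LIMSEQ_unique[OF this tendsto_mult[OF tendsto_const 2]]
    have "(LINT p|lborel. (w p * ?m) *\<^sub>R \<phi> p) = ?m\<^sup>2 * (LINT x|lborel. (\<phi> x * ?m) *\<^sub>R f x)" .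
    \<comment> \<open>Both averages contribute one further factor \<open>gauss_mass\<close> in the
      limit, and it cancels.\<close>
    then have "?m * (LINT p|lborel. \<phi> p * w p) = ?m * (LINT p|lborel. \<phi> p * (?m\<^sup>2 * f p))"
      by (simp add: mult_ac flip: integral_mult_right_zero)
    then have "(LINT p|lborel. \<phi> p * w p) = (LINT p|lborel. \<phi> p * (?m\<^sup>2 * f p))"
      using gauss_mass_pos[where 'a="real ^ 'n"] by simp
    then show ?thesis by (simp add: integral_completion)
  qed
  moreover have "locally_integrable (\<lambda>x. ?m\<^sup>2 * f x)"
  proof (rule integrable_imp_locally_integrable)
    show "integrable lebesgue (\<lambda>x. ?m\<^sup>2 * f x)" using f by (subst integrable_completion) auto
  qed
  ultimately show ?thesis
    using test_integrals_eq_imp_AE_eq[OF continuous_imp_locally_integrable[OF cont]] by blast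
qed

section \<open>Continuity\<close>

text \<open>The estimate between two scales is a uniform Cauchy condition once small balls have
  uniformly small variation, which follows from the absence of atoms. \<open>C\<close> is fixed
  before \<open>u\<close>, so the same constant holds along a sequence.\<close>

lemma continuous_limit_exists:
  fixes B :: "('n::finite \<Rightarrow> nat) \<Rightarrow> 'v::euclidean_space \<Rightarrow>\<^sub>L 'w::euclidean_space"
  assumes ell: "elliptic CARD('n) B" and can: "canceling CARD('n) B"
  obtains C where "C \<ge> 0" "\<And>u \<mu>. integrable lborel u \<Longrightarrow> is_op_measure CARD('n) B u \<mu> \<Longrightarrow>
    \<exists>w. continuous_on UNIV w \<and> (w \<longlongrightarrow> 0) at_infinity \<and>
      (AE x in lebesgue. w x = (gauss_mass TYPE(real ^ 'n))\<^sup>2 * (v \<bullet> u x)) \<and>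
      (\<forall>x r b. r > 0 \<longrightarrow> \<bar>w x - lowpass (\<lambda>y. v \<bullet> u y) b x\<bar> \<le> C * (var \<mu> (ball x r) + var \<mu> UNIV / (2 ^ b * r)))"
proof -
  let ?n = "CARD('n)"
  interpret elliptic_op ?n B by standard (rule ell)
  obtain C where C: "C \<ge> 0" "\<And>u \<mu> x r a b. integrable lborel u \<Longrightarrow> is_op_measure ?n B u \<mu> \<Longrightarrow> r > 0 \<Longrightarrow> b \<le> a \<Longrightarrow>
     \<bar>lowpass (\<lambda>y. v \<bullet> u y) a x - lowpass (\<lambda>y. v \<bullet> u y) b x\<bar> \<le> C * (var \<mu> (ball x r) + var \<mu> UNIV / (2 ^ b * r))"
    by (rule lowpass_estimate[OF ell can, of v]) blast
  show ?thesis
  proof (rule that[OF C(1)])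
    fix u \<mu> assume u: "integrable lborel u" and \<mu>: "is_op_measure ?n B u \<mu>"
    interpret vector_measure \<mu> using \<mu> by (simp add: vector_measure_def is_op_measure_def)
    define f where "f = (\<lambda>y. v \<bullet> u y)"
    have f: "integrable lborel f" using u by (simp add: f_def)
    have est: "\<bar>lowpass f a x - lowpass f b x\<bar> \<le> C * (var \<mu> (ball x r) + var \<mu> UNIV / (2 ^ b * r))"
      if "r > 0" "b \<le> a" for a b x r
      using C(2)[OF u \<mu> that] by (simp add: f_def)
    have vm: "vector_measure \<mu>" by (rule vector_measure_axioms)
    have "uniformly_Cauchy_on UNIV (lowpass f)"
      unfolding uniformly_Cauchy_on_def
    proof (intro allI impI)
      fix e :: real assume e: "e > 0"
      \<comment> \<open>One factor 2 for the ball and the far field, another for comparing both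
        levels with \<open>b\<close>; C + 1 in place of C avoids dividing by 0.\<close>
      define d where "d = e / (4 * (C + 1))"
      have d: "d > 0" using e C(1) by (simp add: d_def)
      \<comment> \<open>A constant sequence turns the statement about strict convergence into
        uniform smallness of small balls for \<mu> alone.\<close>
      obtain r where r: "r > 0" "\<forall>\<^sub>F j in sequentially. \<forall>x. var \<mu> (ball x r) \<le> d"
      proof (rule strict_convergence_uniformly_small[of "\<lambda>_. \<mu>" \<mu> d])
        show "var \<mu> {x} = 0" for x by (rule no_atoms[OF u \<mu> can])
      qed (use vm d in auto)
      then have rs: "var \<mu> (ball x r) \<le> d" for x by simp
      obtain b where b: "var \<mu> UNIV / (2 ^ b * r) < d"
      proof -
        obtain b :: nat where "var \<mu> UNIV / (r * d) < 2 ^ b" using real_arch_pow[of 2] by auto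
        then show ?thesis using that[of b] r(1) d by (simp add: field_simps)
      qed
      have half: "\<bar>lowpass f a x - lowpass f b x\<bar> < e / 2" if "a \<ge> b" for a x
      proof -
        have "\<bar>lowpass f a x - lowpass f b x\<bar> \<le> C * (var \<mu> (ball x r) + var \<mu> UNIV / (2 ^ b * r))"
          by (rule est[OF r(1) that])
        also have "\<dots> \<le> C * (d + d)" using C(1) rs b by (intro mult_left_mono add_mono) (auto intro: less_imp_le)
        also have "\<dots> < (C + 1) * (d + d)" using d by (intro mult_strict_right_mono) auto
        also have "\<dots> = e / 2"
        proof -
          have "C + 1 \<noteq> 0" using C(1) by linarith
          then have "(C + 1) * d = e / 4"
            unfolding d_def times_divide_eq_right mult.commute[of 4] by (rule mult_divide_mult_cancel_left)
          then show ?thesis by (simp add: distrib_left)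
        qed
        finally show ?thesis .
      qed
      show "\<exists>M. \<forall>x\<in>UNIV. \<forall>m\<ge>M. \<forall>n\<ge>M. dist (lowpass f m x) (lowpass f n x) < e"
      proof (intro exI[of _ b] ballI allI impI)
        fix x m n assume "b \<le> m" "b \<le> n"
        then show "dist (lowpass f m x) (lowpass f n x) < e"
          using half[of m x] half[of n x] unfolding dist_real_def by linarith
      qed
    qed
    then obtain w where w: "uniform_limit UNIV (lowpass f) w sequentially"
      using Cauchy_uniformly_convergent uniformly_convergent_on_def by blast
    have cont: "continuous_on UNIV w"
      by (rule uniform_limit_theorem[OF _ w]) (auto intro: always_eventually lowpass_continuous[OF f])
    have inf: "(w \<longlongrightarrow> 0) at_infinity"
    proof (rule tendstoI)
      fix e :: real assume e: "e > 0"
      obtain j where j: "\<And>x. dist (lowpass f j x) (w x) < e / 2"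
        using uniform_limitD[OF w, of "e / 2"] e by (auto simp: eventually_sequentially)
      have "\<forall>\<^sub>F x in at_infinity. dist (lowpass f j x) 0 < e / 2"
        by (rule tendstoD[OF lowpass_at_infinity[OF f]]) (use e in simp)
      then show "\<forall>\<^sub>F x in at_infinity. dist (w x) 0 < e"
      proof eventually_elim
        case (elim x)
        have "dist (w x) 0 \<le> dist (w x) (lowpass f j x) + dist (lowpass f j x) 0" by (rule dist_triangle)
        then show ?case using elim j[of x] by (simp add: dist_commute)
      qed
    qed
    have lim: "(\<lambda>j. lowpass f j x) \<longlonglongrightarrow> w x" for x using tendsto_uniform_limitI[OF w] by simp
    have "\<bar>w x - lowpass f b x\<bar> \<le> C * (var \<mu> (ball x r) + var \<mu> UNIV / (2 ^ b * r))" if r: "r > 0" for x r b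
    proof (rule LIMSEQ_le_const2)
      show "(\<lambda>a. \<bar>lowpass f a x - lowpass f b x\<bar>) \<longlonglongrightarrow> \<bar>w x - lowpass f b x\<bar>"
        by (intro tendsto_intros lim)
      show "\<exists>N. \<forall>a\<ge>N. \<bar>lowpass f a x - lowpass f b x\<bar> \<le> C * (var \<mu> (ball x r) + var \<mu> UNIV / (2 ^ b * r))"
        using est[OF r] by blast
    qed
    then show "\<exists>w. continuous_on UNIV w \<and> (w \<longlongrightarrow> 0) at_infinity \<and>
      (AE x in lebesgue. w x = (gauss_mass TYPE(real ^ 'n))\<^sup>2 * (v \<bullet> u x)) \<and>
      (\<forall>x r b. r > 0 \<longrightarrow> \<bar>w x - lowpass (\<lambda>y. v \<bullet> u y) b x\<bar> \<le> C * (var \<mu> (ball x r) + var \<mu> UNIV / (2 ^ b * r)))"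
      using cont inf lowpass_uniform_limit_AE[OF f w cont] unfolding f_def by blast
  qed
qed

section \<open>Borel representatives and convergence of distributions\<close>

lemma op_dist_cong_AE:
  assumes "u \<in> borel_measurable lebesgue" "u' \<in> borel_measurable lebesgue" "AE x in lebesgue. u x = u' x" "\<phi> \<in> test_functions"
    and "\<And>\<beta>. mi_deriv \<beta> \<phi> \<in> test_functions"
  shows "op_dist k B u \<phi> = op_dist k B u' \<phi>"
proof -
  have "(LINT x|lebesgue. mi_deriv \<beta> \<phi> x *\<^sub>R u x) = (LINT x|lebesgue. mi_deriv \<beta> \<phi> x *\<^sub>R u' x)" for \<beta>
  proof (rule integral_cong_AE)
    have [measurable]: "mi_deriv \<beta> \<phi> \<in> borel_measurable lebesgue"
      using borel_measurable_continuous_onI[OF test_function_continuous[OF assms(5)]]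
      by (intro measurable_completion) simp
    show "(\<lambda>x. mi_deriv \<beta> \<phi> x *\<^sub>R u x) \<in> borel_measurable lebesgue"
      "(\<lambda>x. mi_deriv \<beta> \<phi> x *\<^sub>R u' x) \<in> borel_measurable lebesgue"
      using assms(1,2) by measurable
    show "AE x in lebesgue. mi_deriv \<beta> \<phi> x *\<^sub>R u x = mi_deriv \<beta> \<phi> x *\<^sub>R u' x"
      using assms(3) by eventually_elim simp
  qed
  then show ?thesis by (simp add: op_dist_def)
qed

lemma mi_deriv_test_function:
  assumes "\<phi> \<in> test_functions"
  shows "mi_deriv \<beta> \<phi> \<in> test_functions"
proof -
  obtain R where R: "\<And>x. norm x > R \<Longrightarrow> \<phi> x = 0" using test_function_bounded[OF assms] by metis
  have "smooth (mi_deriv \<beta> \<phi>)"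
    unfolding smooth_def
  proof
    fix "is" :: "'a list"
    have "foldr pd (is @ mi_word \<beta>) \<phi> differentiable_on UNIV"
      using assms unfolding test_functions_def smooth_def by blast
    then show "foldr pd is (mi_deriv \<beta> \<phi>) differentiable_on UNIV" by (simp add: mi_deriv_word)
  qed
  moreover have "mi_deriv \<beta> \<phi> x = 0" if "norm x > R" for x
    unfolding mi_deriv_word by (rule foldr_pd_support[of R \<phi>]) (use R that in auto)
  ultimately show ?thesis
    unfolding test_functions_def using compact_supportI[of R "mi_deriv \<beta> \<phi>"] by blast
qed

text \<open>The measure is still \<open>op_measure k B u\<close> of the original function, the one
  in which strict convergence is formulated; changing \<open>u\<close> on a null set leaves the
  tested distribution unchanged.\<close>

lemma BV_representative:
  fixes B :: "('n::finite \<Rightarrow> nat) \<Rightarrow> 'v::euclidean_space \<Rightarrow>\<^sub>L 'w::euclidean_space"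
  assumes "u \<in> BV k B"
  obtains u' where "integrable lborel u'" "AE x in lebesgue. u x = u' x" "is_op_measure k B u' (op_measure k B u)"
    "integrable lebesgue u"
proof -
  have i: "integrable lebesgue u" using assms sobolev1_integrable by (auto simp: BV_def)
  obtain u' where u': "integrable lborel u'" "AE x in lebesgue. u x = u' x"
    using integrable_lebesgue_obtain_lborel[OF i] by metis
  have "\<exists>\<mu>. is_op_measure k B u \<mu>" using assms by (simp add: BV_def)
  then have op: "is_op_measure k B u (op_measure k B u)" unfolding op_measure_def by (rule someI_ex)
  have u'm: "u' \<in> borel_measurable lebesgue" using u'(1) by (intro measurable_completion) auto
  have "op_dist k B u \<phi> = op_dist k B u' \<phi>" if "\<phi> \<in> test_functions" for \<phi>
    by (rule op_dist_cong_AE[OF borel_measurable_integrable[OF i] u'm u'(2) that mi_deriv_test_function[OF that]])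
  then have "is_op_measure k B u' (op_measure k B u)" using op by (simp add: is_op_measure_def)
  then show ?thesis using that u' i by blast
qed

lemma AE_eq_continuous_imp_eq:
  fixes f g :: "'a::euclidean_space \<Rightarrow> real"
  assumes "continuous_on UNIV f" "continuous_on UNIV g" "AE x in lebesgue. f x = g x"
  shows "f x = g x"
proof -
  have "closed {x. f x = g x}" using assms(1,2) by (intro closed_Collect_eq)
  moreover have "AE x in lebesgue. x \<in> {x. f x = g x}" using assms(3) by simp
  ultimately show ?thesis using mem_closed_if_AE_lebesgue by blast
qed

text \<open>Derivatives of a test function are bounded, so L^1 convergence of the functions yields
  convergence of the measures on test functions, as lower semicontinuity requires.\<close>

lemma op_dist_tendsto:
  fixes B :: "('n::finite \<Rightarrow> nat) \<Rightarrow> 'v::euclidean_space \<Rightarrow>\<^sub>L 'w::euclidean_space"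
  assumes us: "\<And>j. integrable lborel (us j)" and u: "integrable lborel u"
    and lim: "(\<lambda>j. LINT x|lborel. norm (us j x - u x)) \<longlonglongrightarrow> 0" and \<phi>: "\<phi> \<in> test_functions"
  shows "(\<lambda>j. op_dist k B (us j) \<phi>) \<longlonglongrightarrow> op_dist k B u \<phi>"
  unfolding op_dist_def
proof (intro tendsto_sum tendsto_scaleR tendsto_const blinfun.tendsto)
  fix \<beta> :: "'n \<Rightarrow> nat"
  define \<psi> where "\<psi> = mi_deriv \<beta> \<phi>"
  have \<psi>: "\<psi> \<in> test_functions" unfolding \<psi>_def by (rule mi_deriv_test_function[OF \<phi>])
  obtain C where C: "\<And>x. \<bar>\<psi> x\<bar> \<le> C" "C \<ge> 0" using test_function_bounded[OF \<psi>] by metis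
  have m: "\<psi> \<in> borel_measurable borel"
    by (rule borel_measurable_continuous_onI[OF test_function_continuous[OF \<psi>]])
  have i: "integrable lborel (\<lambda>x. \<psi> x *\<^sub>R h x)" if "integrable lborel h" for h :: "real ^ 'n \<Rightarrow> 'v"
    by (rule integrable_bounded_mult[OF that m C(1)])
  have comp: "(LINT x|lebesgue. \<psi> x *\<^sub>R h x) = (LINT x|lborel. \<psi> x *\<^sub>R h x)" if "integrable lborel h" for h :: "real ^ 'n \<Rightarrow> 'v"
    by (rule integral_completion) (use i[OF that] in auto)
  have "(\<lambda>j. (LINT x|lborel. \<psi> x *\<^sub>R us j x) - (LINT x|lborel. \<psi> x *\<^sub>R u x)) \<longlonglongrightarrow> 0"
  proof (rule Lim_null_comparison)
    show "(\<lambda>j. C * (LINT x|lborel. norm (us j x - u x))) \<longlonglongrightarrow> 0"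
      using tendsto_mult[OF tendsto_const lim, of C] by simp
    show "\<forall>\<^sub>F j in sequentially. norm ((LINT x|lborel. \<psi> x *\<^sub>R us j x) - (LINT x|lborel. \<psi> x *\<^sub>R u x)) \<le> C * (LINT x|lborel. norm (us j x - u x))"
    proof (intro always_eventually allI)
      fix j
      have d: "integrable lborel (\<lambda>x. us j x - u x)" using us u by simp
      have "(LINT x|lborel. \<psi> x *\<^sub>R us j x) - (LINT x|lborel. \<psi> x *\<^sub>R u x) = (LINT x|lborel. \<psi> x *\<^sub>R (us j x - u x))"
        unfolding scaleR_diff_right by (rule Bochner_Integration.integral_diff[OF i[OF us] i[OF u], symmetric])
      also have "norm \<dots> \<le> (LINT x|lborel. norm (\<psi> x *\<^sub>R (us j x - u x)))" by (rule integral_norm_bound)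
      also have "\<dots> \<le> (LINT x|lborel. C * norm (us j x - u x))"
        by (rule integral_mono[OF integrable_norm[OF i[OF d]] integrable_mult_right[OF integrable_norm[OF d]]])
           (use C in \<open>auto intro!: mult_right_mono\<close>)
      finally show "norm ((LINT x|lborel. \<psi> x *\<^sub>R us j x) - (LINT x|lborel. \<psi> x *\<^sub>R u x)) \<le> C * (LINT x|lborel. norm (us j x - u x))"
        by simp
    qed
  qed
  then have "(\<lambda>j. LINT x|lborel. \<psi> x *\<^sub>R us j x) \<longlonglongrightarrow> (LINT x|lborel. \<psi> x *\<^sub>R u x)" by (rule LIM_zero_cancel)
  then show "(\<lambda>j. LINT x|lebesgue. mi_deriv \<beta> \<phi> x *\<^sub>R us j x) \<longlonglongrightarrow> (LINT x|lebesgue. mi_deriv \<beta> \<phi> x *\<^sub>R u x)"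
    unfolding \<psi>_def[symmetric] by (simp add: comp us u)
qed

section \<open>Embedding into continuous functions and strict continuity\<close>

lemma BV_subset_C0:
  fixes B :: "('n::finite \<Rightarrow> nat) \<Rightarrow> 'v::euclidean_space \<Rightarrow>\<^sub>L 'w::euclidean_space"
  assumes ell: "elliptic CARD('n) B" and can: "canceling CARD('n) B" and u: "u \<in> BV CARD('n) B"
  shows "\<exists>v\<in>C0. continuous_representative u v"
proof -
  let ?m = "(gauss_mass TYPE(real ^ 'n))\<^sup>2"
  have m: "?m > 0" using gauss_mass_pos[where 'a="real ^ 'n"] by simp
  obtain u' where u': "integrable lborel u'" "AE x in lebesgue. u x = u' x" "is_op_measure CARD('n) B u' (op_measure CARD('n) B u)"
    using BV_representative[OF u] by metis
  have "\<exists>w. continuous_on UNIV w \<and> (w \<longlongrightarrow> 0) at_infinity \<and> (AE x in lebesgue. w x = ?m * (b \<bullet> u' x))" for b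
    by (rule continuous_limit_exists[OF ell can, of b]) (use u' in blast)
  then obtain w where w: "\<And>b. continuous_on UNIV (w b)" "\<And>b. (w b \<longlongrightarrow> 0) at_infinity"
    "\<And>b. AE x in lebesgue. w b x = ?m * (b \<bullet> u' x)" by metis
  \<comment> \<open>Division by \<open>?m\<close> = (2 pi)^n makes up for the normalisation left out
    of \<open>lowpass\<close>.\<close>
  define v where "v x = (\<Sum>b\<in>Basis. (w b x / ?m) *\<^sub>R b)" for x
  have "continuous_on UNIV v"
    unfolding v_def using m w(1) by (intro continuous_intros) auto
  moreover have "(v \<longlongrightarrow> 0) at_infinity"
  proof -
    have "((\<lambda>x. \<Sum>b\<in>Basis. (w b x / ?m) *\<^sub>R b) \<longlongrightarrow> (\<Sum>b\<in>Basis. (0 / ?m) *\<^sub>R (b::'v))) at_infinity"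
      using m by (intro tendsto_sum tendsto_scaleR tendsto_divide w(2) tendsto_const) auto
    then show ?thesis by (simp add: v_def[abs_def])
  qed
  moreover have "AE x in lebesgue. u x = v x"
  proof -
    have "AE x in lebesgue. \<forall>b\<in>Basis. w b x = ?m * (b \<bullet> u' x)"
      using w(3) by (intro AE_finite_allI) auto
    with u'(2) show ?thesis
    proof eventually_elim
      case (elim x)
      have "v x = (\<Sum>b\<in>Basis. (u' x \<bullet> b) *\<^sub>R b)"
        unfolding v_def using elim m by (intro sum.cong) (auto simp: inner_commute)
      then show ?case using elim by (simp add: euclidean_representation)
    qed
  qed
  ultimately show ?thesis by (auto simp: C0_def continuous_representative_def)
qed

text \<open>Three comparisons at one fixed scale \<open>k\<close>: \<open>vs j\<close> with its
  filtered version, the filtered versions of \<open>us j\<close> and \<open>u\<close> with each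
  other, and that of \<open>u\<close> with \<open>v\<close>. The outer ones are small uniformly in
  large j, by uniform smallness on balls and bounded total variation; the middle one is small by L^1
  convergence.\<close>

lemma strict_convergence_imp_uniform_limit:
  fixes B :: "('n::finite \<Rightarrow> nat) \<Rightarrow> 'v::euclidean_space \<Rightarrow>\<^sub>L 'w::euclidean_space"
  assumes ell: "elliptic CARD('n) B" and can: "canceling CARD('n) B"
    and us: "\<And>j. us j \<in> BV CARD('n) B" and u: "u \<in> BV CARD('n) B"
    and strict: "strictly_converges CARD('n) B us u"
    and vs: "\<And>j. continuous_representative (us j) (vs j)" and v: "continuous_representative u v"
  shows "uniform_limit UNIV vs v sequentially"
proof -
  let ?n = "CARD('n)"
  let ?m = "(gauss_mass TYPE(real ^ 'n))\<^sup>2"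
  interpret elliptic_op ?n B by standard (rule ell)
  have m: "?m > 0" using gauss_mass_pos[where 'a="real ^ 'n"] by simp
  define \<mu>s where "\<mu>s j = op_measure ?n B (us j)" for j
  define \<mu> where "\<mu> = op_measure ?n B u"
  have "\<exists>u'. integrable lborel u' \<and> (AE x in lebesgue. us j x = u' x) \<and> is_op_measure ?n B u' (\<mu>s j)" for j
    using BV_representative[OF us[of j]] unfolding \<mu>s_def by metis
  then obtain us' where us': "\<And>j. integrable lborel (us' j)" "\<And>j. AE x in lebesgue. us j x = us' j x"
    "\<And>j. is_op_measure ?n B (us' j) (\<mu>s j)" by metis
  obtain u' where u': "integrable lborel u'" "AE x in lebesgue. u x = u' x" "is_op_measure ?n B u' \<mu>"
    using BV_representative[OF u] unfolding \<mu>_def by metis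
  have vms: "vector_measure (\<mu>s j)" for j using us'(3) by (simp add: vector_measure_def is_op_measure_def)
  have vm: "vector_measure \<mu>" using u'(3) by (simp add: vector_measure_def is_op_measure_def)
  interpret vector_measure \<mu> by (rule vm)
  have L1: "(\<lambda>j. LINT x|lborel. norm (us' j x - u' x)) \<longlonglongrightarrow> 0"
  proof (rule tendsto_sandwich[OF _ _ tendsto_const])
    show "(\<lambda>j. sobolev1_norm (?n - 1) (\<lambda>x. us j x - u x)) \<longlonglongrightarrow> 0"
      using strict by (simp add: strictly_converges_def)
    show "\<forall>\<^sub>F j in sequentially. (LINT x|lborel. norm (us' j x - u' x)) \<le> sobolev1_norm (?n - 1) (\<lambda>x. us j x - u x)"
    proof (intro always_eventually allI)
      fix j
      have i: "integrable lebesgue (\<lambda>x. us j x - u x)"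
        using BV_representative[OF us[of j]] BV_representative[OF u] by (metis Bochner_Integration.integrable_diff)
      have d: "(\<lambda>x. us' j x - u' x) \<in> borel_measurable lborel" using us'(1) u'(1) by measurable
      have "(LINT x|lborel. norm (us' j x - u' x)) = (LINT x|lebesgue. norm (us' j x - u' x))"
        by (rule integral_completion[OF measurable_compose[OF d borel_measurable_norm], symmetric])
      also have "\<dots> = (LINT x|lebesgue. norm (us j x - u x))"
      proof (rule integral_cong_AE)
        show "(\<lambda>x. norm (us' j x - u' x)) \<in> borel_measurable lebesgue"
          using measurable_compose[OF d borel_measurable_norm] by (rule measurable_completion)
        show "(\<lambda>x. norm (us j x - u x)) \<in> borel_measurable lebesgue" using i by auto
        show "AE x in lebesgue. norm (us' j x - u' x) = norm (us j x - u x)"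
          using us'(2)[of j] u'(2) by eventually_elim simp
      qed
      also have "\<dots> \<le> sobolev1_norm (?n - 1) (\<lambda>x. us j x - u x)" by (rule sobolev1_norm_ge[OF i])
      finally show "(LINT x|lborel. norm (us' j x - u' x)) \<le> sobolev1_norm (?n - 1) (\<lambda>x. us j x - u x)" .
    qed
  qed (simp add: always_eventually)
  have conv: "(\<lambda>j. vector_integral (\<mu>s j) \<phi>) \<longlonglongrightarrow> vector_integral \<mu> \<phi>" if "\<phi> \<in> test_functions" for \<phi>
    using op_dist_tendsto[OF us'(1) u'(1) L1 that, of ?n B] us'(3) u'(3) that by (simp add: is_op_measure_def)
  have tvc: "(\<lambda>j. tv (\<mu>s j) UNIV) \<longlonglongrightarrow> tv \<mu> UNIV"
    unfolding tv_def
  proof (rule tendsto_enn2real)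
    show "(\<lambda>j. total_variation (\<mu>s j) UNIV) \<longlonglongrightarrow> ennreal (enn2real (total_variation \<mu> UNIV))"
      using strict ennreal_tv[of UNIV] by (simp add: strictly_converges_def \<mu>s_def \<mu>_def tv_def)
  qed simp
  \<comment> \<open>A common bound for the limit and for almost all members of the sequence, so that
    the scale \<open>k\<close> can be chosen independently of j.\<close>
  define V where "V = 2 * real DIM('w) * (tv \<mu> UNIV + 1)"
  have V: "\<forall>\<^sub>F j in sequentially. var (\<mu>s j) UNIV \<le> V"
  proof -
    have "\<forall>\<^sub>F j in sequentially. tv (\<mu>s j) UNIV < tv \<mu> UNIV + 1"
      using tvc by (rule order_tendstoD) simp
    then show ?thesis
    proof eventually_elim
      case (elim j)
      have "2 * real DIM('w) * tv (\<mu>s j) UNIV \<le> V" unfolding V_def using elim by (intro mult_left_mono) auto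
      then show ?case using vector_measure.var_le_tv[OF vms, of UNIV j] by simp
    qed
  qed
  have V0: "var \<mu> UNIV \<le> V"
  proof -
    have "2 * real DIM('w) * tv \<mu> UNIV \<le> V" unfolding V_def by (intro mult_left_mono) auto
    then show ?thesis using var_le_tv[of UNIV] by simp
  qed
  have atoms: "var \<mu> {x} = 0" for x by (rule no_atoms[OF u'(1,3) can])
  have key: "\<forall>\<^sub>F j in sequentially. \<forall>x. \<bar>(vs j x - v x) \<bullet> b\<bar> < e" if e: "e > 0" for b e
  proof -
    obtain C where C: "C \<ge> 0" "\<And>u \<mu>. integrable lborel u \<Longrightarrow> is_op_measure ?n B u \<mu> \<Longrightarrow>
      \<exists>w. continuous_on UNIV w \<and> (w \<longlongrightarrow> 0) at_infinity \<and> (AE x in lebesgue. w x = ?m * (b \<bullet> u x)) \<and>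
      (\<forall>x r k. r > 0 \<longrightarrow> \<bar>w x - lowpass (\<lambda>y. b \<bullet> u y) k x\<bar> \<le> C * (var \<mu> (ball x r) + var \<mu> UNIV / (2 ^ k * r)))"
      by (rule continuous_limit_exists[OF ell can, of b]) blast
    have rep: "\<bar>?m * (z x \<bullet> b) - lowpass (\<lambda>y. b \<bullet> h' y) k x\<bar> \<le> C * (var \<nu> (ball x r) + var \<nu> UNIV / (2 ^ k * r))"
      if h: "integrable lborel h'" "is_op_measure ?n B h' \<nu>" "AE x in lebesgue. h x = h' x"
        "continuous_representative h z" "r > 0" for h h' z \<nu> x k r
    proof -
      obtain w where w: "continuous_on UNIV w" "AE x in lebesgue. w x = ?m * (b \<bullet> h' x)"
        "\<And>x r k. r > 0 \<Longrightarrow> \<bar>w x - lowpass (\<lambda>y. b \<bullet> h' y) k x\<bar> \<le> C * (var \<nu> (ball x r) + var \<nu> UNIV / (2 ^ k * r))"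
        using C(2)[OF h(1,2)] by blast
      have z: "continuous_on UNIV z" "AE x in lebesgue. h x = z x"
        using h(4) by (auto simp: continuous_representative_def)
      \<comment> \<open>\<open>w\<close> and the given representative are continuous and agree
        almost everywhere up to the factor, hence everywhere; the estimate for \<open>w\<close> thus
        holds at every point.\<close>
      have "w x = ?m * (z x \<bullet> b)"
      proof (rule AE_eq_continuous_imp_eq[OF w(1)])
        show "continuous_on UNIV (\<lambda>x. ?m * (z x \<bullet> b))" by (intro continuous_intros z)
        show "AE x in lebesgue. w x = ?m * (z x \<bullet> b)"
          using w(2) h(3) z(2) by eventually_elim (simp add: inner_commute)
      qed
      then show ?thesis using w(3)[OF h(5), of x k] by simp
    qed
    \<comment> \<open>Keeps C * d below a fifth of e * ?m, so that the errors of the three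
      comparisons add up to less than e * ?m. Half of \<open>d\<close> goes to the ball and half to
      the far field.\<close>
    define d where "d = e * ?m / (5 * (C + 1))"
    have d: "d > 0" using e m C(1) by (simp add: d_def)
    have Cd: "C * d \<le> e * ?m / 5"
    proof -
      have "C * d \<le> (C + 1) * d" using d by (intro mult_right_mono) auto
      also have "\<dots> = e * ?m / 5"
      proof -
        have "C + 1 \<noteq> 0" using C(1) by linarith
        then show ?thesis
          unfolding d_def times_divide_eq_right mult.commute[of 5] by (rule mult_divide_mult_cancel_left)
      qed
      finally show ?thesis .
    qed
    obtain r1 where r1: "r1 > 0" "\<forall>\<^sub>F j in sequentially. \<forall>x. var (\<mu>s j) (ball x r1) \<le> d / 2"
      by (rule strict_convergence_uniformly_small[OF vms vm conv tvc atoms, of "d / 2"]) (use d in auto)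
    obtain r2 where r2: "r2 > 0" "\<forall>\<^sub>F j::nat in sequentially. \<forall>x. var \<mu> (ball x r2) \<le> d / 2"
      by (rule strict_convergence_uniformly_small[OF vm vm tendsto_const tendsto_const atoms, of "d / 2"]) (use d in auto)
    define r where "r = min r1 r2"
    have r: "r > 0" "r \<le> r1" "r \<le> r2" using r1(1) r2(1) by (auto simp: r_def)
    \<comment> \<open>The scale comes after the radius: it has to make the far field V / (2^k r)
      small for this \<open>r\<close>.\<close>
    obtain k :: nat where k: "V / (2 ^ k * r) < d / 2"
    proof -
      obtain k :: nat where "2 * V / (r * d) < 2 ^ k" using real_arch_pow[of 2] by auto
      then show ?thesis using that[of k] r(1) d by (simp add: field_simps)
    qed
    have bound: "C * (var \<nu> (ball x r) + var \<nu> UNIV / (2 ^ k * r)) \<le> e * ?m / 5"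
      if "vector_measure \<nu>" "var \<nu> (ball x r') \<le> d / 2" "r \<le> r'" "var \<nu> UNIV \<le> V" for \<nu> :: "(real ^ 'n) set \<Rightarrow> 'w" and x r'
    proof -
      have "var \<nu> (ball x r) \<le> var \<nu> (ball x r')"
        by (rule vector_measure.var_mono[OF that(1)]) (use that(3) in auto)
      moreover have "var \<nu> UNIV / (2 ^ k * r) \<le> V / (2 ^ k * r)"
        using that(4) r(1) by (intro divide_right_mono) auto
      ultimately have "var \<nu> (ball x r) + var \<nu> UNIV / (2 ^ k * r) \<le> d" using that(2) k by linarith
      then show ?thesis using mult_left_mono[OF _ C(1)] Cd by (meson order_trans)
    qed
    obtain D where D: "\<And>f g x. integrable lborel f \<Longrightarrow> integrable lborel g \<Longrightarrow>
      \<bar>lowpass f k x - lowpass g k (x :: real ^ 'n)\<bar> \<le> D * (LINT y|lborel. \<bar>f y - g y\<bar>)"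
      by (rule lowpass_diff_bound) blast
    have low: "\<forall>\<^sub>F j in sequentially. \<bar>D\<bar> * (norm b * (LINT x|lborel. norm (us' j x - u' x))) < e * ?m / 5"
    proof -
      have "(\<lambda>j. \<bar>D\<bar> * (norm b * (LINT x|lborel. norm (us' j x - u' x)))) \<longlonglongrightarrow> \<bar>D\<bar> * (norm b * 0)"
        by (intro tendsto_mult tendsto_const L1)
      then show ?thesis using e m by (intro order_tendstoD(2)) auto
    qed
    have r2': "var \<mu> (ball x r2) \<le> d / 2" for x using r2(2) by simp
    show ?thesis
      using r1(2) V low
    proof eventually_elim
      case (elim j)
      show ?case
      proof
        fix x
        let ?p = "lowpass (\<lambda>y. b \<bullet> us' j y) k x" and ?q = "lowpass (\<lambda>y. b \<bullet> u' y) k x"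
        have 1: "\<bar>?m * (vs j x \<bullet> b) - ?p\<bar> \<le> e * ?m / 5"
          using rep[OF us'(1,3,2) vs r(1), of j x k] bound[OF vms elim(1)[rule_format] r(2) elim(2), of x] by linarith
        have 2: "\<bar>?m * (v x \<bullet> b) - ?q\<bar> \<le> e * ?m / 5"
          using rep[OF u'(1,3,2) v r(1), of x k] bound[OF vm r2' r(3) V0, of x] by linarith
        have fi: "integrable lborel (\<lambda>y. b \<bullet> us' j y)" "integrable lborel (\<lambda>y. b \<bullet> u' y)"
          using us'(1) u'(1) by auto
        have di: "integrable lborel (\<lambda>y. us' j y - u' y)" using us'(1) u'(1) by simp
        have "(LINT y|lborel. \<bar>b \<bullet> us' j y - b \<bullet> u' y\<bar>) \<le> (LINT y|lborel. norm b * norm (us' j y - u' y))"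
        proof (rule integral_mono)
          show "integrable lborel (\<lambda>y. \<bar>b \<bullet> us' j y - b \<bullet> u' y\<bar>)" using fi by auto
          show "integrable lborel (\<lambda>y. norm b * norm (us' j y - u' y))" using di by (intro integrable_mult_right integrable_norm)
          show "\<bar>b \<bullet> us' j y - b \<bullet> u' y\<bar> \<le> norm b * norm (us' j y - u' y)" for y
            using Cauchy_Schwarz_ineq2[of b "us' j y - u' y"] by (simp add: inner_diff_right)
        qed
        then have L: "(LINT y|lborel. \<bar>b \<bullet> us' j y - b \<bullet> u' y\<bar>) \<le> norm b * (LINT y|lborel. norm (us' j y - u' y))" by simp
        have "\<bar>?p - ?q\<bar> \<le> D * (LINT y|lborel. \<bar>b \<bullet> us' j y - b \<bullet> u' y\<bar>)" by (rule D[OF fi])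
        also have "\<dots> \<le> \<bar>D\<bar> * (norm b * (LINT y|lborel. norm (us' j y - u' y)))"
          by (intro mult_mono L) auto
        finally have 3: "\<bar>?p - ?q\<bar> < e * ?m / 5" using elim(3) by linarith
        have "\<bar>?m * (vs j x \<bullet> b) - ?m * (v x \<bullet> b)\<bar> < e * ?m"
          using 1 2 3 e m mult_pos_pos[OF e m] by linarith
        then have "\<bar>?m * ((vs j x - v x) \<bullet> b)\<bar> < e * ?m"
          by (simp only: right_diff_distrib inner_diff_left)
        then show "\<bar>(vs j x - v x) \<bullet> b\<bar> < e"
          unfolding abs_mult abs_of_pos[OF m] mult.commute[of e] mult_less_cancel_left_pos[OF m] .
      qed
    qed
  qed
  show ?thesis
  proof (rule uniform_limitI)
    fix e :: real assume e: "e > 0"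
    \<comment> \<open>The norm is at most the sum of the dim V components, each of which is made
      smaller than \<open>d\<close>.\<close>
    define d where "d = e / (real DIM('v))"
    have d: "d > 0" using e by (simp add: d_def)
    have "\<forall>\<^sub>F j in sequentially. \<forall>b\<in>(Basis :: 'v set). \<forall>x. \<bar>(vs j x - v x) \<bullet> b\<bar> < d"
      by (intro eventually_ball_finite ballI key[OF d]) auto
    then show "\<forall>\<^sub>F j in sequentially. \<forall>x\<in>UNIV. dist (vs j x) (v x) < e"
    proof eventually_elim
      case (elim j)
      show ?case
      proof
        fix x
        have "dist (vs j x) (v x) \<le> (\<Sum>b\<in>Basis. \<bar>(vs j x - v x) \<bullet> b\<bar>)"
          unfolding dist_norm by (rule norm_le_l1)
        also have "\<dots> < (\<Sum>b\<in>(Basis :: 'v set). d)"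
          by (rule sum_strict_mono) (use elim in auto)
        also have "\<dots> = e" by (simp add: d_def)
        finally show "dist (vs j x) (v x) < e" .
      qed
    qed
  qed
qed

theorem theorem1p2:
  fixes B :: "('n::finite \<Rightarrow> nat) \<Rightarrow> 'v::euclidean_space \<Rightarrow>\<^sub>L 'w::euclidean_space"
  assumes "elliptic CARD('n) B"
    and "canceling CARD('n) B"
  shows "(\<forall>u \<in> BV CARD('n) B. \<exists>v \<in> C0. continuous_representative u v) \<and>
    (\<forall>us u vs v.
       (\<forall>j. us j \<in> BV CARD('n) B) \<longrightarrow> u \<in> BV CARD('n) B \<longrightarrow>
       strictly_converges CARD('n) B us u \<longrightarrow>
       (\<forall>j. continuous_representative (us j) (vs j)) \<longrightarrow> continuous_representative u v \<longrightarrow>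
       uniform_limit UNIV vs v sequentially)"
  using BV_subset_C0[OF assms] strict_convergence_imp_uniform_limit[OF assms] by blast

end
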